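(* For every real $C\geq 20$ there exists $s_0=s_0(C)$ such that the following holds. Let $s>s_0$ and let $n,k$ be positive integers with $k<\frac{Cn}{3\sqrt{s/\log s}}$. Then the sequence $(f_1,\ldots,f_s)$ with $f_i=\min\big(s-1,\ i + C\sqrt{s\log s}\big)\, n^{k-1}$, $i\in[s]$, is satisfying; that is, whenever $\mathcal F_1,\ldots,\mathcal F_s\subset [n]^k$ satisfy $|\mathcal F_i|> f_i$ for every $i\in[s]$, there exist pairwise disjoint $F_1\in\mathcal F_1,\ldots,F_s\in\mathcal F_s$.
   Context: $[n]=\{1,\ldots,n\}$ and $[n]^k$ is the set of all $k$-tuples $(x_1,\ldots,x_k)$ with $x_j\in[n]$. A tuple $(x_1,\ldots,x_k)$ is identified with the $k$-element set $\{(1,x_1),\ldots,(k,x_k)\}\subset[k]\times[n]$; thus two tuples $x,y$ are disjoint iff $x_j\neq y_j$ for all $j\in[k]$. For families $\mathcal F_1,\ldots,\mathcal F_s\subset[n]^k$, a rainbow matching is a choice of pairwise disjoint $F_1\in\mathcal F_1,\ldots,F_s\in\mathcal F_s$. A sequence of reals $(f_1,\ldots,f_s)$ is satisfying if for all families $\mathcal F_1,\ldots,\mathcal F_s\subset[n]^k$ with $|\mathcal F_i|>f_i$ for each $i$, the families contain a rainbow matching. Here $\log$ denotes the natural logarithm. *)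

theory Defs
  imports Complex_Main "HOL-Library.FuncSet" "HOL-Library.Disjoint_Sets"
begin

definition tuples :: "nat \<Rightarrow> nat \<Rightarrow> (nat \<Rightarrow> nat) set" where
  "tuples n k = {1..k} \<rightarrow>\<^sub>E {1..n}"

text \<open>The \<open>k\<close>-element subset of \<open>[k] \<times> [n]\<close> with which a tuple is identified.\<close>

definition tuple_set :: "nat \<Rightarrow> (nat \<Rightarrow> nat) \<Rightarrow> (nat \<times> nat) set" where
  "tuple_set k x = (\<lambda>j. (j, x j)) ` {1..k}"

definition rainbow_matching ::
  "nat \<Rightarrow> nat \<Rightarrow> (nat \<Rightarrow> (nat \<Rightarrow> nat) set) \<Rightarrow> (nat \<Rightarrow> nat \<Rightarrow> nat) \<Rightarrow> bool" where
  "rainbow_matching k s \<F> F \<longleftrightarrow>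
     (\<forall>i\<in>{1..s}. F i \<in> \<F> i) \<and> disjoint_family_on (\<lambda>i. tuple_set k (F i)) {1..s}"

text \<open>Only the values of \<open>f\<close> and \<open>\<F>\<close> on \<open>{1..s}\<close> matter.\<close>

definition satisfying :: "nat \<Rightarrow> nat \<Rightarrow> nat \<Rightarrow> (nat \<Rightarrow> real) \<Rightarrow> bool" where
  "satisfying n k s f \<longleftrightarrow>
     (\<forall>\<F> :: nat \<Rightarrow> (nat \<Rightarrow> nat) set.
        (\<forall>i\<in>{1..s}. \<F> i \<subseteq> tuples n k \<and> real (card (\<F> i)) > f i) \<longrightarrow>
        (\<exists>F. rainbow_matching k s \<F> F))"

lemma tuple_set_disjnt_iff:
  "disjnt (tuple_set k x) (tuple_set k y) \<longleftrightarrow> (\<forall>j\<in>{1..k}. x j \<noteq> y j)"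
  by (auto simp: tuple_set_def disjnt_def)

end

theory Submission
  imports Defs "HOL-Real_Asymp.Real_Asymp"
begin

text \<open>Write \<open>t = C * sqrt (s * ln s)\<close> and let \<open>M\<close> be a random perfect matching of \<open>[n]^k\<close>. The number of members of
  the \<open>i\<close>-th family \<open>F i\<close> in \<open>M\<close> has expectation \<open>|F i| / n^(k-1)\<close> and deviates from it by \<open>t / 2\<close> with probability
  less than \<open>s^(-8)\<close>. So, typically, a family with \<open>i + t < s - 1\<close> has more than \<open>i\<close> members in \<open>M\<close>, and each of the
  remaining (at least \<open>t + 1\<close>) tight families has \<open>s - 1 \<plusminus> t / 2\<close> of them. If there is no rainbow matching in such an
  \<open>M\<close>, then counting shows that the tight families have at most \<open>s - 1\<close> members in \<open>M\<close> on average, with equality only if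
  each of them has exactly \<open>s - 1\<close>, and then all families agree with subfamilies of \<open>F s\<close> on \<open>M\<close>. As the expectations
  of the tight families exceed \<open>s - 1\<close>, this equality case must hold with probability close to 1.

  Hence all families are almost contained in \<open>F s\<close>, and \<open>|F s \<inter> M|\<close> has tiny variance. The variance controls the
  Fourier weight of \<open>F s\<close> above level 1, so \<open>F s\<close> is close to the family of all tuples that meet a set \<open>S\<close> of
  \<open>s - 1\<close> vertices. Since \<open>|F s| > (s - 1) n^(k-1)\<close>, some \<open>G \<in> F s\<close> misses \<open>S\<close>. In a random perfect matching containing
  \<open>G\<close>, the tight families contain all \<open>s - 1\<close> tuples that meet \<open>S\<close>. Every other family loses at most
  \<open>(s - 1) k / n \<le> t / 3\<close> in expectation, as only tuples that meet both \<open>S\<close> and \<open>G\<close> are lost, so it still has \<open>i\<close>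
  members. Giving \<open>G\<close> to \<open>F s\<close>, one serves the other families greedily.\<close>

subsection \<open>Averages over boards\<close>

text \<open>The tails must be polynomially small because the stars are counted exactly. A bad
  matching has probability at most \<open>\<zeta>\<close> <= s^(-7); this becomes bounds of order
  s^(-4) for the mean square deviation of \<open>Fam s\<close> and for the defects of containment.
  Only errors that stay below 1 in total allow the conclusion that there are s - 1 stars and that
  some matching contains all their tuples. With b = t / 2 the choice \<theta> = b / (6 s) minimises
  3 \<theta>^2 s - \<theta> b, so a deviation by b has probability about exp(- b^2 / (12 s)) = s^(-
  C^2 / 48). A union over 2 s events has to leave s^(-7), which needs C^2 > 384 and explains C >=
  20. The 3 in the bound for k limits the loss near G to 2 b / 3, so that a surplus of 2 b stays
  above b even after a further loss of about 2. Nothing bounds n from above in terms of s, and k may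
  grow with n. Hence two arguments produce the stars. For n <= s^3 all of them lie in one column.
  For larger n they may be spread over many columns, but then tuples that meet two of them are
  rare.\<close>

definition avg :: "'a set \<Rightarrow> ('a \<Rightarrow> real) \<Rightarrow> real" where
  "avg A g = (\<Sum>a\<in>A. g a) / real (card A)"

lemma avg_cong: "(\<And>a. a \<in> A \<Longrightarrow> g a = h a) \<Longrightarrow> avg A g = avg A h"
  by (simp add: avg_def)

lemma avg_mono: "(\<And>a. a \<in> A \<Longrightarrow> g a \<le> h a) \<Longrightarrow> avg A g \<le> avg A h"
  by (simp add: avg_def divide_right_mono sum_mono)

lemma avg_const [simp]: "finite A \<Longrightarrow> A \<noteq> {} \<Longrightarrow> avg A (\<lambda>_. c) = c"
  by (simp add: avg_def)

lemma avg_add: "avg A (\<lambda>a. g a + h a) = avg A g + avg A h"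
  by (simp add: avg_def sum.distrib add_divide_distrib)

lemma avg_diff: "avg A (\<lambda>a. g a - h a) = avg A g - avg A h"
  by (simp add: avg_def sum_subtractf diff_divide_distrib)

lemma avg_cmult: "avg A (\<lambda>a. c * g a) = c * avg A g"
  by (simp add: avg_def sum_distrib_left)

lemma avg_multc: "avg A (\<lambda>a. g a * c) = avg A g * c"
  by (simp add: avg_def sum_distrib_right)

lemma avg_nonneg: "(\<And>a. a \<in> A \<Longrightarrow> 0 \<le> g a) \<Longrightarrow> 0 \<le> avg A g"
  by (simp add: avg_def sum_nonneg)

lemma avg_swap: "avg A (\<lambda>a. avg B (\<lambda>b. g a b)) = avg B (\<lambda>b. avg A (\<lambda>a. g a b))"
  unfolding avg_def
  by (simp add: sum_divide_distrib[symmetric] sum.swap[of _ A B] mult.commute)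

lemma avg_abs: "\<bar>avg A g\<bar> \<le> avg A (\<lambda>a. \<bar>g a\<bar>)"
  by (simp add: avg_def abs_divide divide_right_mono)

lemma avg_singleton [simp]: "avg {a} g = g a"
  by (simp add: avg_def)

lemma avg_remove:
  assumes "finite A" "card A = m" "m \<ge> 2" "a \<in> A"
  shows "real (m - 1) * avg (A - {a}) g = real m * avg A g - g a"
proof -
  have "real (card (A - {a})) = real (m - 1)" using assms by simp
  then show ?thesis using assms sum.remove[of A a g] by (simp add: avg_def)
qed

lemma avg_centered_square:
  assumes "finite A" "A \<noteq> {}"
  shows "avg A (\<lambda>a. (g a - avg A g)\<^sup>2) = avg A (\<lambda>a. (g a)\<^sup>2) - (avg A g)\<^sup>2"
proof -
  have "avg A (\<lambda>a. (g a - avg A g)\<^sup>2)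
      = avg A (\<lambda>a. ((g a)\<^sup>2 - 2 * avg A g * g a) + (avg A g)\<^sup>2)"
    by (intro avg_cong) (simp add: power2_eq_square algebra_simps)
  also have "\<dots> = avg A (\<lambda>a. (g a)\<^sup>2) - (avg A g)\<^sup>2"
    using assms by (simp add: avg_add avg_diff avg_cmult power2_eq_square)
  finally show ?thesis .
qed

lemma avg_square_le:
  assumes "finite A" "A \<noteq> {}"
  shows "(avg A g)\<^sup>2 \<le> avg A (\<lambda>a. (g a)\<^sup>2)"
  using avg_centered_square[OF assms, of g] avg_nonneg[of A "\<lambda>a. (g a - avg A g)\<^sup>2"] by simp

text \<open>A tuple is a list, and a board is the list of the sets from which its entries are taken. Striking a
  tuple from a board of side \<open>m\<close> leaves a board of side \<open>m - 1\<close>, the tuples of which are those disjoint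
  from it.\<close>

definition board :: "nat \<Rightarrow> 'a set list \<Rightarrow> bool" where
  "board m As \<longleftrightarrow> (\<forall>A\<in>set As. finite A \<and> card A = m)"

lemma board_Nil [simp]: "board m []" by (simp add: board_def)

lemma board_Cons [simp]: "board m (A # As) \<longleftrightarrow> finite A \<and> card A = m \<and> board m As"
  by (auto simp: board_def)

definition fits :: "'a list \<Rightarrow> 'a set list \<Rightarrow> bool" where
  "fits x As \<longleftrightarrow> list_all2 (\<in>) x As"

lemma fits_Nil [simp]: "fits x [] \<longleftrightarrow> x = []"
  by (simp add: fits_def)

lemma fits_Cons: "fits x (A # As) \<longleftrightarrow> (\<exists>a y. x = a # y \<and> a \<in> A \<and> fits y As)"
  by (auto simp: fits_def list_all2_Cons2)

lemma fits_Cons_Cons [simp]: "fits (a # y) (A # As) \<longleftrightarrow> a \<in> A \<and> fits y As"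
  by (simp add: fits_def)

lemma fits_length: "fits x As \<Longrightarrow> length x = length As"
  by (simp add: fits_def list_all2_lengthD)

lemma fits_iff: "fits x As \<longleftrightarrow> length x = length As \<and> (\<forall>j<length As. x ! j \<in> As ! j)"
  by (auto simp: fits_def list_all2_conv_all_nth)

text \<open>Iterated averaging rather than a sum over fitting tuples: the identities become
  inductions on the columns, and columns of different sizes are allowed, which the slices in
  \<open>degree\<close> use.\<close>

primrec bmean :: "'a set list \<Rightarrow> ('a list \<Rightarrow> real) \<Rightarrow> real" where
  "bmean [] f = f []"
| "bmean (A # As) f = avg A (\<lambda>a. bmean As (\<lambda>x. f (a # x)))"

lemma bmean_cong: "(\<And>x. fits x As \<Longrightarrow> f x = g x) \<Longrightarrow> bmean As f = bmean As g"
proof (induction As arbitrary: f g)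
  case (Cons A As)
  have "bmean As (\<lambda>x. f (a # x)) = bmean As (\<lambda>x. g (a # x))" if "a \<in> A" for a
    using that by (intro Cons.IH Cons.prems) simp
  then show ?case unfolding bmean.simps by (rule avg_cong)
qed simp

lemma bmean_mono: "(\<And>x. fits x As \<Longrightarrow> f x \<le> g x) \<Longrightarrow> bmean As f \<le> bmean As g"
proof (induction As arbitrary: f g)
  case (Cons A As)
  have "bmean As (\<lambda>x. f (a # x)) \<le> bmean As (\<lambda>x. g (a # x))" if "a \<in> A" for a
    using that by (intro Cons.IH Cons.prems) simp
  then show ?case unfolding bmean.simps by (rule avg_mono)
qed simp

lemma bmean_add: "bmean As (\<lambda>x. f x + g x) = bmean As f + bmean As g"
  by (induction As arbitrary: f g) (auto simp: avg_add)

lemma bmean_diff: "bmean As (\<lambda>x. f x - g x) = bmean As f - bmean As g"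
  by (induction As arbitrary: f g) (auto simp: avg_diff)

lemma bmean_cmult: "bmean As (\<lambda>x. c * f x) = c * bmean As f"
  by (induction As arbitrary: f) (auto simp: avg_cmult)

lemma bmean_multc: "bmean As (\<lambda>x. f x * c) = bmean As f * c"
  using bmean_cmult[of As c f] by (simp add: mult.commute)

lemma bmean_const [simp]: "board m As \<Longrightarrow> m > 0 \<Longrightarrow> bmean As (\<lambda>_. c) = c"
proof (induction As)
  case (Cons A As)
  moreover from this have "A \<noteq> {}" by auto
  ultimately show ?case by simp
qed simp

lemma bmean_zero [simp]: "bmean As (\<lambda>_. 0) = 0"
  using bmean_cmult[of As 0 "\<lambda>_. 0"] by simp

lemma bmean_nonneg: "(\<And>x. fits x As \<Longrightarrow> 0 \<le> f x) \<Longrightarrow> 0 \<le> bmean As f"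
  using bmean_mono[of As "\<lambda>_. 0" f] by simp

lemma bmean_sum: "bmean As (\<lambda>x. \<Sum>i\<in>I. f i x) = (\<Sum>i\<in>I. bmean As (f i))"
  by (induction I rule: infinite_finite_induct) (simp_all add: bmean_add)

lemma bmean_avg: "bmean As (\<lambda>x. avg A (\<lambda>a. f a x)) = avg A (\<lambda>a. bmean As (f a))"
  unfolding avg_def divide_inverse by (simp add: bmean_multc bmean_sum)

lemma bmean_le_const: "board m As \<Longrightarrow> m > 0 \<Longrightarrow> (\<And>x. fits x As \<Longrightarrow> f x \<le> c) \<Longrightarrow> bmean As f \<le> c"
  using bmean_mono[of As f "\<lambda>_. c"] by simp

lemma bmean_ge_const: "board m As \<Longrightarrow> m > 0 \<Longrightarrow> (\<And>x. fits x As \<Longrightarrow> c \<le> f x) \<Longrightarrow> c \<le> bmean As f"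
  using bmean_mono[of As "\<lambda>_. c" f] by simp

lemma bmean_centered_square:
  assumes "board m As" "m > 0"
  shows "bmean As (\<lambda>x. (f x - bmean As f)\<^sup>2) = bmean As (\<lambda>x. (f x)\<^sup>2) - (bmean As f)\<^sup>2"
proof -
  have "bmean As (\<lambda>x. (f x - bmean As f)\<^sup>2)
      = bmean As (\<lambda>x. ((f x)\<^sup>2 - 2 * bmean As f * f x) + (bmean As f)\<^sup>2)"
    by (intro bmean_cong) (simp add: power2_eq_square algebra_simps)
  also have "\<dots> = bmean As (\<lambda>x. (f x)\<^sup>2) - (bmean As f)\<^sup>2"
    using assms by (simp add: bmean_add bmean_diff bmean_cmult power2_eq_square)
  finally show ?thesis .
qed

lemma bmean_square_le:
  assumes "board m As" "m > 0"
  shows "(bmean As f)\<^sup>2 \<le> bmean As (\<lambda>x. (f x)\<^sup>2)"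
  using bmean_centered_square[OF assms, of f] bmean_nonneg[of As "\<lambda>x. (f x - bmean As f)\<^sup>2"] by simp

fun strike :: "'a set list \<Rightarrow> 'a list \<Rightarrow> 'a set list" where
  "strike (A # As) (g # G) = (A - {g}) # strike As G"
| "strike _ _ = []"

lemma strike_Nil [simp]: "strike [] G = []" by (cases G) auto

lemma length_strike [simp]: "length (strike As G) = min (length As) (length G)"
  by (induction As G rule: strike.induct) auto

lemma strike_nth: "j < length As \<Longrightarrow> j < length G \<Longrightarrow> strike As G ! j = As ! j - {G ! j}"
proof (induction As G arbitrary: j rule: strike.induct)
  case (1 A As g G j)
  then show ?case by (cases j) auto
qed auto

lemma strike_commute: "strike (strike As G) H = strike (strike As H) G"
proof (induction As arbitrary: G H)
  case (Cons A As)
  then show ?case by (cases G; cases H) auto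
qed simp

lemma board_strike: "board m As \<Longrightarrow> fits G As \<Longrightarrow> board (m - 1) (strike As G)"
  by (induction As G rule: strike.induct) auto

lemma fits_strike: "fits G As \<Longrightarrow> fits x (strike As G) \<longleftrightarrow> fits x As \<and> list_all2 (\<noteq>) x G"
proof (induction As arbitrary: G x)
  case (Cons A As)
  then show ?case by (cases G; cases x) (auto simp: fits_def)
qed auto

text \<open>The mean over ordered pairs of disjoint tuples. It agrees with striking the first tuple
  and then averaging (\<open>bmean_strike\<close>), but can be seen to be symmetric column by
  column.\<close>

primrec pmean :: "'a set list \<Rightarrow> ('a list \<Rightarrow> 'a list \<Rightarrow> real) \<Rightarrow> real" where
  "pmean [] g = g [] []"
| "pmean (A # As) g = avg A (\<lambda>a. avg (A - {a}) (\<lambda>b. pmean As (\<lambda>x y. g (a # x) (b # y))))"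

lemma bmean_strike:
  "bmean As (\<lambda>G. bmean (strike As G) (g G)) = pmean As g"
proof (induction As arbitrary: g)
  case (Cons A As)
  show ?case by (simp add: Cons.IH[symmetric] bmean_avg)
qed simp

lemma avg_pair_swap:
  assumes "finite A"
  shows "avg A (\<lambda>a. avg (A - {a}) (\<lambda>b. g a b)) = avg A (\<lambda>b. avg (A - {b}) (\<lambda>a. g a b))"
proof -
  define c where "c = real (card A) * real (card A - 1)"
  have *: "avg A (\<lambda>a. avg (A - {a}) (\<lambda>b. h a b)) = (\<Sum>a\<in>A. \<Sum>b\<in>A. if a = b then 0 else h a b) / c" for h
  proof -
    have "avg A (\<lambda>a. avg (A - {a}) (\<lambda>b. h a b)) = (\<Sum>a\<in>A. (\<Sum>b\<in>A-{a}. h a b) / real (card A - 1)) / real (card A)"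
      using assms by (simp add: avg_def)
    also have "\<dots> = (\<Sum>a\<in>A. \<Sum>b\<in>A-{a}. h a b) / c"
      by (simp add: sum_divide_distrib[symmetric] c_def mult.commute)
    also have "(\<Sum>a\<in>A. \<Sum>b\<in>A-{a}. h a b) = (\<Sum>a\<in>A. \<Sum>b\<in>A. if a = b then 0 else h a b)"
      using assms by (intro sum.cong refl sum.mono_neutral_cong_left) auto
    finally show ?thesis .
  qed
  show ?thesis
    unfolding *[of g] *[of "\<lambda>a b. g b a"]
    by (subst sum.swap) (simp add: eq_commute)
qed

lemma pmean_swap:
  assumes "board m As"
  shows "pmean As g = pmean As (\<lambda>x y. g y x)"
  using assms
proof (induction As arbitrary: g)
  case (Cons A As)
  have "pmean (A # As) g = avg A (\<lambda>a. avg (A - {a}) (\<lambda>b. pmean As (\<lambda>x y. g (a # y) (b # x))))"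
    using Cons.prems by (simp, subst Cons.IH) auto
  also have "\<dots> = pmean (A # As) (\<lambda>x y. g y x)"
    using Cons.prems by (simp, subst avg_pair_swap) auto
  finally show ?case .
qed simp

text \<open>The expectation over a uniformly random sequence of \<open>l\<close> pairwise disjoint tuples. On a board of
  side \<open>m\<close> it is meaningful for \<open>l \<le> m\<close> only.\<close>

primrec mexp :: "nat \<Rightarrow> 'a set list \<Rightarrow> ('a list list \<Rightarrow> real) \<Rightarrow> real" where
  "mexp 0 As \<Phi> = \<Phi> []"
| "mexp (Suc l) As \<Phi> = bmean As (\<lambda>G. mexp l (strike As G) (\<lambda>L. \<Phi> (G # L)))"

fun matching :: "'a set list \<Rightarrow> 'a list list \<Rightarrow> bool" where
  "matching As [] = True"
| "matching As (G # L) = (fits G As \<and> matching (strike As G) L)"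

lemma mexp_cong:
  "(\<And>L. matching As L \<Longrightarrow> length L = l \<Longrightarrow> \<Phi> L = \<Psi> L) \<Longrightarrow> mexp l As \<Phi> = mexp l As \<Psi>"
proof (induction l arbitrary: As \<Phi> \<Psi>)
  case (Suc l)
  have "mexp l (strike As G) (\<lambda>L. \<Phi> (G # L)) = mexp l (strike As G) (\<lambda>L. \<Psi> (G # L))"
    if "fits G As" for G
    using that by (intro Suc.IH Suc.prems) simp_all
  then show ?case unfolding mexp.simps by (rule bmean_cong)
qed simp

lemma mexp_mono:
  "(\<And>L. matching As L \<Longrightarrow> length L = l \<Longrightarrow> \<Phi> L \<le> \<Psi> L) \<Longrightarrow> mexp l As \<Phi> \<le> mexp l As \<Psi>"
proof (induction l arbitrary: As \<Phi> \<Psi>)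
  case (Suc l)
  have "mexp l (strike As G) (\<lambda>L. \<Phi> (G # L)) \<le> mexp l (strike As G) (\<lambda>L. \<Psi> (G # L))"
    if "fits G As" for G
    using that by (intro Suc.IH Suc.prems) simp_all
  then show ?case unfolding mexp.simps by (rule bmean_mono)
qed simp

lemma mexp_add: "mexp l As (\<lambda>L. \<Phi> L + \<Psi> L) = mexp l As \<Phi> + mexp l As \<Psi>"
  by (induction l arbitrary: As \<Phi> \<Psi>) (auto simp: bmean_add)

lemma mexp_diff: "mexp l As (\<lambda>L. \<Phi> L - \<Psi> L) = mexp l As \<Phi> - mexp l As \<Psi>"
  by (induction l arbitrary: As \<Phi> \<Psi>) (auto simp: bmean_diff)

lemma mexp_cmult: "mexp l As (\<lambda>L. c * \<Phi> L) = c * mexp l As \<Phi>"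
  by (induction l arbitrary: As \<Phi>) (auto simp: bmean_cmult)

lemma mexp_zero [simp]: "mexp l As (\<lambda>_. 0) = 0"
  using mexp_cmult[of l As 0 "\<lambda>_. 0"] by simp

lemma mexp_sum: "mexp l As (\<lambda>L. \<Sum>i\<in>I. \<Phi> i L) = (\<Sum>i\<in>I. mexp l As (\<Phi> i))"
  by (induction I rule: infinite_finite_induct) (simp_all add: mexp_add)

lemma mexp_const [simp]: "board m As \<Longrightarrow> l \<le> m \<Longrightarrow> mexp l As (\<lambda>_. c) = c"
proof (induction l arbitrary: As m)
  case (Suc l)
  have "mexp (Suc l) As (\<lambda>_. c) = bmean As (\<lambda>_. c)"
    unfolding mexp.simps using Suc.prems
    by (intro bmean_cong Suc.IH[of "m - 1"] board_strike) auto
  also have "\<dots> = c" using Suc.prems by (intro bmean_const[of m]) simp_all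
  finally show ?case .
qed simp

lemma mexp_nonneg: "(\<And>L. matching As L \<Longrightarrow> length L = l \<Longrightarrow> 0 \<le> \<Phi> L) \<Longrightarrow> 0 \<le> mexp l As \<Phi>"
  using mexp_mono[of As l "\<lambda>_. 0" \<Phi>] by simp

lemma mexp_less_obtains:
  assumes "mexp l As \<Phi> < mexp l As \<Psi>"
  obtains L where "matching As L" "length L = l" "\<Phi> L < \<Psi> L"
  using mexp_mono[of As l \<Psi> \<Phi>] assms by (meson not_le)

text \<open>The first two tuples of a random matching are exchangeable, because striking commutes
  and \<open>pmean\<close> is symmetric. After the exchange the tuple to be forgotten is the first
  one on a struck board, where the induction hypothesis applies.\<close>

lemma mexp_tl:
  assumes "board m As" "l < m"
  shows "mexp (Suc l) As (\<lambda>L. \<Phi> (tl L)) = mexp l As \<Phi>"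
  using assms
proof (induction l arbitrary: As m \<Phi>)
  case 0
  then show ?case by simp
next
  case (Suc l)
  have "mexp (Suc (Suc l)) As (\<lambda>L. \<Phi> (tl L))
      = pmean As (\<lambda>G H. mexp l (strike (strike As G) H) (\<lambda>L. \<Phi> (H # L)))"
    by (simp add: bmean_strike)
  also have "\<dots> = pmean As (\<lambda>G H. mexp l (strike (strike As G) H) (\<lambda>L. \<Phi> (G # L)))"
    using Suc.prems(1) by (subst pmean_swap) (simp_all add: strike_commute)
  also have "\<dots> = bmean As (\<lambda>G. mexp (Suc l) (strike As G) (\<lambda>L. \<Phi> (G # tl L)))"
    by (simp add: bmean_strike)
  also have "\<dots> = bmean As (\<lambda>G. mexp l (strike As G) (\<lambda>L. \<Phi> (G # L)))"
    using Suc.prems by (intro bmean_cong Suc.IH[of "m - 1"] board_strike) simp_all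
  finally show ?case by simp
qed

lemma mexp_hd:
  assumes "board m As" "l < m"
  shows "mexp (Suc l) As (\<lambda>L. f (hd L)) = bmean As f"
  unfolding mexp.simps list.sel
proof (intro bmean_cong)
  fix G assume "fits G As"
  then show "mexp l (strike As G) (\<lambda>L. f G) = f G"
    using assms by (intro mexp_const[of "m - 1"] board_strike) simp_all
qed

lemma mexp_drop:
  assumes "board m As" "l + l' \<le> m"
  shows "mexp (l + l') As (\<lambda>L. \<Phi> (drop l L)) = mexp l' As \<Phi>"
  using assms
proof (induction l)
  case (Suc l)
  have "mexp (Suc (l + l')) As (\<lambda>L. \<Phi> (drop l (tl L))) = mexp (l + l') As (\<lambda>L. \<Phi> (drop l L))"
    using Suc.prems by (intro mexp_tl[of m As "l + l'" "\<lambda>L. \<Phi> (drop l L)"]) simp_all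
  with Suc show ?case by (simp add: drop_Suc del: mexp.simps)
qed simp

lemma mexp_take:
  assumes "board m As" "l + l' \<le> m"
  shows "mexp (l + l') As (\<lambda>L. \<Phi> (take l L)) = mexp l As \<Phi>"
  using assms
proof (induction l arbitrary: As m \<Phi>)
  case 0
  then show ?case by (simp add: mexp_const[of m])
next
  case (Suc l)
  have "mexp (l + l') (strike As G) (\<lambda>L. \<Phi> (G # take l L)) = mexp l (strike As G) (\<lambda>L. \<Phi> (G # L))"
    if "fits G As" for G
    using that Suc.prems
    by (intro Suc.IH[of "m - 1" _ "\<lambda>L. \<Phi> (G # L)"] board_strike) simp_all
  then show ?case unfolding add_Suc mexp.simps take_Suc_Cons by (rule bmean_cong)
qed

definition hits :: "('a list \<Rightarrow> real) \<Rightarrow> 'a list list \<Rightarrow> real" where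
  "hits f L = sum_list (map f L)"

lemma hits_Nil [simp]: "hits f [] = 0" by (simp add: hits_def)
lemma hits_Cons [simp]: "hits f (G # L) = f G + hits f L" by (simp add: hits_def)

lemma hits_hd_tl: "length L = Suc l \<Longrightarrow> hits f L = f (hd L) + hits f (tl L)"
  by (cases L) simp_all

lemma mexp_hits:
  assumes "board m As" "l \<le> m"
  shows "mexp l As (hits f) = real l * bmean As f"
  using assms
proof (induction l)
  case (Suc l)
  have "mexp (Suc l) As (hits f) = mexp (Suc l) As (\<lambda>L. f (hd L) + hits f (tl L))"
    by (intro mexp_cong hits_hd_tl)
  also have "\<dots> = bmean As f + mexp l As (hits f)"
    unfolding mexp_add using Suc.prems by (simp only: mexp_tl[of m] mexp_hd[of m] Suc_le_eq)
  finally show ?case using Suc by (simp add: algebra_simps)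
qed simp

lemma mexp_hits_square:
  assumes "board m As" "l \<le> m" and f01: "\<And>x. f x * f x = f x"
  shows "mexp l As (\<lambda>L. (hits f L)\<^sup>2)
       = real l * bmean As f + real l * (real l - 1) * pmean As (\<lambda>x y. f x * f y)"
  using assms(1,2)
proof (induction l)
  case (Suc l)
  have 1: "mexp (Suc l) As (\<lambda>L. f (hd L) * hits f (tl L)) = real l * pmean As (\<lambda>x y. f x * f y)"
  proof -
    have "mexp l (strike As G) (\<lambda>L. f G * hits f L) = real l * bmean (strike As G) (\<lambda>H. f G * f H)"
      if "fits G As" for G
      using Suc.prems
      by (subst mexp_cmult, subst mexp_hits[OF board_strike[OF _ that]]) (auto simp: bmean_cmult)
    then have "mexp (Suc l) As (\<lambda>L. f (hd L) * hits f (tl L))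
        = bmean As (\<lambda>G. real l * bmean (strike As G) (\<lambda>H. f G * f H))"
      unfolding mexp.simps list.sel by (rule bmean_cong)
    then show ?thesis by (subst (asm) bmean_cmult, subst (asm) bmean_strike)
  qed
  have "(hits f L)\<^sup>2 = f (hd L) + 2 * (f (hd L) * hits f (tl L)) + (hits f (tl L))\<^sup>2"
    if "length L = Suc l" for L
    by (simp add: hits_hd_tl[OF that] power2_sum f01 power2_eq_square[of "f (hd L)"])
  then have "mexp (Suc l) As (\<lambda>L. (hits f L)\<^sup>2)
      = mexp (Suc l) As (\<lambda>L. f (hd L) + 2 * (f (hd L) * hits f (tl L)) + (hits f (tl L))\<^sup>2)"
    by (intro mexp_cong)
  also have "\<dots> = bmean As f + 2 * (real l * pmean As (\<lambda>x y. f x * f y))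
       + mexp l As (\<lambda>L. (hits f L)\<^sup>2)"
    unfolding mexp_add mexp_cmult 1 using Suc.prems
    by (simp only: mexp_tl[of m _ _ "\<lambda>L. (hits f L)\<^sup>2"] mexp_hd[of m] Suc_le_eq)
  finally show ?case using Suc by (simp add: algebra_simps)
qed simp

subsection \<open>The spectrum of the disjointness relation\<close>

text \<open>\<open>level1\<close> is the squared norm of the projection of \<open>f\<close> to the sums of functions of one coordinate
  with mean zero.\<close>

definition degree :: "'a set list \<Rightarrow> ('a list \<Rightarrow> real) \<Rightarrow> nat \<Rightarrow> 'a \<Rightarrow> real" where
  "degree As f j v = bmean (As[j := {v}]) f"

definition level1 :: "'a set list \<Rightarrow> ('a list \<Rightarrow> real) \<Rightarrow> real" where
  "level1 As f = (\<Sum>j<length As. avg (As ! j) (\<lambda>v. (degree As f j v - bmean As f)\<^sup>2))"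

lemma level1_Nil [simp]: "level1 [] f = 0"
  by (simp add: level1_def)

lemma level1_Cons:
  "level1 (A # As) f = avg A (\<lambda>a. (bmean As (\<lambda>x. f (a # x)) - bmean (A # As) f)\<^sup>2)
     + level1 As (\<lambda>x. avg A (\<lambda>a. f (a # x)))"
proof -
  have "degree (A # As) f (Suc j) v = degree As (\<lambda>x. avg A (\<lambda>a. f (a # x))) j v" for j v
    by (simp add: degree_def bmean_avg)
  moreover have "degree (A # As) f 0 a = bmean As (\<lambda>x. f (a # x))" for a
    by (simp add: degree_def)
  ultimately show ?thesis
    by (simp add: level1_def sum.lessThan_Suc_shift bmean_avg del: sum.lessThan_Suc)
qed

lemma avg_pair_remove:
  assumes "finite A" "card A = m" "m \<ge> 2"
  shows "avg A (\<lambda>a. avg (A - {a}) (h a)) = (real m * avg A (\<lambda>a. avg A (h a)) - avg A (\<lambda>a. h a a)) / real (m - 1)"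
proof -
  have "avg (A - {a}) (h a) = (real m * avg A (h a) - h a a) / real (m - 1)" if "a \<in> A" for a
    using avg_remove[OF assms that, of "h a"] assms by (simp add: field_simps)
  then have "avg A (\<lambda>a. avg (A - {a}) (h a)) = avg A (\<lambda>a. (real m * avg A (h a) - h a a) / real (m - 1))"
    by (rule avg_cong)
  also have "\<dots> = (real m * avg A (\<lambda>a. avg A (h a)) - avg A (\<lambda>a. h a a)) / real (m - 1)"
    unfolding divide_inverse avg_multc avg_diff avg_cmult ..
  finally show ?thesis .
qed

lemma pmean_diff: "pmean As (\<lambda>x y. g x y - h x y) = pmean As g - pmean As h"
  by (simp add: bmean_strike[symmetric] bmean_diff)

lemma pmean_avg: "pmean As (\<lambda>x y. avg A (\<lambda>a. h a x y)) = avg A (\<lambda>a. pmean As (h a))"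
  by (simp add: bmean_strike[symmetric] bmean_avg)

abbreviation qform :: "'a set list \<Rightarrow> ('a list \<Rightarrow> real) \<Rightarrow> real" where
  "qform As f \<equiv> pmean As (\<lambda>x y. f x * f y)"

text \<open>On a single column, averaging over the entries other than \<open>a\<close> has
  eigenvalue 1 on constants and -1 / (m - 1) on functions with mean zero. Accordingly
  \<open>f\<close> is split into its average \<open>fb\<close> over the first entry and the
  deviations from it.\<close>

lemma qform_Cons:
  assumes "finite A" "card A = m" "m \<ge> 2"
  defines "fb \<equiv> (\<lambda>f x. avg A (\<lambda>a. f (a # x)))"
  shows "qform (A # As) f = qform As (fb f)
     - avg A (\<lambda>a. qform As (\<lambda>x. f (a # x) - fb f x)) / real (m - 1)"
proof -
  have A: "A \<noteq> {}" using assms by auto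
  have 1: "qform As (fb f) = avg A (\<lambda>a. avg A (\<lambda>b. pmean As (\<lambda>x y. f (a # x) * f (b # y))))"
  proof -
    have "fb f x * fb f y = avg A (\<lambda>a. avg A (\<lambda>b. f (a # x) * f (b # y)))" for x y
      by (simp add: fb_def avg_cmult avg_multc)
    then show ?thesis by (simp add: pmean_avg)
  qed
  have 2: "avg A (\<lambda>a. qform As (\<lambda>x. f (a # x) - fb f x))
      = avg A (\<lambda>a. pmean As (\<lambda>x y. f (a # x) * f (a # y))) - qform As (fb f)"
  proof -
    have "avg A (\<lambda>a. (f (a # x) - fb f x) * (f (a # y) - fb f y))
        = avg A (\<lambda>a. f (a # x) * f (a # y)) - fb f x * fb f y" for x y
    proof -
      have "avg A (\<lambda>a. (f (a # x) - fb f x) * (f (a # y) - fb f y))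
          = avg A (\<lambda>a. f (a # x) * f (a # y) - fb f x * f (a # y) - f (a # x) * fb f y + fb f x * fb f y)"
        by (intro avg_cong) (simp add: algebra_simps)
      also have "\<dots> = avg A (\<lambda>a. f (a # x) * f (a # y)) - fb f x * fb f y"
        using assms(1) A unfolding avg_add avg_diff avg_cmult avg_multc
        by (simp add: fb_def)
      finally show ?thesis .
    qed
    then show ?thesis by (simp add: pmean_avg[symmetric] pmean_diff[symmetric])
  qed
  have m: "real m = real (m - 1) + 1" "real (m - 1) > 0" using assms(3) by auto
  have "qform (A # As) f = (real m * qform As (fb f)
      - avg A (\<lambda>a. pmean As (\<lambda>x y. f (a # x) * f (a # y)))) / real (m - 1)"
    unfolding 1 pmean.simps by (subst avg_pair_remove[OF assms(1-3)]) simp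
  then show ?thesis unfolding 2 m(1) using m(2) by (simp add: field_simps)
qed

lemma bmean_avg_square:
  assumes "finite A" "A \<noteq> {}"
  shows "bmean (A # As) (\<lambda>x. (f x)\<^sup>2) = bmean As (\<lambda>x. (avg A (\<lambda>a. f (a # x)))\<^sup>2)
     + avg A (\<lambda>a. bmean As (\<lambda>x. (f (a # x) - avg A (\<lambda>a. f (a # x)))\<^sup>2))"
proof -
  have "avg A (\<lambda>a. (f (a # x))\<^sup>2) = (avg A (\<lambda>a. f (a # x)))\<^sup>2
      + avg A (\<lambda>a. (f (a # x) - avg A (\<lambda>a. f (a # x)))\<^sup>2)" for x
    using avg_centered_square[OF assms, of "\<lambda>a. f (a # x)"] by simp
  then show ?thesis by (simp add: bmean_avg[symmetric] bmean_add[symmetric])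
qed

text \<open>Disjointness has an eigenvalue of modulus at most 1 / (m - 1) on everything orthogonal
  to the constants. For the deviations in the first column the weaker bound 1 suffices, as
  \<open>qform_Cons\<close> already supplies a factor 1 / (m - 1).\<close>

lemma qform_mean_bound:
  assumes "board m As" "m \<ge> 2"
  shows "\<bar>qform As f - (bmean As f)\<^sup>2\<bar> \<le> (bmean As (\<lambda>x. (f x)\<^sup>2) - (bmean As f)\<^sup>2) / real (m - 1)"
  using assms(1)
proof (induction As arbitrary: f)
  case (Cons A As)
  define fb where "fb = (\<lambda>x. avg A (\<lambda>a. f (a # x)))"
  define c where "c = 1 / real (m - 1)"
  have c: "0 \<le> c" "c \<le> 1" using assms(2) by (auto simp: c_def)
  have A: "finite A" "card A = m" "A \<noteq> {}" and As: "board m As" using Cons.prems assms(2) by auto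
  have al: "bmean (A # As) f = bmean As fb" by (simp add: fb_def bmean_avg)
  have "\<bar>qform As (\<lambda>x. f (a # x) - fb x)\<bar> \<le> bmean As (\<lambda>x. (f (a # x) - fb x)\<^sup>2)" for a
  proof -
    define u where "u = (\<lambda>x. f (a # x) - fb x)"
    have "\<bar>qform As u - (bmean As u)\<^sup>2\<bar> \<le> c * (bmean As (\<lambda>x. (u x)\<^sup>2) - (bmean As u)\<^sup>2)"
      using Cons.IH[OF As, of u] by (simp add: c_def)
    also have "\<dots> \<le> 1 * (bmean As (\<lambda>x. (u x)\<^sup>2) - (bmean As u)\<^sup>2)"
      using c bmean_square_le[OF As, of u] assms(2) by (intro mult_right_mono) auto
    finally have *: "\<bar>qform As u - (bmean As u)\<^sup>2\<bar> \<le> 1 * (bmean As (\<lambda>x. (u x)\<^sup>2) - (bmean As u)\<^sup>2)" .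
    have "\<bar>q\<bar> \<le> B" if "\<bar>q - S\<bar> \<le> 1 * (B - S)" "0 \<le> S" for q S B :: real
      using that by (simp add: abs_le_iff)
    from this[OF *] have "\<bar>qform As u\<bar> \<le> bmean As (\<lambda>x. (u x)\<^sup>2)" by simp
    then show ?thesis by (simp add: u_def)
  qed
  then have 1: "\<bar>avg A (\<lambda>a. qform As (\<lambda>x. f (a # x) - fb x))\<bar>
      \<le> avg A (\<lambda>a. bmean As (\<lambda>x. (f (a # x) - fb x)\<^sup>2))"
    by (intro order_trans[OF avg_abs] avg_mono)
  have "qform (A # As) f - (bmean (A # As) f)\<^sup>2
      = (qform As fb - (bmean As fb)\<^sup>2) - c * avg A (\<lambda>a. qform As (\<lambda>x. f (a # x) - fb x))"
    using qform_Cons[OF A(1,2) assms(2), of As f] by (simp add: al fb_def c_def del: bmean.simps pmean.simps)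
  then have "\<bar>qform (A # As) f - (bmean (A # As) f)\<^sup>2\<bar>
      \<le> \<bar>qform As fb - (bmean As fb)\<^sup>2\<bar> + c * \<bar>avg A (\<lambda>a. qform As (\<lambda>x. f (a # x) - fb x))\<bar>"
    using abs_triangle_ineq4[of _ "c * _"] c(1) by (simp add: abs_mult del: bmean.simps pmean.simps)
  also have "\<dots> \<le> c * (bmean As (\<lambda>x. (fb x)\<^sup>2) - (bmean As fb)\<^sup>2)
      + c * avg A (\<lambda>a. bmean As (\<lambda>x. (f (a # x) - fb x)\<^sup>2))"
    using Cons.IH[OF As, of fb] 1 c(1) by (intro add_mono mult_left_mono) (simp_all add: c_def)
  also have "\<dots> = c * (bmean (A # As) (\<lambda>x. (f x)\<^sup>2) - (bmean (A # As) f)\<^sup>2)"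
    unfolding al bmean_avg_square[OF A(1,3), of As f] by (simp add: fb_def algebra_simps)
  finally show ?case by (simp add: c_def)
qed (simp add: power2_eq_square)

text \<open>The eigenvalue on level l is (-1 / (m - 1))^l: level 1 contributes exactly
  \<open>- level1 As f / (m - 1)\<close>, and the higher levels at most 1 / (m - 1)^2 times their
  weight. In the induction, the means of the deviations belong to level 1, and the rest of the
  deviations gains its second factor from \<open>qform_mean_bound\<close>.\<close>

lemma qform_level1_bound:
  assumes "board m As" "m \<ge> 2"
  shows "\<bar>qform As f - (bmean As f)\<^sup>2 + level1 As f / real (m - 1)\<bar>
     \<le> (bmean As (\<lambda>x. (f x)\<^sup>2) - (bmean As f)\<^sup>2 - level1 As f) / (real (m - 1))\<^sup>2"
  using assms(1)
proof (induction As arbitrary: f)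
  case (Cons A As)
  define fb where "fb = (\<lambda>x. avg A (\<lambda>a. f (a # x)))"
  define c where "c = 1 / real (m - 1)"
  have c: "0 \<le> c" using assms(2) by (auto simp: c_def)
  have A: "finite A" "card A = m" "A \<noteq> {}" and As: "board m As" using Cons.prems assms(2) by auto
  have al: "bmean (A # As) f = bmean As fb" by (simp add: fb_def bmean_avg)
  define u where "u = (\<lambda>a x. f (a # x) - fb x)"
  have bu: "bmean As (u a) = bmean As (\<lambda>x. f (a # x)) - bmean As fb" for a
    by (simp add: u_def bmean_diff)
  have l1: "level1 (A # As) f = avg A (\<lambda>a. (bmean As (u a))\<^sup>2) + level1 As fb"
    unfolding level1_Cons al bu by (simp add: fb_def)
  have q: "qform (A # As) f = qform As fb - c * avg A (\<lambda>a. qform As (u a))"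
    using qform_Cons[OF A(1,2) assms(2), of As f] by (simp add: fb_def c_def u_def del: bmean.simps pmean.simps)
  have sq: "bmean (A # As) (\<lambda>x. (f x)\<^sup>2) = bmean As (\<lambda>x. (fb x)\<^sup>2) + avg A (\<lambda>a. bmean As (\<lambda>x. (u a x)\<^sup>2))"
    unfolding bmean_avg_square[OF A(1,3), of As f] fb_def u_def ..
  have 1: "\<bar>avg A (\<lambda>a. qform As (u a) - (bmean As (u a))\<^sup>2)\<bar>
      \<le> c * avg A (\<lambda>a. bmean As (\<lambda>x. (u a x)\<^sup>2) - (bmean As (u a))\<^sup>2)"
    unfolding avg_cmult[symmetric]
    using qform_mean_bound[OF As assms(2)]
    by (intro order_trans[OF avg_abs] avg_mono) (simp add: c_def)
  have "qform (A # As) f - (bmean (A # As) f)\<^sup>2 + c * level1 (A # As) f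
      = (qform As fb - (bmean As fb)\<^sup>2 + c * level1 As fb)
        - c * avg A (\<lambda>a. qform As (u a) - (bmean As (u a))\<^sup>2)"
    unfolding q l1 al avg_diff by (simp add: algebra_simps)
  then have "\<bar>qform (A # As) f - (bmean (A # As) f)\<^sup>2 + c * level1 (A # As) f\<bar>
      \<le> \<bar>qform As fb - (bmean As fb)\<^sup>2 + c * level1 As fb\<bar>
        + c * \<bar>avg A (\<lambda>a. qform As (u a) - (bmean As (u a))\<^sup>2)\<bar>"
    using abs_triangle_ineq4[of _ "c * _"] c by (simp add: abs_mult del: bmean.simps pmean.simps)
  also have "\<dots> \<le> c\<^sup>2 * (bmean As (\<lambda>x. (fb x)\<^sup>2) - (bmean As fb)\<^sup>2 - level1 As fb)
      + c * (c * avg A (\<lambda>a. bmean As (\<lambda>x. (u a x)\<^sup>2) - (bmean As (u a))\<^sup>2))"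
    using Cons.IH[OF As, of fb] 1 c
    by (intro add_mono mult_left_mono) (simp_all add: c_def power_one_over)
  also have "\<dots> = c\<^sup>2 * (bmean (A # As) (\<lambda>x. (f x)\<^sup>2) - (bmean (A # As) f)\<^sup>2 - level1 (A # As) f)"
    unfolding al l1 sq avg_diff by (simp add: algebra_simps power2_eq_square)
  finally show ?case by (simp add: c_def power_one_over)
qed (simp add: power2_eq_square)

section \<open>Slices, vertex degrees and the linear part\<close>

lemma bmean_slice:
  assumes "j < length As"
  shows "bmean As f = avg (As ! j) (\<lambda>v. bmean (As[j := {v}]) f)"
  using assms
proof (induction As arbitrary: f j)
  case (Cons A As)
  show ?case
  proof (cases j)
    case (Suc i)
    then have "bmean As (\<lambda>x. f (a # x)) = avg (As ! i) (\<lambda>v. bmean (As[i := {v}]) (\<lambda>x. f (a # x)))" for a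
      using Cons by auto
    then show ?thesis using Suc by (simp add: avg_swap[of A])
  qed simp
qed simp

lemma fits_slice: "fits x (As[j := {v}]) \<Longrightarrow> j < length As \<Longrightarrow> x ! j = v"
  by (auto simp: fits_iff)

lemma bmean_times_coordinate:
  assumes "j < length As"
  shows "bmean As (\<lambda>x. f x * h (x ! j)) = avg (As ! j) (\<lambda>v. degree As f j v * h v)"
  using assms
  by (subst bmean_slice[OF assms])
     (auto simp: degree_def bmean_multc[symmetric] intro!: avg_cong bmean_cong dest: fits_slice)

text \<open>The orthogonal projection of \<open>f\<close> to level 1.\<close>

definition linpart :: "'a set list \<Rightarrow> ('a list \<Rightarrow> real) \<Rightarrow> 'a list \<Rightarrow> real" where
  "linpart As f x = (\<Sum>j<length As. degree As f j (x ! j) - bmean As f)"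

lemma bmean_times_linpart:
  assumes "board m As" "m > 0"
  shows "bmean As (\<lambda>x. f x * linpart As f x) = level1 As f"
proof -
  have "bmean As (\<lambda>x. f x * linpart As f x)
      = (\<Sum>j<length As. bmean As (\<lambda>x. f x * (degree As f j (x ! j) - bmean As f)))"
    by (simp add: linpart_def sum_distrib_left bmean_sum)
  also have "\<dots> = level1 As f"
    unfolding level1_def
  proof (intro sum.cong refl)
    fix j assume "j \<in> {..<length As}"
    then have j: "j < length As" by simp
    then have Aj: "finite (As ! j)" "As ! j \<noteq> {}" using assms by (auto simp: board_def set_conv_nth)
    have al: "avg (As ! j) (degree As f j) = bmean As f"
      using bmean_slice[OF j] by (simp add: degree_def[abs_def])
    have "bmean As (\<lambda>x. f x * (degree As f j (x ! j) - bmean As f))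
        = avg (As ! j) (\<lambda>v. (degree As f j v)\<^sup>2 - degree As f j v * bmean As f)"
      unfolding bmean_times_coordinate[OF j, of f "\<lambda>v. degree As f j v - bmean As f"]
      by (simp add: power2_eq_square algebra_simps)
    also have "\<dots> = avg (As ! j) (\<lambda>v. (degree As f j v - bmean As f)\<^sup>2)"
      unfolding avg_diff avg_multc al
      using avg_centered_square[OF Aj, of "degree As f j"] by (simp add: al power2_eq_square)
    finally show "bmean As (\<lambda>x. f x * (degree As f j (x ! j) - bmean As f))
        = avg (As ! j) (\<lambda>v. (degree As f j v - bmean As f)\<^sup>2)" .
  qed
  finally show ?thesis .
qed

text \<open>The entries of a random tuple are independent, and up to the third power every mixed
  term contains a lone factor of mean zero. Fourth moments would no longer be additive.\<close>

lemma bmean_centered_sum_moments: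
  assumes "board m As" "m > 0" "\<And>j. j < length As \<Longrightarrow> avg (As ! j) (\<phi> j) = 0"
  defines "lam \<equiv> (\<lambda>x. \<Sum>j<length As. \<phi> j (x ! j))"
  shows "bmean As lam = 0"
    and "bmean As (\<lambda>x. (lam x)\<^sup>2) = (\<Sum>j<length As. avg (As ! j) (\<lambda>v. (\<phi> j v)\<^sup>2))"
    and "bmean As (\<lambda>x. (lam x) ^ 3) = (\<Sum>j<length As. avg (As ! j) (\<lambda>v. (\<phi> j v) ^ 3))"
proof -
  have "bmean As lam = 0 \<and>
     bmean As (\<lambda>x. (lam x)\<^sup>2) = (\<Sum>j<length As. avg (As ! j) (\<lambda>v. (\<phi> j v)\<^sup>2)) \<and>
     bmean As (\<lambda>x. (lam x) ^ 3) = (\<Sum>j<length As. avg (As ! j) (\<lambda>v. (\<phi> j v) ^ 3))"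
    unfolding lam_def using assms(1,3)
  proof (induction As arbitrary: \<phi>)
    case (Cons A As)
    define l where "l = (\<lambda>x. \<Sum>j<length As. \<phi> (Suc j) (x ! j))"
    have A: "finite A" "A \<noteq> {}" and As: "board m As" using Cons.prems assms(2) by auto
    have ph: "avg A (\<phi> 0) = 0" using Cons.prems(2)[of 0] by simp
    have ph': "avg (As ! j) (\<phi> (Suc j)) = 0" if "j < length As" for j
      using Cons.prems(2)[of "Suc j"] that by simp
    have IH: "bmean As l = 0"
       "bmean As (\<lambda>x. (l x)\<^sup>2) = (\<Sum>j<length As. avg (As ! j) (\<lambda>v. (\<phi> (Suc j) v)\<^sup>2))"
       "bmean As (\<lambda>x. (l x) ^ 3) = (\<Sum>j<length As. avg (As ! j) (\<lambda>v. (\<phi> (Suc j) v) ^ 3))"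
      using Cons.IH[OF As, of "\<lambda>j. \<phi> (Suc j)"] ph' by (simp_all add: l_def)
    have cst: "bmean As (\<lambda>x. c) = c" for c using As assms(2) by (rule bmean_const)
    have s: "(\<Sum>j<length (A # As). \<phi> j ((a # x) ! j)) = \<phi> 0 a + l x" for a x
      by (simp add: l_def sum.lessThan_Suc_shift del: sum.lessThan_Suc)
    have e2: "(\<phi> 0 a + l x)\<^sup>2 = (\<phi> 0 a)\<^sup>2 + 2 * \<phi> 0 a * l x + (l x)\<^sup>2" for a x
      by (simp add: power2_eq_square algebra_simps)
    have e3: "(\<phi> 0 a + l x) ^ 3 = (\<phi> 0 a) ^ 3 + 3 * (\<phi> 0 a)\<^sup>2 * l x + 3 * \<phi> 0 a * (l x)\<^sup>2 + (l x) ^ 3" for a x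
      by (simp add: power2_eq_square power3_eq_cube algebra_simps)
    have "bmean (A # As) (\<lambda>x. \<Sum>j<length (A # As). \<phi> j (x ! j)) = 0"
      unfolding bmean.simps s bmean_add cst IH using ph by simp
    moreover have "bmean (A # As) (\<lambda>x. (\<Sum>j<length (A # As). \<phi> j (x ! j))\<^sup>2)
        = avg A (\<lambda>v. (\<phi> 0 v)\<^sup>2) + bmean As (\<lambda>x. (l x)\<^sup>2)"
      unfolding bmean.simps s e2 bmean_add bmean_cmult cst IH(1) avg_add
      using A by simp
    moreover have "bmean (A # As) (\<lambda>x. (\<Sum>j<length (A # As). \<phi> j (x ! j)) ^ 3)
        = avg A (\<lambda>v. (\<phi> 0 v) ^ 3) + bmean As (\<lambda>x. (l x) ^ 3)"
      unfolding bmean.simps s e3 bmean_add bmean_cmult cst IH(1) avg_add avg_multc avg_cmult ph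
      using A by simp
    ultimately show ?case
      unfolding IH(2,3) by (simp add: sum.lessThan_Suc_shift del: sum.lessThan_Suc bmean.simps)
  qed simp
  then show "bmean As lam = 0"
    and "bmean As (\<lambda>x. (lam x)\<^sup>2) = (\<Sum>j<length As. avg (As ! j) (\<lambda>v. (\<phi> j v)\<^sup>2))"
    and "bmean As (\<lambda>x. (lam x) ^ 3) = (\<Sum>j<length As. avg (As ! j) (\<lambda>v. (\<phi> j v) ^ 3))"
    by blast+
qed

lemma mexp_multc: "mexp l As (\<lambda>L. \<Phi> L * c) = mexp l As \<Phi> * c"
  using mexp_cmult[of l As c \<Phi>] by (simp add: mult.commute)

subsection \<open>Exponential moments\<close>

lemma exp_le_quadratic:
  fixes x :: real
  assumes "\<bar>x\<bar> \<le> 1/10"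
  shows "exp x \<le> 1 + x + 3/5 * x\<^sup>2"
proof -
  obtain t where t: "\<bar>t\<bar> \<le> \<bar>x\<bar>" "exp x = (\<Sum>m<2. x ^ m / fact m) + exp t / fact 2 * x ^ 2"
    using Maclaurin_exp_le[of x 2] by blast
  have "exp t \<le> exp (1/10)" using t(1) assms by simp
  also have "\<dots> \<le> 6/5" using exp_bound[of "1/10"] by (simp add: power2_eq_square)
  finally have "exp t / 2 * x\<^sup>2 \<le> 3/5 * x\<^sup>2" by (intro mult_right_mono) auto
  then show ?thesis using t(2) by (simp add: numeral_2_eq_2)
qed

text \<open>Exposing the entries of \<open>G\<close> one by one gives a martingale with increments in \<open>[-1, 1]\<close>. The sum of
  its conditional variances is bounded along every path, not only on average, since the functions that
  describe the increments are orthogonal and a version of Bessel's inequality applies.\<close>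

lemma bmean_strike_mgf:
  assumes "board m As" "m \<ge> 2" "\<And>x. 0 \<le> f x \<and> f x \<le> 1" "\<bar>u\<bar> \<le> 1/10"
  shows "bmean As (\<lambda>G. exp (u * (real (m - 1) * (bmean (strike As G) f - bmean As f))))
     \<le> exp (3/5 * u\<^sup>2 * ((real m / real (m - 1)) ^ length As
            * (bmean As (\<lambda>x. (f x)\<^sup>2) - (bmean As f)\<^sup>2)))"
  using assms(1,3)
proof (induction As arbitrary: f)
  case (Cons A As)
  define \<rho> where "\<rho> = real m / real (m - 1)"
  have \<rho>: "\<rho> \<ge> 1" using assms(2) by (simp add: \<rho>_def)
  have A: "finite A" "card A = m" "A \<noteq> {}" and As: "board m As" using Cons.prems assms(2) by auto
  have m0: "m > 0" using assms(2) by simp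
  define d where "d = (\<lambda>b. bmean As (\<lambda>x. f (b # x)))"
  define \<alpha> where "\<alpha> = bmean (A # As) f"
  have \<alpha>: "\<alpha> = avg A d" by (simp add: \<alpha>_def d_def[abs_def])
  define g where "g = (\<lambda>a x. avg (A - {a}) (\<lambda>b. f (b # x)))"
  define V where "V = (\<lambda>h. bmean As (\<lambda>x. (h x)\<^sup>2) - (bmean As h)\<^sup>2)"
  have V_eq: "V h = bmean As (\<lambda>x. (h x - bmean As h)\<^sup>2)" for h
    using bmean_centered_square[OF As m0, of h] by (simp add: V_def)
  define R where "R = avg A (\<lambda>b. V (\<lambda>x. f (b # x)))"
  define D where "D = avg A (\<lambda>b. (d b - \<alpha>)\<^sup>2)"
  have R0: "0 \<le> R" unfolding R_def V_eq by (intro avg_nonneg bmean_nonneg) simp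
  have D0: "0 \<le> D" unfolding D_def by (intro avg_nonneg) simp
  have d01: "0 \<le> d b \<and> d b \<le> 1" for b
    using Cons.prems(2) bmean_ge_const[OF As m0] bmean_le_const[OF As m0] by (simp add: d_def)
  have \<alpha>01: "0 \<le> \<alpha>" "\<alpha> \<le> 1"
    using d01 avg_nonneg[of A d] avg_mono[of A d "\<lambda>_. 1"] A by (auto simp: \<alpha>)
  have Aa: "finite (A - {a})" "A - {a} \<noteq> {}" if "a \<in> A" for a
  proof -
    have "card (A - {a}) = m - 1" using A that by simp
    then show "A - {a} \<noteq> {}" using assms(2) by (metis One_nat_def card.empty diff_is_0_eq not_less_eq_eq numeral_2_eq_2 le_refl)
  qed (use A in auto)
  have Vf: "bmean (A # As) (\<lambda>x. (f x)\<^sup>2) - (bmean (A # As) f)\<^sup>2 = D + R"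
  proof -
    have "R = bmean (A # As) (\<lambda>x. (f x)\<^sup>2) - avg A (\<lambda>a. (d a)\<^sup>2)"
      by (simp add: R_def V_def avg_diff d_def)
    moreover have "D = avg A (\<lambda>a. (d a)\<^sup>2) - \<alpha>\<^sup>2"
      using avg_centered_square[OF A(1,3), of d] by (simp add: D_def \<alpha>)
    ultimately show ?thesis by (simp add: \<alpha>_def[symmetric] del: bmean.simps)
  qed
  have bg: "bmean B (g a) = avg (A - {a}) (\<lambda>b. bmean B (\<lambda>x. f (b # x)))" for a B
    by (simp add: g_def bmean_avg)
  \<comment> \<open>By convexity, averaging over the first entry does not increase the variance, and
    leaving out one entry of \<open>A\<close> costs at most a factor \<open>\<rho>\<close>. Each
    column adds one such factor to the final bound.\<close>
  have Vg: "V (g a) \<le> \<rho> * R" if a: "a \<in> A" for a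
  proof -
    have "(g a x - bmean As (g a))\<^sup>2 \<le> avg (A - {a}) (\<lambda>b. (f (b # x) - d b)\<^sup>2)" for x
    proof -
      have "g a x - bmean As (g a) = avg (A - {a}) (\<lambda>b. f (b # x) - d b)"
        unfolding g_def d_def bmean_avg avg_diff ..
      then show ?thesis
        using avg_square_le[OF Aa[OF a], of "\<lambda>b. f (b # x) - d b"] by simp
    qed
    then have "V (g a) \<le> avg (A - {a}) (\<lambda>b. V (\<lambda>x. f (b # x)))"
      unfolding V_eq d_def bmean_avg[symmetric] by (intro bmean_mono)
    also have "\<dots> \<le> \<rho> * R"
    proof -
      have "0 \<le> V (\<lambda>x. f (a # x))" unfolding V_eq by (intro bmean_nonneg) simp
      then have "real (m - 1) * avg (A - {a}) (\<lambda>b. V (\<lambda>x. f (b # x))) \<le> real m * R"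
        using avg_remove[OF A(1,2) assms(2) a, of "\<lambda>b. V (\<lambda>x. f (b # x))"] by (simp add: R_def)
      then show ?thesis using assms(2) by (simp add: \<rho>_def field_simps)
    qed
    finally show ?thesis .
  qed
  \<comment> \<open>The degrees of the entries other than \<open>a\<close> add up to m \<alpha> - d
    a. So exposing \<open>a\<close> produces the increment \<alpha> - d a, and what remains is the
    same problem for \<open>g a\<close> on the other columns.\<close>
  have split: "real (m - 1) * (bmean (strike (A # As) (a # G)) f - \<alpha>)
      = (\<alpha> - d a) + real (m - 1) * (bmean (strike As G) (g a) - bmean As (g a))" if a: "a \<in> A" for a G
  proof -
    have 1: "bmean (strike (A # As) (a # G)) f = bmean (strike As G) (g a)"
      by (simp add: bg)
    have 2: "real (m - 1) * bmean As (g a) = real m * \<alpha> - d a"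
      using avg_remove[OF A(1,2) assms(2) a, of d] by (simp add: bg \<alpha> d_def[abs_def])
    have "real m = real (m - 1) + 1" using assms(2) by simp
    then have "real m * \<alpha> = real (m - 1) * \<alpha> + \<alpha>" by (simp only: distrib_right mult_1)
    then show ?thesis unfolding 1 right_diff_distrib 2 by linarith
  qed
  define W where "W = exp (3/5 * u\<^sup>2 * (\<rho> ^ length As * (\<rho> * R)))"
  have g01: "0 \<le> g a x \<and> g a x \<le> 1" if "a \<in> A" for a x
    using Cons.prems(2) avg_nonneg[of "A - {a}" "\<lambda>b. f (b # x)"]
      avg_mono[of "A - {a}" "\<lambda>b. f (b # x)" "\<lambda>_. 1"] Aa[OF that] by (simp add: g_def)
  have inner: "bmean As (\<lambda>G. exp (u * (real (m - 1) * (bmean (strike (A # As) (a # G)) f - \<alpha>))))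
      \<le> exp (u * (\<alpha> - d a)) * W" if a: "a \<in> A" for a
  proof -
    have "bmean As (\<lambda>G. exp (u * (real (m - 1) * (bmean (strike (A # As) (a # G)) f - \<alpha>))))
       = exp (u * (\<alpha> - d a)) * bmean As (\<lambda>G. exp (u * (real (m - 1) * (bmean (strike As G) (g a) - bmean As (g a)))))"
      unfolding split[OF a] distrib_left[of u] exp_add bmean_cmult ..
    also have "\<dots> \<le> exp (u * (\<alpha> - d a)) * exp (3/5 * u\<^sup>2 * (\<rho> ^ length As * V (g a)))"
      using Cons.IH[OF As g01[OF a]] by (intro mult_left_mono) (simp_all add: V_def \<rho>_def)
    also have "\<dots> \<le> exp (u * (\<alpha> - d a)) * W"
      using Vg[OF a] \<rho> unfolding W_def
      by (intro mult_left_mono iffD2[OF exp_le_cancel_iff]) auto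
    finally show ?thesis .
  qed
  have first: "avg A (\<lambda>a. exp (u * (\<alpha> - d a))) \<le> exp (3/5 * u\<^sup>2 * D)"
  proof -
    have "exp (u * (\<alpha> - d a)) \<le> 1 + u * (\<alpha> - d a) + 3/5 * u\<^sup>2 * (d a - \<alpha>)\<^sup>2" for a
    proof -
      have "\<bar>u * (\<alpha> - d a)\<bar> \<le> 1/10 * 1"
        unfolding abs_mult using assms(4) d01[of a] \<alpha>01 by (intro mult_mono) auto
      moreover have "(u * (\<alpha> - d a))\<^sup>2 = u\<^sup>2 * (d a - \<alpha>)\<^sup>2"
        by (simp only: power_mult_distrib power2_commute[of \<alpha>])
      ultimately show ?thesis using exp_le_quadratic[of "u * (\<alpha> - d a)"] by simp
    qed
    then have "avg A (\<lambda>a. exp (u * (\<alpha> - d a))) \<le> avg A (\<lambda>a. 1 + u * (\<alpha> - d a) + 3/5 * u\<^sup>2 * (d a - \<alpha>)\<^sup>2)"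
      by (intro avg_mono)
    also have "\<dots> = 1 + 3/5 * u\<^sup>2 * D"
      unfolding avg_add avg_cmult avg_diff D_def using A by (simp add: \<alpha>)
    also have "\<dots> \<le> exp (3/5 * u\<^sup>2 * D)" by (rule exp_ge_add_one_self)
    finally show ?thesis .
  qed
  have "bmean (A # As) (\<lambda>G. exp (u * (real (m - 1) * (bmean (strike (A # As) G) f - \<alpha>))))
      \<le> avg A (\<lambda>a. exp (u * (\<alpha> - d a)) * W)"
    unfolding bmean.simps(2)[of A As "\<lambda>G. exp (u * (real (m - 1) * (bmean (strike (A # As) G) f - \<alpha>)))"] using inner by (rule avg_mono)
  also have "\<dots> \<le> exp (3/5 * u\<^sup>2 * D) * W"
    unfolding avg_multc using first by (intro mult_right_mono) (auto simp: W_def)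
  also have "\<dots> = exp (3/5 * u\<^sup>2 * (D + \<rho> ^ length (A # As) * R))"
    by (simp add: W_def exp_add[symmetric] algebra_simps)
  also have "\<dots> \<le> exp (3/5 * u\<^sup>2 * (\<rho> ^ length (A # As) * (D + R)))"
  proof -
    have "D \<le> \<rho> ^ length (A # As) * D"
      using D0 \<rho> one_le_power[OF \<rho>, of "length (A # As)"] mult_right_mono[of 1 "\<rho> ^ length (A # As)" D] by simp
    then show ?thesis by (intro iffD2[OF exp_le_cancel_iff] mult_left_mono) (auto simp: distrib_left)
  qed
  finally show ?case unfolding Vf \<alpha>_def \<rho>_def .
qed simp

text \<open>The first tuple \<open>G\<close> acts twice: through \<open>f G\<close>, and through the
  change \<open>D G\<close> of the mean on the struck board, which the induction hypothesis sees.
  The two are dependent, so the product of their exponentials is bounded by half the sum of the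
  squares, and each square has mean at most 1 after normalisation. The side never drops below
  \<open>m0\<close>, which keeps the power of m / (m - 1) bounded.\<close>

lemma mexp_hits_mgf:
  assumes "\<And>x. 0 \<le> f x \<and> f x \<le> 1" "\<bar>\<theta>\<bar> \<le> 1/200" "m0 \<ge> 2"
    and "(real m0 / real (m0 - 1)) ^ k \<le> 51/50"
    and "board m As" "length As = k" "l + m0 \<le> m"
  shows "mexp l As (\<lambda>L. exp (\<theta> * hits f L)) \<le> exp ((\<theta> + 5/2 * \<theta>\<^sup>2) * (real l * bmean As f))"
  using assms(5-)
proof (induction l arbitrary: m As)
  case (Suc l)
  define \<kappa> where "\<kappa> = \<theta> + 5/2 * \<theta>\<^sup>2"
  define \<alpha> where "\<alpha> = bmean As f"
  have m: "m \<ge> 2" "m > 0" using Suc.prems assms(3) by auto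
  note As = Suc.prems(1)
  have \<alpha>0: "0 \<le> \<alpha>" using assms(1) unfolding \<alpha>_def by (intro bmean_nonneg) auto
  define u where "u = \<kappa> * real l / real (m - 1)"
  have \<theta>2: "\<theta>\<^sup>2 \<le> 1/200 * \<bar>\<theta>\<bar>"
    using mult_right_mono[OF assms(2), of "\<bar>\<theta>\<bar>"] by (simp add: power2_eq_square)
  have \<kappa>1: "\<bar>\<kappa>\<bar> \<le> 81/80 * \<bar>\<theta>\<bar>" using \<theta>2 abs_triangle_ineq[of \<theta> "5/2 * \<theta>\<^sup>2"] by (simp add: \<kappa>_def)
  have u1: "\<bar>u\<bar> \<le> \<bar>\<kappa>\<bar>"
  proof -
    have "real l / real (m - 1) \<le> 1" using Suc.prems assms(3) by simp
    then have "\<bar>\<kappa>\<bar> * (real l / real (m - 1)) \<le> \<bar>\<kappa>\<bar> * 1" by (intro mult_left_mono) auto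
    then show ?thesis by (simp add: u_def abs_mult)
  qed
  define D where "D = (\<lambda>G. real (m - 1) * (bmean (strike As G) f - \<alpha>))"
  \<comment> \<open>\<open>p\<close> pays for the tuple \<open>G\<close> itself and \<open>q\<close>
    for the change of the mean. Both constants are computed for doubled exponents, as the squares at
    the end require.\<close>
  define p where "p = \<theta> + 6/5 * \<theta>\<^sup>2"
  define q where "q = 51/50 * (6/5 * u\<^sup>2)"
  have pq: "p + q \<le> \<kappa>"
  proof -
    have "u\<^sup>2 \<le> (81/80 * \<bar>\<theta>\<bar>)\<^sup>2"
      using u1 \<kappa>1 by (intro iffD1[OF abs_le_square_iff]) auto
    then have "u\<^sup>2 \<le> (81/80)\<^sup>2 * \<theta>\<^sup>2" by (simp only: power_mult_distrib power2_abs mult.commute)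
    then have "q \<le> 51/50 * (6/5 * ((81/80)\<^sup>2 * \<theta>\<^sup>2))" unfolding q_def by linarith
    moreover have "(81/80)\<^sup>2 = (6561/6400 :: real)" by (simp add: power2_eq_square)
    ultimately have "q \<le> 51/50 * (6/5 * (6561/6400 * \<theta>\<^sup>2))" by simp
    then show ?thesis using zero_le_power2[of \<theta>] unfolding p_def \<kappa>_def by linarith
  qed
  have e1: "bmean As (\<lambda>G. exp (2 * (\<theta> * f G - p * \<alpha>))) \<le> 1"
  proof -
    have "exp (2 * \<theta> * f G) \<le> 1 + 2 * p * f G" for G
    proof -
      have f: "0 \<le> f G" "f G \<le> 1" using assms(1) by auto
      have "\<bar>\<theta>\<bar> * f G \<le> 1/200 * 1" using assms(2) f by (intro mult_mono) auto
      then have "\<bar>2 * \<theta> * f G\<bar> \<le> 1/10" using f by (simp add: abs_mult)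
      from exp_le_quadratic[OF this]
      have "exp (2 * \<theta> * f G) \<le> 1 + 2 * \<theta> * f G + 12/5 * \<theta>\<^sup>2 * (f G)\<^sup>2"
        by (simp add: power_mult_distrib)
      also have "12/5 * \<theta>\<^sup>2 * (f G)\<^sup>2 \<le> 12/5 * \<theta>\<^sup>2 * f G"
        using f by (intro mult_left_mono) (auto simp: power2_eq_square mult_left_le)
      finally show ?thesis by (simp add: p_def algebra_simps)
    qed
    then have "bmean As (\<lambda>G. exp (2 * \<theta> * f G)) \<le> bmean As (\<lambda>G. 1 + 2 * p * f G)"
      by (intro bmean_mono)
    also have "\<dots> = 1 + 2 * p * \<alpha>"
      using bmean_const[OF As m(2), of 1] by (simp add: bmean_add bmean_cmult \<alpha>_def)
    also have "\<dots> \<le> exp (2 * p * \<alpha>)" by (rule exp_ge_add_one_self)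
    finally have "bmean As (\<lambda>G. exp (2 * \<theta> * f G)) * exp (- (2 * p * \<alpha>)) \<le> exp (2 * p * \<alpha>) * exp (- (2 * p * \<alpha>))"
      by (intro mult_right_mono) auto
    then show ?thesis
      unfolding bmean_multc[symmetric] exp_add[symmetric] by (simp add: algebra_simps)
  qed
  have e2: "bmean As (\<lambda>G. exp (2 * (u * D G - q * \<alpha>))) \<le> 1"
  proof -
    have "\<bar>2 * u\<bar> \<le> 1/10" using u1 \<kappa>1 assms(2) by simp
    from bmean_strike_mgf[OF As m(1) assms(1) this]
    have "bmean As (\<lambda>G. exp (2 * u * D G)) \<le> exp (3/5 * (2*u)\<^sup>2 * ((real m / real (m - 1)) ^ k
            * (bmean As (\<lambda>x. (f x)\<^sup>2) - \<alpha>\<^sup>2)))"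
      using Suc.prems by (simp add: D_def \<alpha>_def)
    also have "\<dots> \<le> exp (2 * q * \<alpha>)"
    proof -
      have "real m / real (m - 1) \<le> real m0 / real (m0 - 1)"
        using Suc.prems assms(3) by (simp add: field_simps of_nat_diff)
      then have "(real m / real (m - 1)) ^ k \<le> (real m0 / real (m0 - 1)) ^ k"
        by (intro power_mono) auto
      then have "(real m / real (m - 1)) ^ k \<le> 51/50" using assms(4) by linarith
      moreover have "bmean As (\<lambda>x. (f x)\<^sup>2) - \<alpha>\<^sup>2 \<le> \<alpha>"
      proof -
        have "bmean As (\<lambda>x. (f x)\<^sup>2) \<le> \<alpha>"
          unfolding \<alpha>_def using assms(1) by (intro bmean_mono) (simp add: power2_eq_square mult_left_le)
        then show ?thesis using zero_le_power2[of \<alpha>] by linarith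
      qed
      moreover have "0 \<le> bmean As (\<lambda>x. (f x)\<^sup>2) - \<alpha>\<^sup>2"
        using bmean_square_le[OF As m(2), of f] by (simp add: \<alpha>_def)
      ultimately have "(real m / real (m - 1)) ^ k * (bmean As (\<lambda>x. (f x)\<^sup>2) - \<alpha>\<^sup>2) \<le> 51/50 * \<alpha>"
        by (intro mult_mono) simp_all
      then have "3/5 * (2*u)\<^sup>2 * ((real m / real (m - 1)) ^ k * (bmean As (\<lambda>x. (f x)\<^sup>2) - \<alpha>\<^sup>2))
          \<le> 3/5 * (2*u)\<^sup>2 * (51/50 * \<alpha>)" by (intro mult_left_mono) auto
      also have "\<dots> = 2 * q * \<alpha>" by (simp add: q_def power2_eq_square)
      finally show ?thesis by simp
    qed
    finally have "bmean As (\<lambda>G. exp (2 * u * D G)) * exp (- (2 * q * \<alpha>)) \<le> exp (2 * q * \<alpha>) * exp (- (2 * q * \<alpha>))"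
      by (intro mult_right_mono) auto
    then show ?thesis
      unfolding bmean_multc[symmetric] exp_add[symmetric] by (simp add: algebra_simps)
  qed
  have step: "mexp l (strike As G) (\<lambda>L. exp (\<theta> * hits f (G # L)))
      \<le> exp (\<kappa> * (real (Suc l) * \<alpha>)) * ((exp (2 * (\<theta> * f G - p * \<alpha>)) + exp (2 * (u * D G - q * \<alpha>))) / 2)"
    if G: "fits G As" for G
  proof -
    have "mexp l (strike As G) (\<lambda>L. exp (\<theta> * hits f (G # L)))
        = exp (\<theta> * f G) * mexp l (strike As G) (\<lambda>L. exp (\<theta> * hits f L))"
      unfolding hits_Cons distrib_left exp_add mexp_cmult ..
    also have "\<dots> \<le> exp (\<theta> * f G) * exp (\<kappa> * (real l * bmean (strike As G) f))"
      unfolding \<kappa>_def using Suc.prems G fits_length[OF G]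
      by (intro mult_left_mono Suc.IH[of "m - 1"] board_strike) auto
    also have "\<dots> = exp (\<kappa> * (real l * \<alpha>) + (\<theta> * f G + u * D G))"
    proof -
      have "u * D G = \<kappa> * real l * (bmean (strike As G) f - \<alpha>)"
        using m by (simp add: u_def D_def)
      then show ?thesis by (simp add: exp_add[symmetric] algebra_simps)
    qed
    also have "\<dots> \<le> exp (\<kappa> * (real (Suc l) * \<alpha>) + ((\<theta> * f G - p * \<alpha>) + (u * D G - q * \<alpha>)))"
    proof -
      have "(p + q) * \<alpha> \<le> \<kappa> * \<alpha>" using pq \<alpha>0 by (rule mult_right_mono)
      then show ?thesis by (simp add: algebra_simps)
    qed
    also have "\<dots> = exp (\<kappa> * (real (Suc l) * \<alpha>)) * (exp (\<theta> * f G - p * \<alpha>) * exp (u * D G - q * \<alpha>))"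
      by (simp add: exp_add)
    also have "\<dots> \<le> exp (\<kappa> * (real (Suc l) * \<alpha>)) * (((exp (\<theta> * f G - p * \<alpha>))\<^sup>2 + (exp (u * D G - q * \<alpha>))\<^sup>2) / 2)"
      using sum_squares_bound[of "exp (\<theta> * f G - p * \<alpha>)" "exp (u * D G - q * \<alpha>)"]
      by (intro mult_left_mono) auto
    finally show ?thesis by (simp add: exp_double[symmetric])
  qed
  have "mexp (Suc l) As (\<lambda>L. exp (\<theta> * hits f L))
      \<le> bmean As (\<lambda>G. exp (\<kappa> * (real (Suc l) * \<alpha>)) * ((exp (2 * (\<theta> * f G - p * \<alpha>)) + exp (2 * (u * D G - q * \<alpha>))) / 2))"
    unfolding mexp.simps using step by (rule bmean_mono)
  also have "\<dots> = exp (\<kappa> * (real (Suc l) * \<alpha>)) * ((bmean As (\<lambda>G. exp (2 * (\<theta> * f G - p * \<alpha>)))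
      + bmean As (\<lambda>G. exp (2 * (u * D G - q * \<alpha>)))) / 2)"
    unfolding bmean_cmult divide_inverse bmean_multc bmean_add ..
  also have "\<dots> \<le> exp (\<kappa> * (real (Suc l) * \<alpha>)) * 1"
    using e1 e2 by (intro mult_left_mono) auto
  finally show ?case by (simp add: \<kappa>_def \<alpha>_def del: mexp.simps)
qed simp

lemma exp_convex_combination:
  fixes a b t :: real
  assumes "0 \<le> t" "t \<le> 1"
  shows "exp ((1 - t) * a + t * b) \<le> (1 - t) * exp a + t * exp b"
proof -
  define z where "z = (1 - t) * a + t * b"
  have tangent: "exp z * (1 + (x - z)) \<le> exp x" for x
  proof -
    have "exp z * (1 + (x - z)) \<le> exp z * exp (x - z)"
      using exp_ge_add_one_self[of "x - z"] by (intro mult_left_mono) auto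
    then show ?thesis by (simp add: exp_diff)
  qed
  have "exp z = (1 - t) * (exp z * (1 + (a - z))) + t * (exp z * (1 + (b - z)))"
    by (simp add: z_def algebra_simps)
  also have "\<dots> \<le> (1 - t) * exp a + t * exp b"
    using assms tangent by (intro add_mono mult_left_mono) auto
  finally show ?thesis by (simp add: z_def)
qed

text \<open>The bound on \<open>mexp l As\<close> requires that the board stays large. A complete matching is cut into
  two blocks; by exchangeability the second one may be drawn first, and convexity recombines the two.\<close>

lemma mexp_complete_hits_mgf:
  assumes "\<And>x. 0 \<le> f x \<and> f x \<le> 1" "\<bar>\<theta>\<bar> \<le> 1/4000" "m0 \<ge> 2" "200 * m0 \<le> n"
    and "(real m0 / real (m0 - 1)) ^ k \<le> 51/50"
    and As: "board n As" "length As = k"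
  shows "mexp n As (\<lambda>L. exp (\<theta> * hits f L)) \<le> exp ((\<theta> + 3 * \<theta>\<^sup>2) * (real n * bmean As f))"
proof -
  define l where "l = n - m0"
  define \<alpha> where "\<alpha> = bmean As f"
  have n: "n = l + m0" "m0 \<le> l" "200 * real m0 \<le> real n" using assms(3,4) by (auto simp: l_def)
  have \<alpha>0: "0 \<le> \<alpha>" using assms(1) unfolding \<alpha>_def by (intro bmean_nonneg) auto
  \<comment> \<open>With weights 19/20 and 1/20 both arguments combine to \<theta>. The last block
    has at most n / 200 tuples, so it tolerates the argument 20 \<theta> (at most 1/200), and 20/19
    l + 20 m0 stays below 6/5 n.\<close>
  define \<theta>1 where "\<theta>1 = 20/19 * \<theta>"
  define \<theta>2 where "\<theta>2 = 20 * \<theta>"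
  define a where "a = (\<theta>1 + 5/2 * \<theta>1\<^sup>2) * (real l * \<alpha>)"
  define b where "b = (\<theta>2 + 5/2 * \<theta>2\<^sup>2) * (real m0 * \<alpha>)"
  have 1: "mexp n As (\<lambda>L. exp (\<theta>1 * hits f (take l L))) \<le> exp a"
  proof -
    have "mexp (l + m0) As (\<lambda>L. exp (\<theta>1 * hits f (take l L))) = mexp l As (\<lambda>L. exp (\<theta>1 * hits f L))"
      using As(1) n(1) by (intro mexp_take[of n]) auto
    moreover have "mexp l As (\<lambda>L. exp (\<theta>1 * hits f L)) \<le> exp a"
      unfolding a_def \<alpha>_def using assms n(1,2)
      by (intro mexp_hits_mgf[of f _ m0 k n As]) (auto simp: \<theta>1_def)
    ultimately show ?thesis using n(1) by simp
  qed
  have 2: "mexp n As (\<lambda>L. exp (\<theta>2 * hits f (drop l L))) \<le> exp b"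
  proof -
    have "mexp (l + m0) As (\<lambda>L. exp (\<theta>2 * hits f (drop l L))) = mexp m0 As (\<lambda>L. exp (\<theta>2 * hits f L))"
      using As(1) n(1) by (intro mexp_drop[of n]) auto
    moreover have "mexp m0 As (\<lambda>L. exp (\<theta>2 * hits f L)) \<le> exp b"
      unfolding b_def \<alpha>_def using assms n(1,2)
      by (intro mexp_hits_mgf[of f _ m0 k n As]) (auto simp: \<theta>2_def)
    ultimately show ?thesis using n(1) by simp
  qed
  have *: "exp (\<theta> * hits f L) \<le> exp (19/20 * a + 1/20 * b) *
      (19/20 * (exp (\<theta>1 * hits f (take l L)) * exp (- a)) + 1/20 * (exp (\<theta>2 * hits f (drop l L)) * exp (- b)))"
    (is "_ \<le> ?r L") for L
  proof -
    have "hits f (take l L @ drop l L) = hits f (take l L) + hits f (drop l L)"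
      unfolding hits_def map_append sum_list_append ..
    then have "hits f L = hits f (take l L) + hits f (drop l L)" by simp
    then have "\<theta> * hits f L = (19/20 * a + 1/20 * b)
        + ((1 - 1/20) * (\<theta>1 * hits f (take l L) - a) + 1/20 * (\<theta>2 * hits f (drop l L) - b))"
      by (simp add: \<theta>1_def \<theta>2_def algebra_simps)
    then have "exp (\<theta> * hits f L) = exp (19/20 * a + 1/20 * b) *
        exp ((1 - 1/20) * (\<theta>1 * hits f (take l L) - a) + 1/20 * (\<theta>2 * hits f (drop l L) - b))"
      by (simp only: exp_add)
    also have "\<dots> \<le> exp (19/20 * a + 1/20 * b) *
        ((1 - 1/20) * exp (\<theta>1 * hits f (take l L) - a) + 1/20 * exp (\<theta>2 * hits f (drop l L) - b))"
      by (intro mult_left_mono exp_convex_combination) auto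
    also have "\<dots> = ?r L"
      unfolding diff_conv_add_uminus[of "_ * hits f _"] exp_add by simp
    finally show ?thesis .
  qed
  have "mexp n As (\<lambda>L. exp (\<theta> * hits f L)) \<le> mexp n As ?r"
    using * by (intro mexp_mono)
  also have "\<dots> = exp (19/20 * a + 1/20 * b) *
     (19/20 * (mexp n As (\<lambda>L. exp (\<theta>1 * hits f (take l L))) * exp (- a))
      + 1/20 * (mexp n As (\<lambda>L. exp (\<theta>2 * hits f (drop l L))) * exp (- b)))"
    unfolding mexp_cmult mexp_add mexp_multc ..
  also have "\<dots> \<le> exp (19/20 * a + 1/20 * b) * (19/20 * (exp a * exp (- a)) + 1/20 * (exp b * exp (- b)))"
    using 1 2 by (intro mult_left_mono add_mono mult_right_mono) auto
  also have "\<dots> = exp (19/20 * a + 1/20 * b)" by (simp add: exp_add[symmetric])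
  also have "\<dots> \<le> exp ((\<theta> + 3 * \<theta>\<^sup>2) * (real n * \<alpha>))"
  proof -
    have "19/20 * a + 1/20 * b = \<theta> * (real n * \<alpha>) + 5/2 * \<theta>\<^sup>2 * \<alpha> * (20/19 * real l + 20 * real m0)"
      unfolding a_def b_def \<theta>1_def \<theta>2_def n(1) by (simp add: power2_eq_square field_simps)
    also have "\<dots> \<le> \<theta> * (real n * \<alpha>) + 5/2 * \<theta>\<^sup>2 * \<alpha> * (6/5 * real n)"
      using n \<alpha>0 by (intro add_left_mono mult_left_mono) auto
    also have "\<dots> = (\<theta> + 3 * \<theta>\<^sup>2) * (real n * \<alpha>)" by (simp add: algebra_simps)
    finally show ?thesis by simp
  qed
  finally show ?thesis by (simp add: \<alpha>_def)
qed

subsection \<open>Families with few deviations resemble unions of vertex stars\<close>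

lemma bmean_const_nonempty:
  "(\<And>A. A \<in> set As \<Longrightarrow> finite A \<and> A \<noteq> {}) \<Longrightarrow> bmean As (\<lambda>_. c) = c"
  by (induction As) simp_all

lemma bmean_slice_update:
  "j < length As \<Longrightarrow> bmean (As[j := {u}]) g = bmean (As[j := {v}]) (\<lambda>x. g (x[j := u]))"
proof (induction As arbitrary: j g)
  case (Cons A As)
  show ?case
  proof (cases j)
    case (Suc i)
    then have "bmean (As[i := {u}]) (\<lambda>x. g (a # x)) = bmean (As[i := {v}]) (\<lambda>x. g (a # x[i := u]))" for a
      using Cons.prems by (intro Cons.IH) simp
    then show ?thesis using Suc by simp
  qed simp
qed simp

lemma board_nth: "board m As \<Longrightarrow> j < length As \<Longrightarrow> finite (As ! j) \<and> card (As ! j) = m"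
  by (simp add: board_def)

lemma avg_ge_two_elements:
  assumes "finite A" "a \<in> A" "b \<in> A" "a \<noteq> b" "\<And>a. a \<in> A \<Longrightarrow> 0 \<le> g a"
  shows "g a + g b \<le> real (card A) * avg A g"
proof -
  have "sum g {a, b} \<le> sum g A" using assms by (intro sum_mono2) auto
  moreover have "card A \<noteq> 0" using assms by auto
  ultimately show ?thesis using assms by (simp add: avg_def)
qed

lemma avg_obtain_le:
  assumes "finite A" "A \<noteq> {}"
  shows "\<exists>a\<in>A. g a \<le> avg A g"
proof (rule ccontr)
  assume "\<not> (\<exists>a\<in>A. g a \<le> avg A g)"
  then have *: "avg A g < g a" if "a \<in> A" for a using that by force
  have "(\<Sum>a\<in>A. avg A g) < sum g A" using assms * by (intro sum_strict_mono) auto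
  then show False using assms by (simp add: avg_def)
qed

text \<open>The negative of the part of \<open>f\<close> above level 1; the mean and
  \<open>linpart\<close> are levels 0 and 1.\<close>

definition residue :: "'a set list \<Rightarrow> ('a list \<Rightarrow> real) \<Rightarrow> 'a list \<Rightarrow> real" where
  "residue As f x = bmean As f + linpart As f x - f x"

text \<open>In the application \<open>f\<close> is the indicator of \<open>Fam s\<close> and
  \<open>r\<close> is \<open>s - 1\<close>. The two structure lemmas at the end cover complementary
  ranges of \<open>n\<close>.\<close>

locale zero_one_board =
  fixes n :: nat and As :: "'a set list" and f :: "'a list \<Rightarrow> real" and r :: nat and \<epsilon> :: real
  assumes board: "board n As" and n3: "n \<ge> 3"
    and f01: "\<And>x. f x = 0 \<or> f x = 1"
    and dev: "mexp n As (\<lambda>L. (hits f L - real r)\<^sup>2) \<le> \<epsilon>"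
    and mean_gt: "real r < real n * bmean As f"
    and r1: "r \<ge> 1" and \<epsilon>_small: "\<epsilon> \<le> 1/64"
begin

abbreviation "\<alpha> \<equiv> bmean As f"
abbreviation "d \<equiv> degree As f"
abbreviation "lam \<equiv> linpart As f"

lemma n0: "n > 0" using n3 by simp

lemma fsq: "f x * f x = f x" "(f x)\<^sup>2 = f x" using f01[of x] by auto

lemma f_range: "0 \<le> f x" "f x \<le> 1" using f01[of x] by auto

lemma nth_board: "j < length As \<Longrightarrow> finite (As ! j)" "j < length As \<Longrightarrow> card (As ! j) = n"
  "j < length As \<Longrightarrow> As ! j \<noteq> {}"
  using board_nth[OF board] n0 card_gt_0_iff by metis+

lemma avg_d: "j < length As \<Longrightarrow> avg (As ! j) (d j) = \<alpha>"
  using bmean_slice[of j As f] by (simp add: degree_def[abs_def])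

lemma slice_nonempty: "j < length As \<Longrightarrow> A \<in> set (As[j := {v}]) \<Longrightarrow> finite A \<and> A \<noteq> {}"
proof -
  assume "j < length As" "A \<in> set (As[j := {v}])"
  then have "A = {v} \<or> A \<in> set As" using set_update_subset_insert[of As j "{v}"] by auto
  then show ?thesis using board n0 by (auto simp: board_def)
qed

lemma d_range: assumes "j < length As" shows "0 \<le> d j v" "d j v \<le> 1"
proof -
  show "0 \<le> d j v" unfolding degree_def using f_range by (intro bmean_nonneg)
  have "d j v \<le> bmean (As[j := {v}]) (\<lambda>_. 1)" unfolding degree_def using f_range by (intro bmean_mono)
  also have "\<dots> = 1" using slice_nonempty[OF assms] by (intro bmean_const_nonempty)
  finally show "d j v \<le> 1" .
qed

lemma \<alpha>_range: "0 \<le> \<alpha>" "\<alpha> \<le> 1" "real n * \<alpha> \<le> real n" "1 < real n * \<alpha>"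
proof -
  show "0 \<le> \<alpha>" using f_range by (intro bmean_nonneg)
  show "\<alpha> \<le> 1" using f_range by (intro bmean_le_const[OF board n0])
  then show "real n * \<alpha> \<le> real n" by (simp add: mult_left_le)
  show "1 < real n * \<alpha>" using mean_gt r1 by linarith
qed

lemma r_less_n: "r < n"
  using mean_gt \<alpha>_range(3) by linarith

lemma hits_Ints: "hits f L \<in> \<int>"
proof (induction L)
  case (Cons G L)
  then show ?case using f01[of G] by (auto simp: Ints_add)
qed simp

text \<open>Integers satisfy z <= z^2, so the mean excess over \<open>r\<close> is at most the mean
  square deviation.\<close>

lemma mean_le: "real n * \<alpha> \<le> real r + \<epsilon>"
proof -
  have "hits f L - real r \<le> (hits f L - real r)\<^sup>2" for L
  proof -
    have "hits f L - real r \<in> \<int>" using hits_Ints by (intro Ints_diff) auto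
    then obtain z :: int where z: "hits f L - real r = of_int z" by (rule Ints_cases)
    have "z \<le> z\<^sup>2"
    proof (cases "z \<le> 0")
      case True
      then show ?thesis using zero_le_power2[of z] by linarith
    qed (simp add: power2_eq_square)
    then show ?thesis unfolding z by (metis of_int_le_iff of_int_power)
  qed
  then have "mexp n As (\<lambda>L. hits f L - real r) \<le> \<epsilon>"
    by (intro order_trans[OF mexp_mono dev])
  then show ?thesis using board by (simp add: mexp_diff mexp_hits)
qed

lemma bmean_residue_square:
  "bmean As (\<lambda>x. (residue As f x)\<^sup>2) = \<alpha> - \<alpha>\<^sup>2 - level1 As f"
proof -
  note mom = bmean_centered_sum_moments[OF board n0, of "\<lambda>j v. d j v - \<alpha>"]
  have z: "avg (As ! j) (\<lambda>v. d j v - \<alpha>) = 0" if "j < length As" for j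
    using nth_board[OF that] by (simp add: avg_diff avg_d[OF that])
  have l0: "bmean As lam = 0" and l2: "bmean As (\<lambda>x. (lam x)\<^sup>2) = level1 As f"
    using mom(1,2)[OF z] by (simp_all add: linpart_def[abs_def] level1_def)
  have "(residue As f x)\<^sup>2 = \<alpha>\<^sup>2 + 2 * \<alpha> * lam x - 2 * \<alpha> * f x + (lam x)\<^sup>2 - 2 * (f x * lam x) + f x" for x
    by (simp add: residue_def power2_eq_square algebra_simps fsq)
  then have "bmean As (\<lambda>x. (residue As f x)\<^sup>2)
      = \<alpha>\<^sup>2 + 2 * \<alpha> * bmean As lam - 2 * \<alpha> * \<alpha> + bmean As (\<lambda>x. (lam x)\<^sup>2)
        - 2 * bmean As (\<lambda>x. f x * lam x) + \<alpha>"
    using bmean_const[OF board n0, of "\<alpha>\<^sup>2"] by (simp add: bmean_add bmean_diff bmean_cmult)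
  then show ?thesis unfolding l0 l2 bmean_times_linpart[OF board n0] by (simp add: power2_eq_square)
qed

text \<open>In the variance of the number of hits, level 1 cancels: the n diagonal terms contribute
  n times its weight, and the n (n - 1) pairs, with eigenvalue -1 / (n - 1), remove exactly that.
  The weight above level 1 keeps a factor of at least n (1 - 1 / (n - 1)) >= n / 2. The second
  moment about \<open>r\<close> is at least the variance.\<close>

lemma residue_bound: "real n * (\<alpha> - \<alpha>\<^sup>2 - level1 As f) \<le> 2 * \<epsilon>"
proof -
  define w where "w = \<alpha> - \<alpha>\<^sup>2 - level1 As f"
  have w0: "0 \<le> w" unfolding w_def bmean_residue_square[symmetric] by (intro bmean_nonneg) simp
  define q where "q = qform As f"
  define N where "N = real (n - 1)"
  have N: "N \<ge> 2" "real n = N + 1" using n3 by (auto simp: N_def)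
  have "- (w / N\<^sup>2) \<le> q - \<alpha>\<^sup>2 + level1 As f / N"
    using qform_level1_bound[OF board, of f] n3 by (simp add: fsq w_def q_def N_def abs_le_iff)
  then have "N\<^sup>2 * (- (w / N\<^sup>2)) \<le> N\<^sup>2 * (q - \<alpha>\<^sup>2 + level1 As f / N)"
    by (intro mult_left_mono) auto
  then have q: "N\<^sup>2 * q \<ge> N\<^sup>2 * \<alpha>\<^sup>2 - N * level1 As f - w"
    using N by (simp add: algebra_simps power2_eq_square)
  have "mexp n As (\<lambda>L. (hits f L - real r)\<^sup>2)
      = mexp n As (\<lambda>L. (hits f L)\<^sup>2 - 2 * real r * hits f L + (real r)\<^sup>2)"
    by (intro mexp_cong) (simp add: power2_eq_square algebra_simps)
  also have "\<dots> = real n * \<alpha> + real n * N * q - 2 * real r * (real n * \<alpha>) + (real r)\<^sup>2"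
    using N board mexp_hits_square[OF board order_refl fsq(1)] mexp_hits[OF board order_refl, of f]
      mexp_const[OF board order_refl, of "(real r)\<^sup>2"]
    by (simp add: mexp_diff mexp_add mexp_cmult q_def)
  finally have "real n * \<alpha> + real n * N * q - 2 * real r * (real n * \<alpha>) + (real r)\<^sup>2 \<le> \<epsilon>"
    using dev by simp
  moreover have "0 \<le> (real n * \<alpha> - real r)\<^sup>2" by simp
  ultimately have "real n * \<alpha> + real n * N * q - (real n * \<alpha>)\<^sup>2 \<le> \<epsilon>"
    by (simp add: power2_eq_square algebra_simps)
  then have "real n * (\<alpha> + N * q - real n * \<alpha>\<^sup>2) \<le> \<epsilon>"
    by (simp add: power2_eq_square algebra_simps)
  then have 1: "N * (real n * (\<alpha> + N * q - real n * \<alpha>\<^sup>2)) \<le> N * \<epsilon>"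
    using N by (intro mult_left_mono) auto
  have "real n * (N * (\<alpha> - real n * \<alpha>\<^sup>2) + (N\<^sup>2 * \<alpha>\<^sup>2 - N * level1 As f - w))
      \<le> real n * (N * (\<alpha> - real n * \<alpha>\<^sup>2) + N\<^sup>2 * q)"
    using q by (intro mult_left_mono) auto
  also have "\<dots> = N * (real n * (\<alpha> + N * q - real n * \<alpha>\<^sup>2))"
    by (simp add: power2_eq_square algebra_simps)
  finally have "real n * (N * (\<alpha> - real n * \<alpha>\<^sup>2) + (N\<^sup>2 * \<alpha>\<^sup>2 - N * level1 As f - w)) \<le> N * \<epsilon>"
    using 1 by linarith
  moreover have "N * (\<alpha> - real n * \<alpha>\<^sup>2) + (N\<^sup>2 * \<alpha>\<^sup>2 - N * level1 As f - w) = (N - 1) * w"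
    by (simp add: N(2) w_def power2_eq_square algebra_simps)
  ultimately have "real n * ((N - 1) * w) \<le> N * \<epsilon>" by simp
  moreover have "real n * (N / 2 * w) \<le> real n * ((N - 1) * w)"
    using N w0 by (intro mult_left_mono mult_right_mono) auto
  ultimately have "N * (real n * w) \<le> N * (2 * \<epsilon>)"
    unfolding mult.left_commute[of "real n"] by (simp add: mult.left_commute)
  then show ?thesis using N by (simp add: w_def)
qed

lemma level1_le: "level1 As f \<le> \<alpha>"
proof -
  have "0 \<le> \<alpha> - \<alpha>\<^sup>2 - level1 As f"
    unfolding bmean_residue_square[symmetric] by (intro bmean_nonneg) simp
  then show ?thesis using zero_le_power2[of \<alpha>] by linarith
qed

lemma \<epsilon>_nonneg: "0 \<le> \<epsilon>"
  using dev mexp_nonneg[of As n "\<lambda>L. (hits f L - real r)\<^sup>2"] by simp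

text \<open>Changing the \<open>j\<close>-th coordinate from \<open>u\<close> to \<open>v\<close> changes the linear part by a constant, while it
  changes \<open>f\<close> by an element of \<open>{-1, 0, 1}\<close>.\<close>

lemma degree_difference_dichotomy:
  assumes j: "j < length As" and uv: "u \<in> As ! j" "v \<in> As ! j"
  shows "\<bar>d j v - d j u\<bar> \<le> 8 * \<epsilon> \<or> 1 - 8 * \<epsilon> \<le> \<bar>d j v - d j u\<bar>"
proof (cases "u = v")
  case False
  define B where "B = As[j := {v}]"
  define m where "m = d j v - d j u"
  define e where "e = residue As f"
  define Z where "Z = (\<lambda>x. f x - f (x[j := u]))"
  have Bc: "bmean B (\<lambda>_. c) = c" for c
    unfolding B_def using slice_nonempty[OF j] by (intro bmean_const_nonempty)
  \<comment> \<open>The n slices of column \<open>j\<close> share a total squared residue of at most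
    2 \<epsilon>, so any two of them together have no more.\<close>
  have E: "bmean B (\<lambda>x. (e x)\<^sup>2) + bmean B (\<lambda>x. (e (x[j := u]))\<^sup>2) \<le> 2 * \<epsilon>"
  proof -
    have "bmean B (\<lambda>x. (e x)\<^sup>2) + bmean (As[j := {u}]) (\<lambda>x. (e x)\<^sup>2)
        \<le> real (card (As ! j)) * avg (As ! j) (\<lambda>v. bmean (As[j := {v}]) (\<lambda>x. (e x)\<^sup>2))"
      unfolding B_def using nth_board[OF j] uv False
      by (intro avg_ge_two_elements[where g = "\<lambda>v. bmean (As[j := {v}]) (\<lambda>x. (e x)\<^sup>2)"] bmean_nonneg) auto
    also have "\<dots> \<le> 2 * \<epsilon>"
      using residue_bound nth_board[OF j] by (simp add: bmean_slice[OF j, symmetric] e_def bmean_residue_square)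
    finally show ?thesis
      unfolding B_def using bmean_slice_update[OF j, of u "\<lambda>x. (e x)\<^sup>2" v] by simp
  qed
  have Zm: "bmean B Z = m"
    unfolding Z_def bmean_diff m_def degree_def B_def bmean_slice_update[OF j, of u f v] ..
  have diff: "Z x - m = e (x[j := u]) - e x" if "fits x B" for x
  proof -
    have len: "length x = length As" "x ! j = v"
      using fits_length[OF that] fits_slice[of x As j v] that j by (auto simp: B_def)
    have "lam x - lam (x[j := u]) = (\<Sum>i<length As. d i (x ! i) - d i (x[j := u] ! i))"
      by (simp add: linpart_def sum_subtractf)
    also have "\<dots> = (\<Sum>i<length As. if i = j then m else 0)"
      using len j by (intro sum.cong) (auto simp: m_def)
    also have "\<dots> = m" using j by simp
    finally show ?thesis by (simp add: Z_def e_def residue_def)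
  qed
  have "bmean B (\<lambda>x. (Z x - m)\<^sup>2) \<le> bmean B (\<lambda>x. 2 * ((e x)\<^sup>2 + (e (x[j := u]))\<^sup>2))"
  proof (intro bmean_mono)
    fix x assume "fits x B"
    have "(a - b)\<^sup>2 \<le> 2 * (b\<^sup>2 + a\<^sup>2)" for a b :: real
      using zero_le_power2[of "a + b"] by (simp add: power2_eq_square algebra_simps)
    then show "(Z x - m)\<^sup>2 \<le> 2 * ((e x)\<^sup>2 + (e (x[j := u]))\<^sup>2)"
      unfolding diff[OF \<open>fits x B\<close>] .
  qed
  also have "\<dots> \<le> 4 * \<epsilon>" using E by (simp add: bmean_cmult bmean_add)
  finally have up: "bmean B (\<lambda>x. (Z x - m)\<^sup>2) \<le> 4 * \<epsilon>" .
  \<comment> \<open>\<open>Z\<close> has values in {-1, 0, 1} and mean \<open>m\<close>, so the mean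
    of its square is at least \<bar>m\<bar>.\<close>
  have "\<bar>m\<bar> - m\<^sup>2 \<le> bmean B (\<lambda>x. (Z x - m)\<^sup>2)"
  proof -
    have "sgn m * Z x - 2 * m * Z x + m\<^sup>2 \<le> (Z x - m)\<^sup>2" for x
    proof -
      have "sgn m * Z x \<le> (Z x)\<^sup>2"
        using f01[of x] f01[of "x[j := u]"] by (auto simp: Z_def sgn_if)
      then show ?thesis by (simp add: power2_eq_square algebra_simps)
    qed
    then have "bmean B (\<lambda>x. sgn m * Z x - 2 * m * Z x + m\<^sup>2) \<le> bmean B (\<lambda>x. (Z x - m)\<^sup>2)"
      by (intro bmean_mono)
    moreover have "bmean B (\<lambda>x. sgn m * Z x - 2 * m * Z x + m\<^sup>2) = sgn m * m - 2 * m * m + m\<^sup>2"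
      unfolding bmean_add bmean_diff bmean_cmult Bc Zm ..
    ultimately show ?thesis by (simp add: power2_eq_square mult.commute[of "sgn m"] flip: abs_sgn)
  qed
  then have main: "\<bar>m\<bar> * (1 - \<bar>m\<bar>) \<le> 4 * \<epsilon>" using up by (simp add: power2_eq_square algebra_simps)
  have "\<bar>m\<bar> \<le> 1" using d_range[OF j, of u] d_range[OF j, of v] by (auto simp: m_def)
  show ?thesis
  proof (cases "\<bar>m\<bar> \<le> 1/2")
    case True
    then have "\<bar>m\<bar> * (1/2) \<le> \<bar>m\<bar> * (1 - \<bar>m\<bar>)" by (intro mult_left_mono) auto
    then show ?thesis using main by (auto simp: m_def)
  next
    case False
    then have "(1/2) * (1 - \<bar>m\<bar>) \<le> \<bar>m\<bar> * (1 - \<bar>m\<bar>)" using \<open>\<bar>m\<bar> \<le> 1\<close> by (intro mult_right_mono) auto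
    then show ?thesis using main by (auto simp: m_def)
  qed
qed (use \<epsilon>_nonneg in simp)

lemma exists_low_degree:
  assumes "j < length As"
  shows "\<exists>u\<in>As ! j. d j u \<le> \<alpha>"
  using avg_obtain_le[of "As ! j" "d j"] nth_board[OF assms] avg_d[OF assms] by simp

text \<open>Since n \<alpha> > 1 and n (1 - \<alpha>) >= 1 - \<epsilon>, the variance of
  \<open>f\<close> is at least 1 / (4 n), and at least 1 / (8 n) of it lies on level 1. Degrees that
  are all within 8 \<epsilon> of \<alpha> would give level 1 too little weight. So some column has
  two degrees differing by almost 1, which by the dichotomy makes all its degrees close to 0 or 1.
  Their sum n \<alpha> is so close to \<open>r\<close> that exactly \<open>r\<close> of them are
  close to 1.\<close>

lemma small_board_structure:
  assumes "512 * \<epsilon>\<^sup>2 * real n * real (length As) < 1" and "32 * \<epsilon> * real n < 1"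
  shows "\<exists>j<length As. \<exists>S\<subseteq>As ! j. card S = r \<and> (\<forall>v\<in>S. 1 - 16 * \<epsilon> \<le> d j v)"
proof -
  have n: "real n > 0" using n0 by simp
  have var: "1 \<le> 4 * real n * (\<alpha> - \<alpha>\<^sup>2)"
  proof (cases "\<alpha> \<le> 1/2")
    case True
    then have "\<alpha> * (1/2) \<le> \<alpha> * (1 - \<alpha>)" using \<alpha>_range by (intro mult_left_mono) linarith+
    then have "real n * (\<alpha> * (1/2)) \<le> real n * (\<alpha> * (1 - \<alpha>))" by (rule mult_left_mono) simp
    then show ?thesis using \<alpha>_range(4) by (simp add: power2_eq_square algebra_simps)
  next
    case False
    then have "(1/2) * (1 - \<alpha>) \<le> \<alpha> * (1 - \<alpha>)" using \<alpha>_range by (intro mult_right_mono) auto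
    then have "real n * ((1/2) * (1 - \<alpha>)) \<le> real n * (\<alpha> * (1 - \<alpha>))" by (rule mult_left_mono) simp
    moreover have "real n * (1 - \<alpha>) \<ge> 1 - \<epsilon>"
      using mean_le r_less_n by (simp add: algebra_simps)
    moreover have "real n * ((1/2) * (1 - \<alpha>)) = 1/2 * (real n * (1 - \<alpha>))" by simp
    moreover have "4 * real n * (\<alpha> - \<alpha>\<^sup>2) = 4 * (real n * (\<alpha> * (1 - \<alpha>)))"
      by (simp add: power2_eq_square algebra_simps)
    ultimately show ?thesis using \<epsilon>_small by linarith
  qed
  have l1: "1 \<le> 8 * real n * level1 As f"
    using var residue_bound \<epsilon>_small by (simp add: algebra_simps)
  have "\<exists>j<length As. \<exists>v\<in>As ! j. 8 * \<epsilon> < \<bar>d j v - \<alpha>\<bar>"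
  proof (rule ccontr)
    assume flat: "\<not> ?thesis"
    have "level1 As f \<le> (\<Sum>j<length As. 64 * \<epsilon>\<^sup>2)"
      unfolding level1_def
    proof (intro sum_mono)
      fix j assume "j \<in> {..<length As}"
      then have j: "j < length As" by simp
      have "(d j v - \<alpha>)\<^sup>2 \<le> 64 * \<epsilon>\<^sup>2" if "v \<in> As ! j" for v
      proof -
        have "\<bar>d j v - \<alpha>\<bar> \<le> \<bar>8 * \<epsilon>\<bar>" using flat j that \<epsilon>_nonneg by force
        then have "(d j v - \<alpha>)\<^sup>2 \<le> (8 * \<epsilon>)\<^sup>2" by (simp only: abs_le_square_iff)
        then show ?thesis by (simp add: power_mult_distrib)
      qed
      then have "avg (As ! j) (\<lambda>v. (d j v - \<alpha>)\<^sup>2) \<le> avg (As ! j) (\<lambda>v. 64 * \<epsilon>\<^sup>2)" by (intro avg_mono)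
      then show "avg (As ! j) (\<lambda>v. (d j v - \<alpha>)\<^sup>2) \<le> 64 * \<epsilon>\<^sup>2" using nth_board[OF j] by simp
    qed
    then have "8 * real n * level1 As f \<le> 8 * real n * (real (length As) * (64 * \<epsilon>\<^sup>2))"
      by (intro mult_left_mono) auto
    also have "\<dots> = 512 * \<epsilon>\<^sup>2 * real n * real (length As)" by simp
    finally show False using l1 assms(1) by linarith
  qed
  then obtain j v where j: "j < length As" and v: "v \<in> As ! j" "8 * \<epsilon> < \<bar>d j v - \<alpha>\<bar>" by auto
  note Aj = nth_board[OF j]
  have "\<exists>u\<in>As ! j. 8 * \<epsilon> < \<bar>d j v - d j u\<bar>"
  proof (rule ccontr)
    assume "\<not> ?thesis"
    then have *: "\<bar>d j v - d j u\<bar> \<le> 8 * \<epsilon>" if "u \<in> As ! j" for u using that by force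
    have "\<bar>d j v - \<alpha>\<bar> = \<bar>avg (As ! j) (\<lambda>u. d j v - d j u)\<bar>"
      using Aj by (simp add: avg_diff avg_d[OF j])
    also have "\<dots> \<le> avg (As ! j) (\<lambda>u. 8 * \<epsilon>)"
      using * by (intro order_trans[OF avg_abs] avg_mono)
    finally show False using v Aj by simp
  qed
  then obtain u where u: "u \<in> As ! j" "8 * \<epsilon> < \<bar>d j v - d j u\<bar>" by auto
  then have "1 - 8 * \<epsilon> \<le> \<bar>d j v - d j u\<bar>" using degree_difference_dichotomy[OF j u(1) v(1)] by linarith
  then obtain a b where ab: "a \<in> As ! j" "b \<in> As ! j" "1 - 8 * \<epsilon> \<le> d j a - d j b"
    using u(1) v(1) by (cases "d j u \<le> d j v") auto
  have da: "1 - 8 * \<epsilon> \<le> d j a" using ab(3) d_range[OF j, of b] by linarith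
  have dich: "1 - 16 * \<epsilon> \<le> d j w \<or> d j w \<le> 8 * \<epsilon>" if "w \<in> As ! j" for w
    using degree_difference_dichotomy[OF j ab(1) that] da d_range[OF j, of w] d_range[OF j, of a]
    by linarith
  define S where "S = {w \<in> As ! j. 1 - 16 * \<epsilon> \<le> d j w}"
  have S: "S \<subseteq> As ! j" "finite S" using Aj by (auto simp: S_def)
  have "real n * \<alpha> = (\<Sum>w\<in>As ! j. d j w)"
    using avg_d[OF j] Aj n by (simp add: avg_def field_simps)
  moreover have "real (card S) = (\<Sum>w\<in>As ! j. of_bool (w \<in> S))"
    using S Aj by (simp add: sum_of_bool_eq Int_absorb1)
  ultimately have "\<bar>real n * \<alpha> - real (card S)\<bar> = \<bar>\<Sum>w\<in>As ! j. d j w - of_bool (w \<in> S)\<bar>"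
    by (simp add: sum_subtractf)
  also have "\<dots> \<le> (\<Sum>w\<in>As ! j. \<bar>d j w - of_bool (w \<in> S)\<bar>)" by (rule sum_abs)
  also have "\<dots> \<le> (\<Sum>w\<in>As ! j. 16 * \<epsilon>)"
  proof (intro sum_mono)
    fix w assume w: "w \<in> As ! j"
    show "\<bar>d j w - of_bool (w \<in> S)\<bar> \<le> 16 * \<epsilon>"
      using dich[OF w] d_range[OF j, of w] \<epsilon>_nonneg w by (cases "w \<in> S") (auto simp: S_def)
  qed
  also have "\<dots> = 16 * \<epsilon> * real n" using Aj by simp
  finally have "\<bar>real n * \<alpha> - real (card S)\<bar> < 1/2" using assms(2) by linarith
  then have "card S = r" using mean_gt mean_le \<epsilon>_small by linarith
  then show ?thesis using S j by (intro exI[of _ j] conjI exI[of _ S]) (auto simp: S_def)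
qed

text \<open>The third moment of the linear part is a sum over single coordinates, so it can only be large if some
  degrees are close to 1. This does not require a bound on the number of coordinates.\<close>

lemma large_board_structure:
  assumes "16 * real r * \<alpha> \<le> 1" "144 * \<epsilon> * (real r)\<^sup>2 \<le> 1"
    and "8 * (2 * (real (length As) * \<alpha>) + 13) * \<epsilon> * real r \<le> 1"
  shows "\<exists>S. finite S \<and> card S = r \<and>
    (\<forall>(j, v)\<in>S. j < length As \<and> v \<in> As ! j \<and> 1 - 8 * \<epsilon> \<le> d j v)"
proof -
  define k where "k = length As"
  define B where "B = real k * \<alpha>"
  define w where "w = \<alpha> - \<alpha>\<^sup>2 - level1 As f"
  \<comment> \<open>The weight for the arithmetic-geometric mean inequality applied to 3
    \<bar>y\<bar>: its constant part then costs only 1 / (4 r), at the price of the coefficient 9 r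
    for the squared residue.\<close>
  define \<gamma> where "\<gamma> = 1 / (6 * real r)"
  define e where "e = residue As f"
  have r: "real r \<ge> 1" using r1 by simp
  have n: "real n > 0" using n0 by simp
  have \<alpha>_le: "\<alpha> \<le> 1/16"
  proof -
    have "1 * (16 * \<alpha>) \<le> real r * (16 * \<alpha>)" using r \<alpha>_range by (intro mult_right_mono) auto
    then show ?thesis using assms(1) by (simp add: algebra_simps)
  qed
  have \<gamma>: "\<gamma> > 0" using r by (simp add: \<gamma>_def)
  have B0: "B \<ge> 0" using \<alpha>_range by (simp add: B_def)
  have w0: "0 \<le> w" unfolding w_def bmean_residue_square[symmetric] by (intro bmean_nonneg) simp
  have we: "w \<le> 2 * \<epsilon> * \<alpha>"
  proof -
    have "real n * w \<le> 2 * \<epsilon> * 1" using residue_bound by (simp add: w_def)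
    also have "\<dots> \<le> 2 * \<epsilon> * (real n * \<alpha>)" using \<alpha>_range \<epsilon>_nonneg by (intro mult_left_mono) auto
    finally have "real n * w \<le> real n * (2 * \<epsilon> * \<alpha>)" by (simp add: algebra_simps)
    then show ?thesis using n by simp
  qed
  have we1: "w \<le> \<alpha>"
    using we mult_right_mono[OF \<epsilon>_small \<alpha>_range(1)] \<alpha>_range by linarith
  \<comment> \<open>\<open>T\<close> is evaluated twice. From below: \<open>\<alpha> + lam\<close>
    is \<open>f\<close> plus the residue, so \<open>T\<close> is almost \<alpha> or larger. From
    above: by additivity of the moments \<open>T\<close> is a sum over single vertices, in which
    small degrees contribute little. Hence there must be many large degrees.\<close>
  define T where "T = bmean As (\<lambda>x. (lam x)\<^sup>2 * (\<alpha> + lam x))"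
  have T_eq: "T = (\<Sum>j<k. avg (As ! j) (\<lambda>v. (d j v - \<alpha>)\<^sup>2 * d j v))"
  proof -
    note mom = bmean_centered_sum_moments[OF board n0, of "\<lambda>j v. d j v - \<alpha>"]
    have z: "avg (As ! j) (\<lambda>v. d j v - \<alpha>) = 0" if "j < length As" for j
      using nth_board[OF that] by (simp add: avg_diff avg_d[OF that])
    have l2: "bmean As (\<lambda>x. (lam x)\<^sup>2) = (\<Sum>j<k. avg (As ! j) (\<lambda>v. (d j v - \<alpha>)\<^sup>2))"
      and l3: "bmean As (\<lambda>x. (lam x) ^ 3) = (\<Sum>j<k. avg (As ! j) (\<lambda>v. (d j v - \<alpha>) ^ 3))"
      using mom(2,3)[OF z] by (simp_all add: linpart_def[abs_def] k_def)
    have "T = bmean As (\<lambda>x. \<alpha> * (lam x)\<^sup>2 + (lam x) ^ 3)"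
      unfolding T_def by (intro bmean_cong) (simp add: power2_eq_square power3_eq_cube algebra_simps)
    also have "\<dots> = (\<Sum>j<k. avg (As ! j) (\<lambda>v. \<alpha> * (d j v - \<alpha>)\<^sup>2 + (d j v - \<alpha>) ^ 3))"
      unfolding bmean_add bmean_cmult l2 l3 avg_add avg_cmult sum_distrib_left sum.distrib ..
    also have "\<dots> = (\<Sum>j<k. avg (As ! j) (\<lambda>v. (d j v - \<alpha>)\<^sup>2 * d j v))"
      by (intro sum.cong refl avg_cong) (simp add: power2_eq_square power3_eq_cube algebra_simps)
    finally show ?thesis .
  qed
  have pointwise: "f x * ((1 - \<alpha>)\<^sup>2 - 3/2 * \<gamma>) - 3 / (2 * \<gamma>) * (e x)\<^sup>2 - \<alpha>\<^sup>2/2 - \<alpha>\<^sup>2/2 * (e x)\<^sup>2 - (B + 2) * (e x)\<^sup>2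
      \<le> (lam x)\<^sup>2 * (\<alpha> + lam x)" if "fits x As" for x
  proof -
    have lam: "\<alpha> + lam x = f x + e x" by (simp add: e_def residue_def)
    \<comment> \<open>Degrees are nonnegative. This crude bound is the only pointwise control of the
      residue, and it handles the cubic term below.\<close>
    have lb: "- B \<le> f x + e x"
    proof -
      have "(\<Sum>j<k. - \<alpha>) \<le> lam x"
        unfolding linpart_def k_def using d_range by (intro sum_mono) auto
      then show ?thesis unfolding lam[symmetric] using \<alpha>_range by (simp add: B_def)
    qed
    define y where "y = e x"
    have am: "\<bar>y\<bar> \<le> (\<gamma> + y\<^sup>2 / \<gamma>) / 2"
    proof -
      have "0 \<le> (\<bar>y\<bar> - \<gamma>)\<^sup>2" by simp
      then have "2 * \<gamma> * \<bar>y\<bar> \<le> \<gamma>\<^sup>2 + y\<^sup>2" by (simp add: power2_eq_square algebra_simps)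
      then show ?thesis using \<gamma> by (simp add: field_simps power2_eq_square)
    qed
    have am2: "\<alpha>\<^sup>2 * \<bar>y\<bar> \<le> \<alpha>\<^sup>2/2 + \<alpha>\<^sup>2/2 * y\<^sup>2"
    proof -
      have "0 \<le> (\<bar>y\<bar> - 1)\<^sup>2" by simp
      then have "\<bar>y\<bar> \<le> 1/2 + 1/2 * y\<^sup>2" by (simp add: power2_eq_square algebra_simps)
      then have "\<alpha>\<^sup>2 * \<bar>y\<bar> \<le> \<alpha>\<^sup>2 * (1/2 + 1/2 * y\<^sup>2)" by (intro mult_left_mono) auto
      then show ?thesis by (simp add: algebra_simps)
    qed
    have l: "lam x = f x + y - \<alpha>" using lam by (simp add: y_def)
    have a01: "0 \<le> \<alpha>" "\<alpha> \<le> 1" using \<alpha>_range by auto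
    from f01[of x] show ?thesis
    proof
      assume f: "f x = 0"
      have "- B * y\<^sup>2 - 2 * y\<^sup>2 - \<alpha>\<^sup>2 * \<bar>y\<bar> \<le> (y - \<alpha>)\<^sup>2 * y"
      proof -
        have "- B * y\<^sup>2 \<le> y * y\<^sup>2" using lb f by (intro mult_right_mono) (auto simp: y_def)
        moreover have "- (2 * y\<^sup>2) \<le> - (2 * \<alpha> * y\<^sup>2)" using a01 by (simp add: mult_left_le_one_le)
        moreover have "- (\<alpha>\<^sup>2 * \<bar>y\<bar>) \<le> \<alpha>\<^sup>2 * y" using mult_left_mono[of "- \<bar>y\<bar>" y "\<alpha>\<^sup>2"] by simp
        moreover have "(y - \<alpha>)\<^sup>2 * y = y * y\<^sup>2 - 2 * \<alpha> * y\<^sup>2 + \<alpha>\<^sup>2 * y"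
          by (simp add: power2_eq_square algebra_simps)
        ultimately show ?thesis by linarith
      qed
      moreover have "0 \<le> 3 / (2 * \<gamma>) * y\<^sup>2" using \<gamma> by simp
      ultimately have "- (3 / (2 * \<gamma>) * y\<^sup>2) - \<alpha>\<^sup>2/2 - \<alpha>\<^sup>2/2 * y\<^sup>2 - (B + 2) * y\<^sup>2 \<le> (y - \<alpha>)\<^sup>2 * y"
        using am2 by (simp add: algebra_simps)
      then show ?thesis using f l by (simp add: y_def)
    next
      assume f: "f x = 1"
      define b where "b = 1 - \<alpha>"
      have b: "0 \<le> b" "b \<le> 1" using a01 by (auto simp: b_def)
      have "b\<^sup>2 - 3 * \<bar>y\<bar> - B * y\<^sup>2 \<le> (b + y)\<^sup>2 * (1 + y)"
      proof -
        have "- B * y\<^sup>2 \<le> (1 + y) * y\<^sup>2" using lb f by (intro mult_right_mono) (auto simp: y_def)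
        moreover have "- (3 * \<bar>y\<bar>) \<le> (2 * b + b\<^sup>2) * y"
        proof -
          have "b\<^sup>2 \<le> 1" using b by (simp add: power_le_one)
          then have "(2 * b + b\<^sup>2) * \<bar>y\<bar> \<le> 3 * \<bar>y\<bar>" using b by (intro mult_right_mono) auto
          moreover have "- ((2 * b + b\<^sup>2) * \<bar>y\<bar>) \<le> (2 * b + b\<^sup>2) * y"
            using mult_left_mono[of "- \<bar>y\<bar>" y "2 * b + b\<^sup>2"] b by simp
          ultimately show ?thesis by linarith
        qed
        moreover have "0 \<le> 2 * b * y\<^sup>2" using b by simp
        moreover have "(b + y)\<^sup>2 * (1 + y) = b\<^sup>2 + (2 * b + b\<^sup>2) * y + 2 * b * y\<^sup>2 + (1 + y) * y\<^sup>2"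
          by (simp add: power2_eq_square algebra_simps)
        ultimately show ?thesis by linarith
      qed
      moreover have "3 * \<bar>y\<bar> \<le> 3/2 * \<gamma> + 3 / (2 * \<gamma>) * y\<^sup>2"
        using am by (simp add: field_simps)
      moreover have "0 \<le> \<alpha>\<^sup>2/2 + \<alpha>\<^sup>2/2 * y\<^sup>2 + 2 * y\<^sup>2" by simp
      moreover have "(B + 2) * y\<^sup>2 = B * y\<^sup>2 + 2 * y\<^sup>2" by (rule distrib_right)
      ultimately have "b\<^sup>2 - 3/2 * \<gamma> - 3 / (2 * \<gamma>) * y\<^sup>2 - \<alpha>\<^sup>2/2 - \<alpha>\<^sup>2/2 * y\<^sup>2 - (B + 2) * y\<^sup>2 \<le> (b + y)\<^sup>2 * (1 + y)"
        by linarith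
      moreover have "(lam x)\<^sup>2 * (\<alpha> + lam x) = (b + y)\<^sup>2 * (1 + y)"
      proof -
        have "lam x = b + y" "\<alpha> + lam x = 1 + y" using l f by (simp_all add: b_def)
        then show ?thesis by (simp only:)
      qed
      ultimately show ?thesis unfolding f by (simp add: y_def b_def)
    qed
  qed
  have T_ge: "\<alpha> * (1 - 3 * \<alpha> - 1/4 / real r - 18 * \<epsilon> * real r - (2 * B + 5) * \<epsilon>) \<le> T"
  proof -
    have e2: "bmean As (\<lambda>x. (e x)\<^sup>2) = w" unfolding e_def w_def by (rule bmean_residue_square)
    have "bmean As (\<lambda>x. f x * ((1 - \<alpha>)\<^sup>2 - 3/2 * \<gamma>) - 3 / (2 * \<gamma>) * (e x)\<^sup>2 - \<alpha>\<^sup>2/2 - \<alpha>\<^sup>2/2 * (e x)\<^sup>2 - (B + 2) * (e x)\<^sup>2) \<le> T"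
      unfolding T_def using pointwise by (rule bmean_mono)
    then have T1: "\<alpha> * ((1 - \<alpha>)\<^sup>2 - 3/2 * \<gamma>) - 3 / (2 * \<gamma>) * w - \<alpha>\<^sup>2/2 - \<alpha>\<^sup>2/2 * w - (B + 2) * w \<le> T"
      unfolding bmean_diff bmean_multc bmean_cmult e2 bmean_const[OF board n0] .
    have c1: "3 / (2 * \<gamma>) = 9 * real r" "3/2 * \<gamma> = 1/4 / real r" using r by (simp_all add: \<gamma>_def)
    have c2: "9 * real r * w \<le> 9 * real r * (2 * \<epsilon> * \<alpha>)" "(B + 2) * w \<le> (B + 2) * (2 * \<epsilon> * \<alpha>)"
      using we B0 by (intro mult_left_mono; simp)+
    have c3: "\<alpha>\<^sup>2/2 * w \<le> 1/2 * (2 * \<epsilon> * \<alpha>)"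
      using \<alpha>_range w0 we by (intro mult_mono) (auto simp: power_le_one)
    have c4: "\<alpha>\<^sup>2 = \<alpha> * \<alpha>" "0 \<le> \<alpha> * \<alpha> * \<alpha>" using \<alpha>_range by (simp_all add: power2_eq_square)
    have "\<alpha> * (1 - 3 * \<alpha> - 1/4 / real r - 18 * \<epsilon> * real r - (2 * B + 5) * \<epsilon>)
        \<le> \<alpha> * ((1 - \<alpha>)\<^sup>2 - 1/4 / real r) - 9 * real r * (2 * \<epsilon> * \<alpha>) - \<alpha> * \<alpha> / 2 - 1/2 * (2 * \<epsilon> * \<alpha>) - (B + 2) * (2 * \<epsilon> * \<alpha>)"
    proof -
      have *: "L \<le> N - d - p / 2 - h - h'"
        if "M = a - 2 * p + q" "0 \<le> p" "0 \<le> q" "L = a - 3 * p - c - d - g" "h + h' = g" "N = M - c"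
        for L M N a p q c d g h h' :: real
        using that by linarith
      show ?thesis
      proof (rule *)
        show "\<alpha> * (1 - \<alpha>)\<^sup>2 = \<alpha> - 2 * (\<alpha> * \<alpha>) + \<alpha> * \<alpha> * \<alpha>"
          by (simp add: power2_eq_square algebra_simps)
        show "0 \<le> \<alpha> * \<alpha>" "0 \<le> \<alpha> * \<alpha> * \<alpha>" using c4 by simp_all
        show "\<alpha> * (1 - 3 * \<alpha> - 1/4 / real r - 18 * \<epsilon> * real r - (2 * B + 5) * \<epsilon>)
            = \<alpha> - 3 * (\<alpha> * \<alpha>) - \<alpha> * (1/4 / real r) - 9 * real r * (2 * \<epsilon> * \<alpha>) - (2 * B + 5) * \<epsilon> * \<alpha>"
          by (simp add: algebra_simps)
        show "1/2 * (2 * \<epsilon> * \<alpha>) + (B + 2) * (2 * \<epsilon> * \<alpha>) = (2 * B + 5) * \<epsilon> * \<alpha>"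
          by (simp add: algebra_simps)
        show "\<alpha> * ((1 - \<alpha>)\<^sup>2 - 1/4 / real r) = \<alpha> * (1 - \<alpha>)\<^sup>2 - \<alpha> * (1/4 / real r)"
          by (rule right_diff_distrib)
      qed
    qed
    also have "\<dots> \<le> \<alpha> * ((1 - \<alpha>)\<^sup>2 - 3/2 * \<gamma>) - 3 / (2 * \<gamma>) * w - \<alpha>\<^sup>2/2 - \<alpha>\<^sup>2/2 * w - (B + 2) * w"
      using c2 c3 unfolding c1 c4(1) by linarith
    finally show ?thesis using T1 by linarith
  qed
  define P where "P = Sigma {..<k} (\<lambda>j. {v \<in> As ! j. 1/2 \<le> d j v})"
  have fin: "finite {v \<in> As ! j. 1/2 \<le> d j v}" if "j < k" for j
    using nth_board[of j] that by (simp add: k_def)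
  have finP: "finite P" using fin by (auto simp: P_def)
  \<comment> \<open>Every column contains a vertex of degree at most \<alpha> <= 1/16. Comparison
    with it turns the dichotomy for differences into one for degrees.\<close>
  have dich: "(1/2 \<le> d j v \<and> 1 - 8 * \<epsilon> \<le> d j v) \<or> (d j v < 1/2 \<and> d j v \<le> \<alpha> + 8 * \<epsilon>)"
    if j: "j < k" and v: "v \<in> As ! j" for j v
  proof -
    obtain u where u: "u \<in> As ! j" "d j u \<le> \<alpha>" using exists_low_degree j by (auto simp: k_def)
    show ?thesis
      using degree_difference_dichotomy[OF j[unfolded k_def] u(1) v] d_range[OF j[unfolded k_def], of u]
        d_range[OF j[unfolded k_def], of v] u(2) \<alpha>_le \<epsilon>_small
      by linarith
  qed
  have T_le: "real n * T \<le> real (card P) + (\<alpha> + 8 * \<epsilon>) * (real n * \<alpha>)"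
  proof -
    have "T \<le> (\<Sum>j<k. real (card {v \<in> As ! j. 1/2 \<le> d j v}) / real n
        + (\<alpha> + 8 * \<epsilon>) * avg (As ! j) (\<lambda>v. (d j v - \<alpha>)\<^sup>2))"
      unfolding T_eq
    proof (intro sum_mono)
      fix j assume "j \<in> {..<k}"
      then have j: "j < k" by simp
      note Aj = nth_board[OF j[unfolded k_def]]
      have "(d j v - \<alpha>)\<^sup>2 * d j v \<le> of_bool (1/2 \<le> d j v) + (\<alpha> + 8 * \<epsilon>) * (d j v - \<alpha>)\<^sup>2"
        if v: "v \<in> As ! j" for v
      proof (cases "1/2 \<le> d j v")
        case True
        have "\<bar>d j v - \<alpha>\<bar> \<le> 1" using d_range[OF j[unfolded k_def], of v] \<alpha>_range by auto
        then have "(d j v - \<alpha>)\<^sup>2 \<le> 1" by (simp add: abs_square_le_1)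
        then have "(d j v - \<alpha>)\<^sup>2 * d j v \<le> 1 * 1"
          using d_range[OF j[unfolded k_def], of v] by (intro mult_mono) auto
        moreover have "0 \<le> (\<alpha> + 8 * \<epsilon>) * (d j v - \<alpha>)\<^sup>2" using \<alpha>_range \<epsilon>_nonneg by simp
        ultimately show ?thesis using True by simp
      next
        case False
        then have "d j v \<le> \<alpha> + 8 * \<epsilon>" using dich[OF j v] by auto
        then have "(d j v - \<alpha>)\<^sup>2 * d j v \<le> (d j v - \<alpha>)\<^sup>2 * (\<alpha> + 8 * \<epsilon>)" by (intro mult_left_mono) auto
        then show ?thesis using False by (simp add: mult.commute)
      qed
      then have "avg (As ! j) (\<lambda>v. (d j v - \<alpha>)\<^sup>2 * d j v)
          \<le> avg (As ! j) (\<lambda>v. of_bool (1/2 \<le> d j v) + (\<alpha> + 8 * \<epsilon>) * (d j v - \<alpha>)\<^sup>2)"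
        by (rule avg_mono)
      also have "\<dots> = avg (As ! j) (\<lambda>v. of_bool (1/2 \<le> d j v)) + (\<alpha> + 8 * \<epsilon>) * avg (As ! j) (\<lambda>v. (d j v - \<alpha>)\<^sup>2)"
        unfolding avg_add avg_cmult ..
      also have "avg (As ! j) (\<lambda>v. of_bool (1/2 \<le> d j v)) = real (card {v \<in> As ! j. 1/2 \<le> d j v}) / real n"
        using Aj by (simp add: avg_def sum_of_bool_eq Int_def)
      finally show "avg (As ! j) (\<lambda>v. (d j v - \<alpha>)\<^sup>2 * d j v)
          \<le> real (card {v \<in> As ! j. 1/2 \<le> d j v}) / real n + (\<alpha> + 8 * \<epsilon>) * avg (As ! j) (\<lambda>v. (d j v - \<alpha>)\<^sup>2)" .
    qed
    also have "\<dots> = real (card P) / real n + (\<alpha> + 8 * \<epsilon>) * level1 As f"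
      using fin by (simp add: sum.distrib sum_divide_distrib[symmetric] sum_distrib_left[symmetric]
          level1_def k_def P_def card_SigmaI)
    also have "\<dots> \<le> real (card P) / real n + (\<alpha> + 8 * \<epsilon>) * \<alpha>"
      using level1_le \<alpha>_range \<epsilon>_nonneg by (intro add_left_mono mult_left_mono) auto
    finally have "real n * T \<le> real n * (real (card P) / real n + (\<alpha> + 8 * \<epsilon>) * \<alpha>)"
      by (intro mult_left_mono) auto
    then show ?thesis using n by (simp add: algebra_simps)
  qed
  \<comment> \<open>The relative losses add up to \<delta> with r \<delta> <= 3/4, so the count
    exceeds r - 1 and is therefore at least \<open>r\<close>.\<close>
  have "real r - 1 < real (card P)"
  proof -
    define \<delta> where "\<delta> = 4 * \<alpha> + 1/4 / real r + 18 * \<epsilon> * real r + (2 * B + 13) * \<epsilon>"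
    have "real n * (\<alpha> * (1 - 3 * \<alpha> - 1/4 / real r - 18 * \<epsilon> * real r - (2 * B + 5) * \<epsilon>)) \<le> real n * T"
      using T_ge by (intro mult_left_mono) auto
    then have "(real n * \<alpha>) * (1 - \<delta>) \<le> real (card P)"
      using T_le by (simp add: \<delta>_def algebra_simps)
    moreover have \<delta>1: "real r * \<delta> < 1"
    proof -
      have "real r * \<delta> = 4 * real r * \<alpha> + 1/4 + 18 * \<epsilon> * (real r)\<^sup>2 + (2 * B + 13) * \<epsilon> * real r"
        using r by (simp add: \<delta>_def power2_eq_square field_simps)
      moreover have "8 * ((2 * B + 13) * \<epsilon> * real r) \<le> 1"
        using assms(3) by (simp only: B_def k_def mult.assoc)
      ultimately show ?thesis using assms(1,2) by linarith
    qed
    moreover have "\<delta> \<le> 1"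
    proof -
      have "0 \<le> \<delta>" using \<alpha>_range \<epsilon>_nonneg B0 by (simp add: \<delta>_def)
      then have "1 * \<delta> \<le> real r * \<delta>" using r by (intro mult_right_mono) auto
      then show ?thesis using \<delta>1 by simp
    qed
    moreover have "real r * (1 - \<delta>) \<le> (real n * \<alpha>) * (1 - \<delta>)"
      using mean_gt \<open>\<delta> \<le> 1\<close> by (intro mult_right_mono) auto
    ultimately show ?thesis by (simp add: algebra_simps)
  qed
  then have "r \<le> card P" by linarith
  then obtain S where S: "S \<subseteq> P" "card S = r" "finite S" by (rule obtain_subset_with_card_n)
  have "j < length As \<and> v \<in> As ! j \<and> 1 - 8 * \<epsilon> \<le> d j v" if "(j, v) \<in> S" for j v
    using S(1) that dich[of j v] by (auto simp: P_def k_def)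
  then show ?thesis using S by (intro exI[of _ S]) auto
qed

end

subsection \<open>Systems of distinct representatives\<close>

text \<open>Greedy choice in order of size. The condition for q = |I| yields a set with at least |I|
  elements; it is served last, when the others have used up only |I| - 1 values.\<close>

lemma distinct_representatives:
  assumes "finite I" "\<And>i. i \<in> I \<Longrightarrow> finite (B i)"
    and "\<And>q. 1 \<le> q \<Longrightarrow> q \<le> card I \<Longrightarrow> card {i \<in> I. card (B i) < q} < q"
  shows "\<exists>c. inj_on c I \<and> (\<forall>i\<in>I. c i \<in> B i)"
  using assms
proof (induction "card I" arbitrary: I)
  case 0
  then show ?case by simp
next
  case (Suc N)
  have "card {i \<in> I. card (B i) < card I} < card I" using Suc.hyps(2) by (intro Suc.prems(3)) auto
  then have "{i \<in> I. card (B i) < card I} \<noteq> I" by auto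
  then obtain a where a: "a \<in> I" "card I \<le> card (B a)" by force
  define I' where "I' = I - {a}"
  have I': "finite I'" "card I' = N" using Suc.prems(1) Suc.hyps(2) a by (auto simp: I'_def)
  have "\<exists>c. inj_on c I' \<and> (\<forall>i\<in>I'. c i \<in> B i)"
  proof (rule Suc.hyps(1))
    fix q assume q: "1 \<le> q" "q \<le> card I'"
    have "card {i \<in> I'. card (B i) < q} \<le> card {i \<in> I. card (B i) < q}"
      using Suc.prems(1) by (intro card_mono) (auto simp: I'_def)
    also have "\<dots> < q" using q I' Suc.hyps(2) by (intro Suc.prems(3)) auto
    finally show "card {i \<in> I'. card (B i) < q} < q" .
  qed (use I' Suc.prems in \<open>auto simp: I'_def\<close>)
  then obtain c where c: "inj_on c I'" "\<And>i. i \<in> I' \<Longrightarrow> c i \<in> B i" by blast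
  have "card (c ` I') < card (B a)"
    using card_image_le[OF I'(1), of c] I'(2) a(2) Suc.hyps(2) by linarith
  then have "\<not> B a \<subseteq> c ` I'" using card_mono[of "c ` I'" "B a"] I'(1) by auto
  then obtain z where z: "z \<in> B a" "z \<notin> c ` I'" by auto
  have "inj_on (c(a := z)) I"
  proof -
    have "I = insert a I'" "a \<notin> I'" using a by (auto simp: I'_def)
    moreover have "inj_on (c(a := z)) I'" using c(1) \<open>a \<notin> I'\<close> by (simp add: inj_on_def)
    ultimately show ?thesis using z(2) by (auto simp: image_iff)
  qed
  moreover have "\<forall>i\<in>I. (c(a := z)) i \<in> B i" using c(2) z(1) by (auto simp: I'_def)
  ultimately show ?case by blast
qed

lemma matching_fits: "matching As L \<Longrightarrow> H \<in> set L \<Longrightarrow> fits H As"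
  by (induction As L rule: matching.induct) (auto simp: fits_strike)

lemma list_all2_neq_sym: "list_all2 (\<noteq>) x y \<Longrightarrow> list_all2 (\<noteq>) y x"
  by (auto simp: list_all2_conv_all_nth)

lemma matching_pairwise:
  "matching As L \<Longrightarrow> G \<in> set L \<Longrightarrow> H \<in> set L \<Longrightarrow> G \<noteq> H \<Longrightarrow> list_all2 (\<noteq>) G H"
proof (induction As L rule: matching.induct)
  case (2 As G' L)
  have "list_all2 (\<noteq>) K G'" if "K \<in> set L" for K
    using 2(2) that matching_fits[of "strike As G'" L K] by (auto simp: fits_strike)
  then show ?case using 2 list_all2_neq_sym by (auto dest: list_all2_neq_sym)
qed auto

text \<open>Without columns the only tuple is \<open>[]\<close>, which is vacuously disjoint from
  itself; hence the condition on \<open>As\<close>.\<close>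

lemma matching_distinct:
  "As \<noteq> [] \<Longrightarrow> matching As L \<Longrightarrow> distinct L"
proof (induction L arbitrary: As)
  case (Cons G L)
  have G: "G \<noteq> []" using Cons.prems fits_length[of G As] by auto
  have "G \<notin> set L"
  proof
    assume "G \<in> set L"
    then have "list_all2 (\<noteq>) G G"
      using Cons.prems matching_fits[of "strike As G" L G] by (auto simp: fits_strike)
    then show False using G by (cases G) auto
  qed
  moreover have "distinct L"
    using Cons.prems G by (intro Cons.IH[of "strike As G"]) (cases As; cases G; auto)+
  ultimately show ?case by simp
qed simp

abbreviation ind :: "'b set \<Rightarrow> 'b \<Rightarrow> real" where
  "ind F x \<equiv> of_bool (x \<in> F)"

lemma hits_ind: "distinct L \<Longrightarrow> hits (ind F) L = real (card (F \<inter> set L))"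
proof (induction L)
  case (Cons G L)
  then show ?case by (cases "G \<in> F") simp_all
qed simp

lemma hits_mono: "(\<And>x. x \<in> set L \<Longrightarrow> f x \<le> g x) \<Longrightarrow> hits f L \<le> hits g L"
  by (induction L) (auto intro: add_mono)

section \<open>Means after striking a tuple, and means over one or two coordinates\<close>

lemma bmean_strike_le:
  assumes "board n As" "n \<ge> 2" "fits G As" "\<And>x. 0 \<le> g x"
  shows "bmean (strike As G) g \<le> (real n / real (n - 1)) ^ length As * bmean As g"
  using assms(1,3,4)
proof (induction As arbitrary: G g)
  case (Cons A As)
  define \<rho> where "\<rho> = real n / real (n - 1)"
  have \<rho>: "\<rho> \<ge> 0" by (simp add: \<rho>_def)
  from Cons.prems(2) obtain a H where G: "G = a # H" "a \<in> A" "fits H As"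
    by (auto simp: fits_Cons)
  have IH: "bmean (strike As H) (\<lambda>x. g (b # x)) \<le> \<rho> ^ length As * bmean As (\<lambda>x. g (b # x))" for b
    using Cons.prems G unfolding \<rho>_def by (intro Cons.IH) auto
  have "bmean (strike (A # As) G) g = avg (A - {a}) (\<lambda>b. bmean (strike As H) (\<lambda>x. g (b # x)))"
    by (simp add: G)
  also have "\<dots> \<le> avg (A - {a}) (\<lambda>b. \<rho> ^ length As * bmean As (\<lambda>x. g (b # x)))"
    using IH by (rule avg_mono)
  also have "\<dots> = \<rho> ^ length As * avg (A - {a}) (\<lambda>b. bmean As (\<lambda>x. g (b # x)))"
    by (rule avg_cmult)
  also have "\<dots> \<le> \<rho> ^ length As * (\<rho> * avg A (\<lambda>b. bmean As (\<lambda>x. g (b # x))))"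
  proof (intro mult_left_mono)
    have "0 \<le> bmean As (\<lambda>x. g (a # x))" using Cons.prems(3) by (intro bmean_nonneg)
    then have "real (n - 1) * avg (A - {a}) (\<lambda>b. bmean As (\<lambda>x. g (b # x)))
        \<le> real n * avg A (\<lambda>b. bmean As (\<lambda>x. g (b # x)))"
      using avg_remove[of A n a "\<lambda>b. bmean As (\<lambda>x. g (b # x))"] Cons.prems(1) G(2) assms(2) by simp
    then show "avg (A - {a}) (\<lambda>b. bmean As (\<lambda>x. g (b # x))) \<le> \<rho> * avg A (\<lambda>b. bmean As (\<lambda>x. g (b # x)))"
      using assms(2) by (simp add: \<rho>_def field_simps)
  qed (use \<rho> in simp)
  finally show ?case by (simp add: \<rho>_def mult_ac)
qed simp

text \<open>Both sides are the sum of \<open>g\<close> over the fitting tuples disjoint from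
  \<open>G\<close>, normalised on the full and on the struck board.\<close>

lemma bmean_disjoint_strike:
  assumes "board n As" "n \<ge> 2" "fits G As"
  shows "real n ^ length As * bmean As (\<lambda>x. g x * of_bool (list_all2 (\<noteq>) x G))
       = real (n - 1) ^ length As * bmean (strike As G) g"
  using assms(1,3)
proof (induction As arbitrary: G g)
  case (Cons A As)
  from Cons.prems(2) obtain a H where G: "G = a # H" "a \<in> A" "fits H As"
    by (auto simp: fits_Cons)
  define N where "N = real n ^ length As"
  define M where "M = real (n - 1) ^ length As"
  have IH: "N * bmean As (\<lambda>x. g (b # x) * of_bool (list_all2 (\<noteq>) x H)) = M * bmean (strike As H) (\<lambda>x. g (b # x))" for b
    unfolding N_def M_def using Cons.prems G by (intro Cons.IH) auto
  define h where "h = (\<lambda>b. of_bool (b \<noteq> a) * bmean As (\<lambda>x. g (b # x) * of_bool (list_all2 (\<noteq>) x H)))"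
  have "bmean (A # As) (\<lambda>x. g x * of_bool (list_all2 (\<noteq>) x G)) = avg A h"
    by (simp add: G h_def of_bool_conj mult_ac flip: bmean_cmult)
  moreover have "real n * avg A h = real (n - 1) * avg (A - {a}) h"
    using avg_remove[of A n a h] Cons.prems(1) G(2) assms(2) by (simp add: h_def)
  ultimately have "real n ^ length (A # As) * bmean (A # As) (\<lambda>x. g x * of_bool (list_all2 (\<noteq>) x G))
     = real (n - 1) * avg (A - {a}) (\<lambda>b. N * h b)"
    by (simp add: N_def avg_cmult)
  also have "avg (A - {a}) (\<lambda>b. N * h b) = avg (A - {a}) (\<lambda>b. M * bmean (strike As H) (\<lambda>x. g (b # x)))"
    by (intro avg_cong) (simp add: h_def IH)
  finally show ?case by (simp add: G M_def avg_cmult)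
qed (simp)

lemma bmean_coordinate:
  assumes "\<And>A. A \<in> set As \<Longrightarrow> finite A \<and> A \<noteq> {}" "j < length As"
  shows "bmean As (\<lambda>x. h (x ! j)) = avg (As ! j) h"
proof -
  have "bmean (As[j := {v}]) (\<lambda>_. 1) = 1" for v
    using assms set_update_subset_insert[of As j "{v}"] by (intro bmean_const_nonempty) blast
  then show ?thesis using bmean_times_coordinate[OF assms(2), of "\<lambda>_. 1" h] by (simp add: degree_def)
qed

lemma bmean_two_coordinates:
  assumes "\<And>A. A \<in> set As \<Longrightarrow> finite A \<and> A \<noteq> {}" "i < length As" "j < length As" "i \<noteq> j"
  shows "bmean As (\<lambda>x. g (x ! i) * h (x ! j)) = avg (As ! i) g * avg (As ! j) h"
proof -
  have "degree As (\<lambda>x. g (x ! i)) j v = avg (As ! i) g" for v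
  proof -
    have "A \<in> set (As[j := {v}]) \<Longrightarrow> finite A \<and> A \<noteq> {}" for A
      using assms set_update_subset_insert[of As j "{v}"] by blast
    then show ?thesis
      using bmean_coordinate[of "As[j := {v}]" i g] assms by (simp add: degree_def)
  qed
  then show ?thesis
    using bmean_times_coordinate[OF assms(3), of "\<lambda>x. g (x ! i)" h] by (simp add: avg_cmult)
qed

lemma avg_indicator: "finite A \<Longrightarrow> v \<in> A \<Longrightarrow> avg A (\<lambda>w. of_bool (w = v)) = 1 / real (card A)"
  by (simp add: avg_def of_bool_def)

lemma avg_indicator_le: "finite A \<Longrightarrow> avg A (\<lambda>w. of_bool (w = v)) \<le> 1 / real (card A)"
  by (cases "v \<in> A") (auto simp: avg_indicator avg_def sum_of_bool_eq)

subsection \<open>Random matchings without a rainbow matching\<close>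

text \<open>Ordered pairs of vertices that a single tuple can contain together; a tuple has only one
  vertex in each column.\<close>

definition cross :: "(nat \<times> 'a) set \<Rightarrow> ((nat \<times> 'a) \<times> (nat \<times> 'a)) set" where
  "cross S = {(p, q) \<in> S \<times> S. fst p \<noteq> fst q}"

text \<open>The parameter \<open>2 * b\<close> stands for \<open>C * sqrt (s * ln s)\<close>, and \<open>\<theta>\<close> is the argument of the exponential moments.\<close>

locale families =
  fixes s n k m0 :: nat and b \<theta> :: real and As :: "'a set list" and Fam :: "nat \<Rightarrow> 'a list set"
  assumes board: "board n As" and lenAs: "length As = k" and k1: "k \<ge> 1"
    and s_large: "s \<ge> 1000" and m0: "m0 \<ge> 2" "200 * m0 \<le> n - 1"
    and ratio: "(real m0 / real (m0 - 1)) ^ k \<le> 51/50"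
    and \<theta>: "0 < \<theta>" "\<theta> \<le> 1/4000" "2 \<le> \<theta> * b"
    and b: "7 \<le> b" "2 * b \<le> real s - 2" "3 * b ^ 3 \<le> (real s)\<^sup>2"
    and tail: "2 * real s * exp (3 * \<theta>\<^sup>2 * real s + \<theta> - \<theta> * b) \<le> 1 / real s ^ 7"
    and k_bound: "real k * real s \<le> real n * (2 * b / 3)"
    and Fam_lower: "\<And>i. i \<in> {1..s} \<Longrightarrow> min (real s - 1) (real i + 2 * b) < real n * bmean As (ind (Fam i))"
    and Fam_upper: "\<And>i. i \<in> {1..s} \<Longrightarrow> real n * bmean As (ind (Fam i)) \<le> real s"
    and Fam_tight: "\<And>i. i \<in> {1..s} \<Longrightarrow> real s - 1 \<le> real i + 2 * b \<Longrightarrow>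
         bmean As (ind (Fam i)) = bmean As (ind (Fam s))"
    and Fam_fits: "\<And>i x. i \<in> {1..s} \<Longrightarrow> x \<in> Fam i \<Longrightarrow> fits x As"
begin

definition rainbow :: bool where
  "rainbow \<longleftrightarrow> (\<exists>F. (\<forall>i\<in>{1..s}. F i \<in> Fam i) \<and>
      (\<forall>i\<in>{1..s}. \<forall>j\<in>{1..s}. i \<noteq> j \<longrightarrow> list_all2 (\<noteq>) (F i) (F j)))"

abbreviation "r \<equiv> s - 1"
abbreviation "X i \<equiv> hits (ind (Fam i))"
abbreviation "cnt i L \<equiv> card (Fam i \<inter> set L)"

definition T :: "nat set" where "T = {i \<in> {1..s}. real s - 1 \<le> real i + 2 * b}"

definition \<zeta> :: real where "\<zeta> = 2 * real s * exp (3 * \<theta>\<^sup>2 * real s + \<theta> - \<theta> * b)"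

lemma s0: "real s \<ge> 1000" "real r = real s - 1" using s_large by auto

lemma sT: "s \<in> T" using s_large b by (auto simp: T_def)

lemma T_sub: "T \<subseteq> {1..s}" "finite T" by (auto simp: T_def)

lemma As_ne: "As \<noteq> []" using lenAs k1 by auto

lemma n_s: "s \<le> n" "n \<ge> 1000"
proof -
  have "real s - 1 < real n * bmean As (ind (Fam s))"
    using Fam_lower[of s] s_large b by (simp add: min_def split: if_splits)
  also have "\<dots> \<le> real n * 1"
    using m0 by (intro mult_left_mono bmean_le_const[OF board]) auto
  finally show "s \<le> n" using s_large by linarith
  then show "n \<ge> 1000" using s_large by linarith
qed

lemma \<zeta>_pos: "0 < \<zeta>" using s_large by (simp add: \<zeta>_def)
lemma \<zeta>_le: "\<zeta> \<le> 1 / real s ^ 7" using tail by (simp add: \<zeta>_def)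

text \<open>The margin of 1 over 2 b is what makes the estimate in \<open>good_sum\<close>
  strict.\<close>

lemma card_T: "2 * b + 1 \<le> real (card T)"
proof -
  define p where "p = nat \<lfloor>2 * b\<rfloor>"
  have p: "real p \<le> 2 * b" "2 * b < real p + 1" using b by (auto simp: p_def)
  have "p + 2 \<le> s" using p b by linarith
  then have "{s - 1 - p..s} \<subseteq> T" using p by (auto simp: T_def)
  then have "card {s - 1 - p..s} \<le> card T" using T_sub by (intro card_mono) auto
  then show ?thesis using p \<open>p + 2 \<le> s\<close> by simp
qed

lemma matching_props:
  assumes "matching As L"
  shows "distinct L" "X i L = real (cnt i L)"
  using matching_distinct[OF As_ne assms] hits_ind by auto

lemma rainbow_from:
  assumes "matching As L" "inj_on c {1..s}" "\<And>i. i \<in> {1..s} \<Longrightarrow> c i \<in> Fam i \<inter> set L"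
  shows rainbow
  unfolding rainbow_def
proof (intro exI[of _ c] conjI ballI impI)
  fix i j assume "i \<in> {1..s}" "j \<in> {1..s}" "i \<noteq> j"
  then show "list_all2 (\<noteq>) (c i) (c j)"
    using assms by (intro matching_pairwise[OF assms(1)]) (auto dest: inj_onD)
qed (use assms in auto)

text \<open>The surplus of 1 in the slack families is spent in \<open>good_contained\<close>, where
  one tuple is taken away from every family.\<close>

definition good :: "'a list list \<Rightarrow> bool" where
  "good L \<longleftrightarrow> (\<forall>i\<in>{1..s}. X i L \<le> real r + b) \<and> (\<forall>i\<in>T. real r - b \<le> X i L)
     \<and> (\<forall>i\<in>{1..s} - T. real i + 1 \<le> X i L)"

text \<open>If the greedy choice fails, then for some q at least q families have fewer than q
  members in \<open>L\<close>. With a = s - q, each of these is at least a below \<open>r\<close>.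
  At most q - 1 of them are slack, so some are tight, which forces a <= b. At most a families are
  outside this set, each at most b above \<open>r\<close>. As there are at least 2 b + 1 tight
  families, the sum is at most -a. For a = 0 all families have at most \<open>r\<close> members, and
  any inequality costs 1 by integrality.\<close>

lemma good_sum:
  assumes L: "matching As L" and g: "good L" and nr: "\<not> rainbow"
  shows "(\<Sum>i\<in>T. X i L - real r) \<le> - of_bool (\<exists>i\<in>T. X i L \<noteq> real r)"
proof -
  have "\<exists>q. 1 \<le> q \<and> q \<le> s \<and> q \<le> card {i \<in> {1..s}. cnt i L < q}"
  proof (rule ccontr)
    assume "\<not> ?thesis"
    then have "card {i \<in> {1..s}. cnt i L < q} < q" if "1 \<le> q" "q \<le> s" for q
      using that not_le by blast
    then have "\<exists>c. inj_on c {1..s} \<and> (\<forall>i\<in>{1..s}. c i \<in> Fam i \<inter> set L)"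
      by (intro distinct_representatives) simp_all
    then show False using rainbow_from[OF L] nr by blast
  qed
  then obtain q where q: "1 \<le> q" "q \<le> s" "q \<le> card {i \<in> {1..s}. cnt i L < q}" by auto
  define A where "A = {i \<in> {1..s}. cnt i L < q}"
  define a where "a = real s - real q"
  have A: "A \<subseteq> {1..s}" "finite A" by (auto simp: A_def)
  have XA: "X i L - real r \<le> - a" if "i \<in> A" for i
    using that s0 matching_props(2)[OF L, of i] by (auto simp: A_def a_def)
  have "A - T \<subseteq> {1..<q}"
  proof
    fix i assume i: "i \<in> A - T"
    then have "real i + 1 \<le> X i L" using g A by (auto simp: good_def)
    then show "i \<in> {1..<q}" using i matching_props(2)[OF L, of i] by (auto simp: A_def)
  qed
  then have "card (A - T) \<le> card {1..<q}" by (intro card_mono) auto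
  then have "card (A - T) < card A" using q by (simp add: A_def)
  then have "A - T \<noteq> A" by auto
  then obtain i where i: "i \<in> A" "i \<in> T" by auto
  have ab: "a \<le> b"
    using XA[OF i(1)] g i(2) by (force simp: good_def)
  have a0: "0 \<le> a" using q by (simp add: a_def)
  define u where "u = real (card (T - A))"
  have u: "u \<le> a"
  proof -
    have "card (T - A) \<le> card ({1..s} - A)" using T_sub by (intro card_mono) auto
    also have "\<dots> = s - card A" using A by (simp add: card_Diff_subset)
    finally show ?thesis using q(2,3) unfolding u_def a_def A_def[symmetric] by linarith
  qed
  have cTA: "real (card (T \<inter> A)) = real (card T) - u"
  proof -
    have "card T = card (T \<inter> A) + card (T - A)" using card_Int_Diff[OF T_sub(2), of A] by simp
    then show ?thesis by (simp add: u_def)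
  qed
  have "(\<Sum>i\<in>T. X i L - real r) = (\<Sum>i\<in>T \<inter> A. X i L - real r) + (\<Sum>i\<in>T - A. X i L - real r)"
    using T_sub by (intro sum.Int_Diff)
  also have "\<dots> \<le> (\<Sum>i\<in>T \<inter> A. - a) + (\<Sum>i\<in>T - A. b)"
    using XA g T_sub by (intro add_mono sum_mono) (force simp: good_def)+
  also have "\<dots> = - (real (card T) * a) + u * (a + b)"
    by (simp add: cTA u_def[symmetric] algebra_simps)
  also have "\<dots> \<le> - (real (card T) * a) + a * (a + b)"
    using u a0 b by (intro add_left_mono mult_right_mono) auto
  also have "\<dots> = - (a * (real (card T) - a - b))" by (simp add: algebra_simps)
  also have "\<dots> \<le> - (a * 1)"
    using card_T ab a0 by (intro le_imp_neg_le mult_left_mono) auto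
  finally have sum_a: "(\<Sum>i\<in>T. X i L - real r) \<le> - a" by simp
  show ?thesis
  proof (cases "q = s")
    case False
    then have "a \<ge> 1" using q by (simp add: a_def)
    then show ?thesis using sum_a by (auto simp: of_bool_def)
  next
    case True
    then have "card A = card {1..s}" using q(3) card_mono[OF _ A(1)] by (simp add: A_def)
    then have AA: "A = {1..s}" using A(1) by (intro card_subset_eq) auto
    then have le: "X i L - real r \<le> 0" if "i \<in> T" for i
      using XA[of i] that T_sub True by (auto simp: a_def)
    show ?thesis
    proof (cases "\<exists>i\<in>T. X i L \<noteq> real r")
      case False
      then show ?thesis using sum_a a0 by simp
    next
      case ex: True
      then obtain i where i: "i \<in> T" "X i L \<noteq> real r" by auto
      have "X i L - real r \<le> -1"
        using le[OF i(1)] i(2) matching_props(2)[OF L, of i] by simp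
      moreover have "(\<Sum>i\<in>T - {i}. X i L - real r) \<le> 0" using le by (intro sum_nonpos) auto
      ultimately show ?thesis using ex sum.remove[OF T_sub(2) i(1), of "\<lambda>i. X i L - real r"] by simp
    qed
  qed
qed

text \<open>A tuple z of \<open>Fam i\<close> outside \<open>Fam s\<close> could be given to family
  \<open>i\<close>, with the other r families served greedily from the rest. Losing z may bring
  other tight families down to r - 1 tuples, but \<open>Fam s\<close> does not contain z and keeps
  r, which saves the greedy condition at q = r.\<close>

lemma good_contained:
  assumes L: "matching As L" and g: "good L" and nr: "\<not> rainbow"
    and eq: "\<And>i. i \<in> T \<Longrightarrow> X i L = real r" and i: "i \<in> {1..s}"
  shows "Fam i \<inter> set L \<subseteq> Fam s"
proof
  fix z assume z: "z \<in> Fam i \<inter> set L"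
  show "z \<in> Fam s"
  proof (rule ccontr)
    assume zs: "z \<notin> Fam s"
    then have ne: "i \<noteq> s" using z by auto
    define I where "I = {1..s} - {i}"
    have I: "finite I" "card I = r" using i by (auto simp: I_def)
    define B where "B = (\<lambda>i'. Fam i' \<inter> set L - {z})"
    have ge: "cnt i' L \<le> card (B i') + 1" for i'
      unfolding B_def using card_Diff1_le card_Suc_Diff1[of "Fam i' \<inter> set L" z]
      by (cases "z \<in> Fam i' \<inter> set L") auto
    have Bs: "card (B s) = r"
    proof -
      have "B s = Fam s \<inter> set L" using zs by (auto simp: B_def)
      then show ?thesis using eq[OF sT] matching_props(2)[OF L, of s] by simp
    qed
    have "\<exists>c. inj_on c I \<and> (\<forall>i'\<in>I. c i' \<in> B i')"
    proof (rule distinct_representatives)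
      fix q assume q: "1 \<le> q" "q \<le> card I"
      show "card {i' \<in> I. card (B i') < q} < q"
      proof (cases "q = r")
        case True
        then have "{i' \<in> I. card (B i') < q} \<subseteq> I - {s}" using Bs by auto
        then have "card {i' \<in> I. card (B i') < q} \<le> card (I - {s})" using I by (intro card_mono) auto
        also have "\<dots> = r - 1" using I ne s_large by (simp add: I_def)
        finally show ?thesis using True s_large by simp
      next
        case False
        then have qr: "q < r" using q I by simp
        have "{i' \<in> I. card (B i') < q} \<subseteq> {1..<q}"
        proof
          fix i' assume "i' \<in> {i' \<in> I. card (B i') < q}"
          then have i': "i' \<in> {1..s}" "card (B i') < q" by (auto simp: I_def)
          have "i' \<notin> T"
          proof
            assume "i' \<in> T"
            then have "cnt i' L = r" using eq matching_props(2)[OF L, of i'] by simp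
            then show False using ge[of i'] i'(2) qr by simp
          qed
          then have "real i' + 1 \<le> X i' L" using g i'(1) unfolding good_def by blast
          then have "real i' + 1 \<le> real (cnt i' L)" using matching_props(2)[OF L, of i'] by linarith
          then have "i' + 1 \<le> cnt i' L" by linarith
          then show "i' \<in> {1..<q}" using ge[of i'] i' by simp
        qed
        then have "card {i' \<in> I. card (B i') < q} \<le> card {1..<q}" by (intro card_mono) auto
        then show ?thesis using q by simp
      qed
    qed (use I in \<open>auto simp: B_def\<close>)
    then obtain c where c: "inj_on c I" "\<And>i'. i' \<in> I \<Longrightarrow> c i' \<in> B i'" by blast
    have "inj_on (c(i := z)) {1..s}"
    proof -
      have "{1..s} = insert i I" "i \<notin> I" using i by (auto simp: I_def)
      moreover have "inj_on (c(i := z)) I" using c(1) \<open>i \<notin> I\<close> by (simp add: inj_on_def)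
      moreover have "z \<notin> c ` I" using c(2) by (force simp: B_def)
      ultimately show ?thesis by (auto simp: image_iff)
    qed
    moreover have "(c(i := z)) i' \<in> Fam i' \<inter> set L" if "i' \<in> {1..s}" for i'
      using c(2)[of i'] z that by (auto simp: I_def B_def)
    ultimately show False using rainbow_from[OF L] nr by blast
  qed
qed

section \<open>Exponential tails and the probability of matchings that are not good\<close>

lemma tail_upper:
  assumes "board m Bs" "length Bs = k" "200 * m0 \<le> m" "\<And>x. 0 \<le> f x \<and> f x \<le> 1" "real m * bmean Bs f \<le> y"
  shows "mexp m Bs (\<lambda>L. exp (\<theta> * (hits f L - c))) \<le> exp ((\<theta> + 3 * \<theta>\<^sup>2) * y - \<theta> * c)"
proof -
  have "mexp m Bs (\<lambda>L. exp (\<theta> * (hits f L - c))) = exp (- (\<theta> * c)) * mexp m Bs (\<lambda>L. exp (\<theta> * hits f L))"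
    unfolding mexp_cmult[symmetric] by (simp add: exp_add[symmetric] algebra_simps)
  also have "\<dots> \<le> exp (- (\<theta> * c)) * exp ((\<theta> + 3 * \<theta>\<^sup>2) * (real m * bmean Bs f))"
    using assms \<theta> m0 ratio by (intro mult_left_mono mexp_complete_hits_mgf[of f \<theta> m0 m k]) auto
  also have "\<dots> \<le> exp (- (\<theta> * c)) * exp ((\<theta> + 3 * \<theta>\<^sup>2) * y)"
    using assms(5) \<theta> by (intro mult_left_mono iffD2[OF exp_le_cancel_iff]) auto
  finally show ?thesis by (simp add: exp_add[symmetric])
qed

lemma tail_lower:
  assumes "board m Bs" "length Bs = k" "200 * m0 \<le> m" "\<And>x. 0 \<le> f x \<and> f x \<le> 1" "y \<le> real m * bmean Bs f"
  shows "mexp m Bs (\<lambda>L. exp (\<theta> * (c - hits f L))) \<le> exp (\<theta> * c - (\<theta> - 3 * \<theta>\<^sup>2) * y)"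
proof -
  have \<theta>3: "0 \<le> \<theta> - 3 * \<theta>\<^sup>2"
  proof -
    have "\<theta> * \<theta> \<le> 1/4000 * \<theta>" using \<theta> by (intro mult_right_mono) auto
    then show ?thesis using \<theta> by (simp add: power2_eq_square)
  qed
  have "mexp m Bs (\<lambda>L. exp (\<theta> * (c - hits f L))) = exp (\<theta> * c) * mexp m Bs (\<lambda>L. exp (- \<theta> * hits f L))"
    unfolding mexp_cmult[symmetric] by (simp add: exp_add[symmetric] algebra_simps)
  also have "\<dots> \<le> exp (\<theta> * c) * exp ((- \<theta> + 3 * (- \<theta>)\<^sup>2) * (real m * bmean Bs f))"
    using assms \<theta> m0 ratio by (intro mult_left_mono mexp_complete_hits_mgf[of f "- \<theta>" m0 m k]) auto
  also have "\<dots> \<le> exp (\<theta> * c) * exp (- ((\<theta> - 3 * \<theta>\<^sup>2) * y))"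
  proof -
    have "(- \<theta> + 3 * (- \<theta>)\<^sup>2) * (real m * bmean Bs f) = - ((\<theta> - 3 * \<theta>\<^sup>2) * (real m * bmean Bs f))"
      by (simp add: algebra_simps)
    also have "\<dots> \<le> - ((\<theta> - 3 * \<theta>\<^sup>2) * y)"
      using mult_left_mono[OF assms(5) \<theta>3] by simp
    finally show ?thesis by simp
  qed
  finally show ?thesis by (simp add: exp_add[symmetric])
qed

text \<open>A smooth majorant of the indicator of the event that \<open>L\<close> is not good, which also controls the excess of
  the numbers of hits on this event.\<close>

definition Z :: "'a list list \<Rightarrow> real" where
  "Z L = (\<Sum>i\<in>{1..s}. exp (\<theta> * (X i L - (real r + b))))
     + (\<Sum>i\<in>{1..s}. if i \<in> T then exp (\<theta> * (real r - b - X i L)) else exp (\<theta> * (real i + 1 - X i L)))"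

lemma slack_lower: "i \<in> {1..s} - T \<Longrightarrow> real i + 2 * b < real n * bmean As (ind (Fam i))"
  using Fam_lower[of i] by (auto simp: T_def min_def split: if_splits)

lemma tight_lower: "i \<in> T \<Longrightarrow> real s - 1 < real n * bmean As (ind (Fam i))"
  using Fam_lower[of i] by (auto simp: T_def min_def split: if_splits)

text \<open>All 2 s terms obey one bound, because the values that enter the quadratic term are at
  most \<open>s\<close>. For a slack family the target i + 1 is 2 b - 1 below the mean, which leaves
  room to spare.\<close>

lemma mexp_Z: "mexp n As Z \<le> \<zeta>"
proof -
  define E where "E = exp (3 * \<theta>\<^sup>2 * real s + \<theta> - \<theta> * b)"
  have fr: "0 \<le> ind F x \<and> ind F x \<le> 1" for F and x :: "'a list" by simp
  have m0n: "200 * m0 \<le> n" using m0 by simp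
  have \<theta>2: "0 \<le> \<theta>\<^sup>2" "0 \<le> \<theta> * b" using \<theta> by auto
  have 1: "mexp n As (\<lambda>L. exp (\<theta> * (X i L - (real r + b)))) \<le> E" if "i \<in> {1..s}" for i
  proof -
    have "mexp n As (\<lambda>L. exp (\<theta> * (X i L - (real r + b)))) \<le> exp ((\<theta> + 3 * \<theta>\<^sup>2) * real s - \<theta> * (real r + b))"
      using Fam_upper[OF that] by (intro tail_upper[OF board lenAs m0n fr])
    also have "\<dots> = E" unfolding E_def s0(2) by (simp add: algebra_simps)
    finally show ?thesis .
  qed
  have 2: "mexp n As (\<lambda>L. exp (\<theta> * (real r - b - X i L))) \<le> E" if "i \<in> T" for i
  proof -
    have "mexp n As (\<lambda>L. exp (\<theta> * (real r - b - X i L))) \<le> exp (\<theta> * (real r - b) - (\<theta> - 3 * \<theta>\<^sup>2) * real r)"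
      using tight_lower[OF that] s0 by (intro tail_lower[OF board lenAs m0n fr]) auto
    also have "\<dots> \<le> E"
    proof -
      have "\<theta>\<^sup>2 * real r \<le> \<theta>\<^sup>2 * real s" by (intro mult_left_mono) auto
      moreover have "\<theta> * (real r - b) - (\<theta> - 3 * \<theta>\<^sup>2) * real r = 3 * (\<theta>\<^sup>2 * real r) - \<theta> * b"
        by (simp add: algebra_simps)
      ultimately show ?thesis using \<theta> unfolding E_def exp_le_cancel_iff by linarith
    qed
    finally show ?thesis .
  qed
  have 3: "mexp n As (\<lambda>L. exp (\<theta> * (real i + 1 - X i L))) \<le> E" if "i \<in> {1..s} - T" for i
  proof -
    have "mexp n As (\<lambda>L. exp (\<theta> * (real i + 1 - X i L)))
        \<le> exp (\<theta> * (real i + 1) - (\<theta> - 3 * \<theta>\<^sup>2) * (real i + 2 * b))"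
      using slack_lower[OF that] by (intro tail_lower[OF board lenAs m0n fr]) auto
    also have "\<dots> \<le> E"
    proof -
      have "real i + 2 * b \<le> real s" using that by (auto simp: T_def)
      then have "\<theta>\<^sup>2 * (real i + 2 * b) \<le> \<theta>\<^sup>2 * real s" by (intro mult_left_mono) auto
      then show ?thesis using \<theta>2 unfolding E_def by (simp add: algebra_simps)
    qed
    finally show ?thesis .
  qed
  have "mexp n As Z = (\<Sum>i\<in>{1..s}. mexp n As (\<lambda>L. exp (\<theta> * (X i L - (real r + b)))))
     + (\<Sum>i\<in>{1..s}. mexp n As (\<lambda>L. if i \<in> T then exp (\<theta> * (real r - b - X i L)) else exp (\<theta> * (real i + 1 - X i L))))"
    unfolding Z_def[abs_def] mexp_add mexp_sum ..
  also have "\<dots> \<le> (\<Sum>i\<in>{1..s}. E) + (\<Sum>i\<in>{1..s}. E)"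
  proof (intro add_mono sum_mono)
    fix i assume "i \<in> {1..s}"
    then show "mexp n As (\<lambda>L. if i \<in> T then exp (\<theta> * (real r - b - X i L)) else exp (\<theta> * (real i + 1 - X i L))) \<le> E"
      using 2 3 by (cases "i \<in> T") auto
  qed (use 1 in auto)
  finally show ?thesis by (simp add: \<zeta>_def E_def)
qed

lemma Z_ge:
  shows "0 \<le> Z L" and "i \<in> {1..s} \<Longrightarrow> exp (\<theta> * (X i L - (real r + b))) \<le> Z L"
    and "i \<in> T \<Longrightarrow> exp (\<theta> * (real r - b - X i L)) \<le> Z L" and "\<not> good L \<Longrightarrow> 1 \<le> Z L"
proof -
  define U where "U = (\<lambda>i. exp (\<theta> * (X i L - (real r + b))))"
  define V where "V = (\<lambda>i. if i \<in> T then exp (\<theta> * (real r - b - X i L)) else exp (\<theta> * (real i + 1 - X i L)))"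
  have Z: "Z L = sum U {1..s} + sum V {1..s}" by (simp add: Z_def U_def V_def)
  have pos: "0 \<le> sum U {1..s}" "0 \<le> sum V {1..s}" by (auto simp: U_def V_def intro!: sum_nonneg)
  show "0 \<le> Z L" using Z pos by simp
  have UV0: "0 \<le> U i" "0 \<le> V i" for i by (simp_all add: U_def V_def)
  have UZ: "U i \<le> Z L" if "i \<in> {1..s}" for i
    using member_le_sum[of i "{1..s}" U] UV0 that pos Z by simp
  have VZ: "V i \<le> Z L" if "i \<in> {1..s}" for i
    using member_le_sum[of i "{1..s}" V] UV0 that pos Z by simp
  show "i \<in> {1..s} \<Longrightarrow> exp (\<theta> * (X i L - (real r + b))) \<le> Z L" using UZ by (auto simp: U_def)
  show "i \<in> T \<Longrightarrow> exp (\<theta> * (real r - b - X i L)) \<le> Z L"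
    using VZ[of i] T_sub by (auto simp: V_def)
  have e: "1 \<le> exp (\<theta> * x)" if "0 \<le> x" for x using that \<theta> by simp
  show "1 \<le> Z L" if "\<not> good L"
  proof -
    from that consider i where "i \<in> {1..s}" "real r + b < X i L" | i where "i \<in> T" "X i L < real r - b"
      | i where "i \<in> {1..s}" "i \<notin> T" "X i L < real i + 1"
      by (auto simp: good_def not_le)
    then show ?thesis
    proof cases
      case 1
      then have "1 \<le> U i" unfolding U_def by (intro e) simp
      then show ?thesis using UZ[OF 1(1)] by linarith
    next
      case 2
      then have "1 \<le> V i" unfolding V_def using e[of "real r - b - X i L"] by simp
      then show ?thesis using VZ[of i] 2(1) T_sub by fastforce
    next
      case 3
      then have "1 \<le> V i" unfolding V_def using e[of "real i + 1 - X i L"] by simp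
      then show ?thesis using VZ[OF 3(1)] by linarith
    qed
  qed
qed

text \<open>As \<theta> b >= 2, the exponential grows faster than the square from x = b onwards.
  This converts large deviations into multiples of \<open>Z\<close>.\<close>

lemma square_le_exp:
  assumes "x \<ge> b"
  shows "x\<^sup>2 \<le> b\<^sup>2 * exp (\<theta> * (x - b))" "x \<le> b * exp (\<theta> * (x - b))"
proof -
  have b0: "b > 0" using b by simp
  define y where "y = \<theta> * (x - b) / 2"
  have "(x - b) / b \<le> y"
  proof -
    have "(x - b) * 2 \<le> (x - b) * (\<theta> * b)" using \<theta> assms by (intro mult_left_mono) auto
    then show ?thesis using b0 by (simp add: y_def field_simps)
  qed
  then have "x / b \<le> 1 + y" using b0 by (simp add: field_simps)
  also have "\<dots> \<le> exp y" by (rule exp_ge_add_one_self)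
  finally have xy: "x / b \<le> exp y" .
  have "(x / b)\<^sup>2 \<le> (exp y)\<^sup>2" using xy assms b0 by (intro power_mono) auto
  also have "\<dots> = exp (\<theta> * (x - b))" by (simp add: y_def flip: exp_double)
  finally show "x\<^sup>2 \<le> b\<^sup>2 * exp (\<theta> * (x - b))" using b0 by (simp add: field_simps)
  have "y \<ge> 0" using \<theta> assms by (simp add: y_def)
  then have "b * exp y \<le> b * exp (\<theta> * (x - b))"
    using b0 by (intro mult_left_mono) (auto simp: y_def)
  moreover have "x \<le> b * exp y" using xy b0 by (simp add: field_simps)
  ultimately show "x \<le> b * exp (\<theta> * (x - b))" by simp
qed

section \<open>Consequences of the absence of a rainbow matching\<close>

definition Y :: "'a list list \<Rightarrow> real" where
  "Y L = of_bool (good L \<and> (\<exists>i\<in>T. X i L \<noteq> real r))"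

lemma X_excess:
  assumes "i \<in> {1..s}" "\<not> good L"
  shows "X i L - real r \<le> b * Z L"
proof (cases "X i L - real r \<le> b")
  case True
  then have "X i L - real r \<le> b * 1" by simp
  also have "\<dots> \<le> b * Z L" using Z_ge(4)[OF assms(2)] b by (intro mult_left_mono) auto
  finally show ?thesis .
next
  case False
  then have "X i L - real r \<le> b * exp (\<theta> * (X i L - real r - b))" by (intro square_le_exp) auto
  also have "\<dots> \<le> b * Z L"
    using Z_ge(2)[OF assms(1), of L] b by (intro mult_left_mono) (auto simp: algebra_simps)
  finally show ?thesis .
qed

text \<open>The excesses X i - r of the tight families have a positive mean. Pointwise their sum is
  at most \<open>- Y\<close> on good matchings and at most a multiple of \<open>Z\<close> on all
  others, so \<open>Y\<close> cannot have a larger mean than that multiple.\<close>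

lemma mexp_Y:
  assumes nr: "\<not> rainbow"
  shows "mexp n As Y \<le> b * real s * \<zeta>"
proof -
  have bs: "b \<ge> 0" using b by simp
  have "(\<Sum>i\<in>T. X i L - real r) + Y L \<le> b * real s * Z L" if L: "matching As L" for L
  proof (cases "good L")
    case True
    then have "(\<Sum>i\<in>T. X i L - real r) + Y L \<le> 0" using good_sum[OF L True nr] by (simp add: Y_def)
    also have "0 \<le> b * real s * Z L" using Z_ge(1) bs by simp
    finally show ?thesis .
  next
    case False
    have "(\<Sum>i\<in>T. X i L - real r) \<le> (\<Sum>i\<in>T. b * Z L)"
      using X_excess[OF _ False] T_sub by (intro sum_mono) auto
    also have "\<dots> = real (card T) * (b * Z L)" by simp
    also have "\<dots> \<le> real s * (b * Z L)"
      using card_mono[OF _ T_sub(1)] Z_ge(1) bs by (intro mult_right_mono) auto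
    finally show ?thesis using False by (simp add: Y_def mult_ac)
  qed
  then have "mexp n As (\<lambda>L. (\<Sum>i\<in>T. X i L - real r) + Y L) \<le> mexp n As (\<lambda>L. b * real s * Z L)"
    by (intro mexp_mono)
  also have "\<dots> \<le> b * real s * \<zeta>"
    unfolding mexp_cmult using mexp_Z bs by (intro mult_left_mono) auto
  also have "mexp n As (\<lambda>L. (\<Sum>i\<in>T. X i L - real r) + Y L)
      = (\<Sum>i\<in>T. real n * bmean As (ind (Fam i)) - real r) + mexp n As Y"
    unfolding mexp_add mexp_sum mexp_diff using mexp_hits[OF board order_refl] mexp_const[OF board order_refl]
    by simp
  finally have "(\<Sum>i\<in>T. real n * bmean As (ind (Fam i)) - real r) + mexp n As Y \<le> b * real s * \<zeta>" .
  moreover have "0 \<le> (\<Sum>i\<in>T. real n * bmean As (ind (Fam i)) - real r)"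
    using tight_lower s0 by (intro sum_nonneg) force
  ultimately show ?thesis by linarith
qed

text \<open>In \<open>\<epsilon>\<close> and \<open>\<eta>\<close> the common factor bounds the mean
  of \<open>Y + Z\<close>, that is, the contribution of the matchings outside the equality
  case.\<close>

definition \<epsilon> :: real where "\<epsilon> = b\<^sup>2 * (b * real s * \<zeta> + \<zeta>)"

definition \<eta> :: real where "\<eta> = (real r + b) * (b * real s * \<zeta> + \<zeta>)"

text \<open>In the equality case the deviation vanishes. Otherwise \<open>Y + Z\<close> is at least
  1, which covers deviations up to \<open>b\<close>, and the exponential terms of \<open>Z\<close>
  cover larger ones.\<close>

lemma deviation_bound:
  assumes nr: "\<not> rainbow"
  shows "mexp n As (\<lambda>L. (X s L - real r)\<^sup>2) \<le> \<epsilon>"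
proof -
  have "(X s L - real r)\<^sup>2 \<le> b\<^sup>2 * (Y L + Z L)" for L
  proof (cases "\<bar>X s L - real r\<bar> \<le> b")
    case True
    then have sq: "(X s L - real r)\<^sup>2 \<le> b\<^sup>2" by (metis abs_le_square_iff abs_of_nonneg abs_ge_zero order_trans)
    show ?thesis
    proof (cases "good L \<and> X s L = real r")
      case True
      then show ?thesis using Z_ge(1)[of L] by (simp add: Y_def)
    next
      case False
      then have "1 \<le> Y L + Z L" using Z_ge(1,4)[of L] sT by (cases "good L") (auto simp: Y_def)
      then have "b\<^sup>2 * 1 \<le> b\<^sup>2 * (Y L + Z L)" by (intro mult_left_mono) auto
      then show ?thesis using sq by simp
    qed
  next
    case False
    have s: "s \<in> {1..s}" using s_large by simp
    have "exp (\<theta> * (\<bar>X s L - real r\<bar> - b)) \<le> Z L"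
      using Z_ge(2)[OF s, of L] Z_ge(3)[OF sT, of L] by (cases "real r \<le> X s L") (auto simp: algebra_simps)
    then have "b\<^sup>2 * exp (\<theta> * (\<bar>X s L - real r\<bar> - b)) \<le> b\<^sup>2 * Z L" by (intro mult_left_mono) auto
    then have "(X s L - real r)\<^sup>2 \<le> b\<^sup>2 * Z L"
      using square_le_exp(1)[of "\<bar>X s L - real r\<bar>"] False by simp
    also have "\<dots> \<le> b\<^sup>2 * (Y L + Z L)" by (intro mult_left_mono) (auto simp: Y_def)
    finally show ?thesis .
  qed
  then have "mexp n As (\<lambda>L. (X s L - real r)\<^sup>2) \<le> mexp n As (\<lambda>L. b\<^sup>2 * (Y L + Z L))"
    by (intro mexp_mono)
  also have "\<dots> \<le> \<epsilon>"
    unfolding mexp_cmult mexp_add \<epsilon>_def using mexp_Y[OF nr] mexp_Z by (intro mult_left_mono add_mono) auto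
  finally show ?thesis .
qed

text \<open>In the equality case \<open>good_contained\<close> leaves no tuple to count. Otherwise
  the number of hits is at most (r + b) (Y + Z).\<close>

lemma containment_bound:
  assumes nr: "\<not> rainbow" and i: "i \<in> {1..s}"
  shows "real n * bmean As (ind (Fam i - Fam s)) \<le> \<eta>"
proof -
  have rb: "0 \<le> real r + b" "real r \<ge> 1" using b s0 by auto
  have "hits (ind (Fam i - Fam s)) L \<le> (real r + b) * (Y L + Z L)" if L: "matching As L" for L
  proof -
    have le: "hits (ind (Fam i - Fam s)) L \<le> X i L" by (intro hits_mono) auto
    show ?thesis
    proof (cases "good L")
      case g: True
      show ?thesis
      proof (cases "\<exists>i\<in>T. X i L \<noteq> real r")
        case True
        have "hits (ind (Fam i - Fam s)) L \<le> (real r + b) * 1"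
          using le g i by (force simp: good_def)
        also have "\<dots> \<le> (real r + b) * (Y L + Z L)"
          using g True rb Z_ge(1)[of L] by (intro mult_left_mono) (auto simp: Y_def)
        finally show ?thesis .
      next
        case False
        have "Fam i \<inter> set L \<subseteq> Fam s" using False by (intro good_contained[OF L g nr _ i]) auto
        then have "(Fam i - Fam s) \<inter> set L = {}" by auto
        then have "hits (ind (Fam i - Fam s)) L = 0"
          unfolding hits_ind[OF matching_props(1)[OF L]] by simp
        then show ?thesis using rb Z_ge(1)[of L] by (simp add: Y_def)
      qed
    next
      case False
      have "X i L \<le> real r * 1 + b * Z L" using X_excess[OF i False] by simp
      also have "\<dots> \<le> real r * Z L + b * Z L"
        using Z_ge(4)[OF False] by (intro add_right_mono mult_left_mono) auto
      also have "\<dots> = (real r + b) * Z L" by (simp add: algebra_simps)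
      also have "\<dots> \<le> (real r + b) * (Y L + Z L)" using rb by (intro mult_left_mono) (auto simp: Y_def)
      finally show ?thesis using le by simp
    qed
  qed
  then have "mexp n As (hits (ind (Fam i - Fam s))) \<le> mexp n As (\<lambda>L. (real r + b) * (Y L + Z L))"
    by (intro mexp_mono)
  also have "\<dots> \<le> \<eta>"
    unfolding mexp_cmult mexp_add \<eta>_def using mexp_Y[OF nr] mexp_Z rb by (intro mult_left_mono add_mono) auto
  finally show ?thesis using mexp_hits[OF board order_refl] by simp
qed

text \<open>Starting from s^(-7), \<open>\<epsilon>\<close> loses the factor 2 b^3 s, which is at
  most s^3, and \<open>\<eta>\<close> loses at most 4 s^3.\<close>

lemma parameter_bounds:
  shows "0 \<le> \<epsilon>" "\<epsilon> * real s ^ 4 \<le> 1" "0 \<le> \<eta>" "\<eta> * real s ^ 4 \<le> 4" "\<zeta> * real s ^ 7 \<le> 1"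
proof -
  have s: "real s \<ge> 1000" and b0: "b \<ge> 6" "b \<le> real s" using b s0 by auto
  show z: "\<zeta> * real s ^ 7 \<le> 1" using \<zeta>_le s by (simp add: field_simps)
  have bs1: "1 \<le> b * real s" using mult_mono[of 1 b 1 "real s"] s b0 by simp
  have zz: "0 \<le> b * real s * \<zeta> + \<zeta>" "b * real s * \<zeta> + \<zeta> \<le> 2 * (b * real s * \<zeta>)"
    using b0 s \<zeta>_pos mult_right_mono[OF bs1, of \<zeta>] by auto
  show "0 \<le> \<epsilon>" unfolding \<epsilon>_def using zz by simp
  show "0 \<le> \<eta>" unfolding \<eta>_def using zz b0 by simp
  have "\<epsilon> \<le> b\<^sup>2 * (2 * (b * real s * \<zeta>))" unfolding \<epsilon>_def using zz by (intro mult_left_mono) auto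
  also have "\<dots> = 2 * b ^ 3 * (real s * \<zeta>)" by (simp add: power2_eq_square power3_eq_cube)
  also have "\<dots> \<le> (real s)\<^sup>2 * (real s * \<zeta>)"
  proof (intro mult_right_mono)
    have "0 \<le> b ^ 3" using b0 by simp
    then show "2 * b ^ 3 \<le> (real s)\<^sup>2" using b(3) by linarith
  qed (use \<zeta>_pos in simp)
  finally have "\<epsilon> * real s ^ 4 \<le> (real s)\<^sup>2 * (real s * \<zeta>) * real s ^ 4" by (intro mult_right_mono) auto
  also have "\<dots> = \<zeta> * real s ^ 7" by (simp add: power_numeral_reduce)
  finally show "\<epsilon> * real s ^ 4 \<le> 1" using z by simp
  have "\<eta> \<le> (2 * real s) * (2 * (real s * real s * \<zeta>))"
    unfolding \<eta>_def using zz b0 s0 \<zeta>_pos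
    by (intro mult_mono order_trans[OF zz(2)] mult_left_mono) auto
  then have "\<eta> * real s ^ 4 \<le> (2 * real s) * (2 * (real s * real s * \<zeta>)) * real s ^ 4"
    by (intro mult_right_mono) auto
  also have "\<dots> = 4 * (\<zeta> * real s ^ 7)" by (simp add: power_numeral_reduce)
  finally show "\<eta> * real s ^ 4 \<le> 4" using z by simp
qed

text \<open>For n <= s^3 the product \<epsilon> n is at most 1 / s; then \<open>S\<close> lies in
  one column and \<open>cross S\<close> is empty. For n > s^3 the mean \<alpha> <= s / n is below
  s^(-2), so the third-moment argument applies, and the fewer than s^2 pairs in
  \<open>cross S\<close> are few compared with n / s.\<close>

lemma popular_vertices:
  assumes nr: "\<not> rainbow"
  shows "\<exists>S. finite S \<and> card S = r \<and>
    (\<forall>(j, v)\<in>S. j < k \<and> v \<in> As ! j \<and> 1 - 16 * \<epsilon> \<le> degree As (ind (Fam s)) j v) \<and>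
    real (card (cross S)) * real s \<le> real n"
proof -
  have s: "real s \<ge> 1000" "0 < real s ^ 4" using s0 by auto
  have e4: "\<epsilon> * real s ^ 4 \<le> 1" and e0: "0 \<le> \<epsilon>" using parameter_bounds by auto
  have eps: "c * \<epsilon> * real s ^ p \<le> c / real s ^ (4 - p)" if "0 \<le> c" "p \<le> 4" for c p
  proof -
    have "c * \<epsilon> * real s ^ p * real s ^ (4 - p) = c * (\<epsilon> * real s ^ 4)"
      using that by (simp add: power_add[symmetric])
    also have "\<dots> \<le> c * 1" using e4 that by (intro mult_left_mono) auto
    finally show ?thesis using s by (simp add: field_simps)
  qed
  have esmall: "\<epsilon> \<le> 1/64"
  proof -
    have "1 * \<epsilon> * real s ^ 3 \<le> 1 / real s ^ (4 - 3)" by (intro eps) auto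
    also have "\<dots> \<le> 1" using s by simp
    finally have "\<epsilon> * real s ^ 3 \<le> 1" by simp
    moreover have "64 \<le> real s ^ 3" using power_mono[of 10 "real s" 3] s by simp
    then have "\<epsilon> * 64 \<le> \<epsilon> * real s ^ 3" using e0 by (intro mult_left_mono) auto
    ultimately show ?thesis by simp
  qed
  interpret zero_one_board n As "ind (Fam s)" r \<epsilon>
    using board n_s deviation_bound[OF nr] tight_lower[OF sT] s0 s_large esmall
    by unfold_locales auto
  have kn: "k \<le> n"
  proof -
    have "real k * real s \<le> real n * real s"
      using k_bound b s by (intro order_trans[OF k_bound] mult_left_mono) auto
    then show ?thesis using s by simp
  qed
  show ?thesis
  proof (cases "real n \<le> real s ^ 3")
    case True
    have n: "32 * \<epsilon> * real n < 1"
    proof -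
      have "32 * \<epsilon> * real n \<le> 32 * \<epsilon> * real s ^ 3" using True e0 by (intro mult_left_mono) auto
      also have "\<dots> \<le> 32 / real s ^ (4 - 3)" by (intro eps) auto
      also have "\<dots> < 1" using s by simp
      finally show ?thesis .
    qed
    moreover have "512 * \<epsilon>\<^sup>2 * real n * real (length As) < 1"
    proof -
      have "512 * \<epsilon>\<^sup>2 * real n * real (length As) \<le> 512 * \<epsilon>\<^sup>2 * real n * real n"
        using kn by (intro mult_left_mono) (auto simp: lenAs)
      also have "\<dots> = 1/2 * (32 * \<epsilon> * real n)\<^sup>2" by (simp add: power2_eq_square)
      also have "\<dots> < 1"
        using n e0 abs_square_less_1[of "32 * \<epsilon> * real n"] by simp
      finally show ?thesis .
    qed
    ultimately obtain j V where j: "j < length As" "V \<subseteq> As ! j" "card V = r"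
        "\<And>v. v \<in> V \<Longrightarrow> 1 - 16 * \<epsilon> \<le> degree As (ind (Fam s)) j v"
      using small_board_structure by blast
    have "finite V" using j(1,2) nth_board finite_subset by blast
    moreover have "cross (Pair j ` V) = {}" by (auto simp: cross_def)
    ultimately show ?thesis using j
      by (intro exI[of _ "Pair j ` V"]) (auto simp: card_image inj_on_def lenAs)
  next
    case False
    have n3: "real s ^ 3 < real n" using False by simp
    define \<alpha> where "\<alpha> = bmean As (ind (Fam s))"
    have ns: "real n * \<alpha> \<le> real s" unfolding \<alpha>_def using Fam_upper[of s] s_large by simp
    have \<alpha>0: "0 \<le> \<alpha>" unfolding \<alpha>_def by (intro bmean_nonneg) simp
    have "16 * real r * \<alpha> \<le> 1"
    proof -
      have "real s ^ 3 * \<alpha> \<le> real n * \<alpha>" using n3 \<alpha>0 by (intro mult_right_mono) auto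
      then have "real s * (real s * real s * \<alpha>) \<le> real s * 1" using ns by (simp add: power3_eq_cube)
      then have "real s * real s * \<alpha> \<le> 1" using s by simp
      moreover have "16 * real r * \<alpha> \<le> real s * real s * \<alpha>"
        using s s0 \<alpha>0 by (intro mult_right_mono mult_mono) auto
      ultimately show ?thesis by simp
    qed
    moreover have "144 * \<epsilon> * (real r)\<^sup>2 \<le> 1"
    proof -
      have "144 * \<epsilon> * (real r)\<^sup>2 \<le> 144 * \<epsilon> * (real s)\<^sup>2"
        using s0 e0 by (intro mult_left_mono power_mono) auto
      also have "\<dots> \<le> 144 / real s ^ (4 - 2)" by (intro eps) auto
      also have "\<dots> \<le> 1"
        using power_mono[of 1000 "real s" 2] s by simp
      finally show ?thesis .
    qed
    moreover have "8 * (2 * (real (length As) * \<alpha>) + 13) * \<epsilon> * real r \<le> 1"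
    proof -
      have "real (length As) * \<alpha> \<le> real n * \<alpha>" using kn \<alpha>0 by (intro mult_right_mono) (auto simp: lenAs)
      then have "8 * (2 * (real (length As) * \<alpha>) + 13) * \<epsilon> * real r \<le> 8 * (3 * real s) * \<epsilon> * real s"
        using ns s s0 e0 \<alpha>0 by (intro mult_mono) auto
      also have "\<dots> = 24 * \<epsilon> * (real s)\<^sup>2" by (simp add: power2_eq_square)
      also have "\<dots> \<le> 24 / real s ^ (4 - 2)" by (intro eps) auto
      also have "\<dots> \<le> 1" using power_mono[of 1000 "real s" 2] s by simp
      finally show ?thesis .
    qed
    ultimately obtain S where S: "finite S" "card S = r"
        "\<And>j v. (j, v) \<in> S \<Longrightarrow> j < length As \<and> v \<in> As ! j \<and> 1 - 8 * \<epsilon> \<le> degree As (ind (Fam s)) j v"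
      using large_board_structure unfolding \<alpha>_def by blast
    have "card (cross S) \<le> card (S \<times> S)" using S(1) by (intro card_mono) (auto simp: cross_def)
    then have "card (cross S) \<le> r * r" using S by (simp add: card_cartesian_product)
    then have "real (card (cross S)) \<le> real (r * r)" by (simp only: of_nat_le_iff)
    also have "\<dots> \<le> real s * real s" using s0 by (simp add: mult_mono)
    finally have "real (card (cross S)) * real s \<le> real s * real s * real s" by (intro mult_right_mono) auto
    also have "\<dots> \<le> real n" using n3 by (simp add: power3_eq_cube)
    finally have "real (card (cross S)) * real s \<le> real n" .
    moreover have "1 - 16 * \<epsilon> \<le> degree As (ind (Fam s)) j v" if "(j, v) \<in> S" for j v
      using S(3)[OF that] e0 by linarith
    ultimately show ?thesis using S by (intro exI[of _ S]) (auto simp: lenAs)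
  qed
qed

end

subsection \<open>Extending a tuple outside of all stars\<close>

lemma avg_point: "finite A \<Longrightarrow> v \<in> A \<Longrightarrow> avg A (\<lambda>w. g w * of_bool (w = v)) = g v / real (card A)"
  by (simp add: avg_def of_bool_def if_distrib cong: if_cong)

definition vertex :: "nat \<times> 'a \<Rightarrow> 'a list \<Rightarrow> real" where
  "vertex p x = of_bool (x ! fst p = snd p)"

definition meeting :: "(nat \<times> 'a) set \<Rightarrow> 'a list set" where
  "meeting S = {x. \<exists>p\<in>S. x ! fst p = snd p}"

lemma finite_cross: "finite S \<Longrightarrow> finite (cross S)"
  by (rule finite_subset[of _ "S \<times> S"]) (auto simp: cross_def)

lemma ind_meeting_le: "finite S \<Longrightarrow> ind (meeting S) x \<le> (\<Sum>p\<in>S. vertex p x)"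
proof (cases "x \<in> meeting S")
  case True
  assume S: "finite S"
  from True obtain p where p: "p \<in> S" "vertex p x = 1" by (auto simp: meeting_def vertex_def)
  have "vertex p x \<le> (\<Sum>p\<in>S. vertex p x)" using p S by (intro member_le_sum) (auto simp: vertex_def)
  then show ?thesis using p True by simp
qed (auto simp: vertex_def intro!: sum_nonneg)

text \<open>Bonferroni's inequality. If x contains c >= 1 vertices of \<open>S\<close>, one of them
  forms c - 1 cross pairs with the others, which already suffices.\<close>

lemma ind_meeting_ge:
  assumes S: "finite S"
  shows "(\<Sum>p\<in>S. vertex p x) - (\<Sum>(p, q)\<in>cross S. vertex p x * vertex q x) \<le> ind (meeting S) x"
proof (cases "x \<in> meeting S")
  case True
  then obtain p0 where p0: "p0 \<in> S" "x ! fst p0 = snd p0" by (auto simp: meeting_def)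
  define P where "P = {p \<in> S. x ! fst p = snd p}"
  have P: "finite P" "p0 \<in> P" using S p0 by (auto simp: P_def)
  have 1: "(\<Sum>p\<in>S. vertex p x) = real (card P)"
    using S by (simp add: vertex_def sum_of_bool_eq P_def Int_def)
  have sub: "Pair p0 ` (P - {p0}) \<subseteq> cross S"
    using p0 by (auto simp: cross_def P_def prod_eq_iff)
  have "real (card (P - {p0})) = (\<Sum>q\<in>Pair p0 ` (P - {p0}). (1::real))"
    by (simp add: card_image inj_on_def)
  also have "\<dots> = (\<Sum>(p, q)\<in>Pair p0 ` (P - {p0}). vertex p x * vertex q x)"
    using p0 by (intro sum.cong) (auto simp: vertex_def P_def)
  also have "\<dots> \<le> (\<Sum>(p, q)\<in>cross S. vertex p x * vertex q x)"
    using sub finite_cross[OF S] by (intro sum_mono2) (auto simp: vertex_def)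
  finally have "real (card P) - 1 \<le> (\<Sum>(p, q)\<in>cross S. vertex p x * vertex q x)"
    using P by simp
  then show ?thesis using 1 True by simp
next
  case False
  then have "(\<Sum>p\<in>S. vertex p x) = 0" by (intro sum.neutral) (auto simp: vertex_def meeting_def)
  moreover have "0 \<le> (\<Sum>(p, q)\<in>cross S. vertex p x * vertex q x)"
    by (intro sum_nonneg) (auto simp: vertex_def)
  ultimately show ?thesis using False by simp
qed

lemma bmean_at:
  assumes "board m As" "m > 0" "fst p < length As" "snd p \<in> As ! fst p"
  shows "bmean As (vertex p) = 1 / real m"
proof -
  have ne: "finite A \<and> A \<noteq> {}" if "A \<in> set As" for A using that assms(1,2) by (auto simp: board_def)
  have "bmean As (vertex p) = avg (As ! fst p) (\<lambda>w. of_bool (w = snd p))"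
    unfolding vertex_def by (rule bmean_coordinate[OF ne assms(3)])
  then show ?thesis using board_nth[OF assms(1,3)] assms(4) by (simp add: avg_indicator)
qed

lemma bmean_at_at:
  assumes "board m As" "m > 0" "fst p < length As" "fst q < length As" "fst p \<noteq> fst q"
  shows "bmean As (\<lambda>x. vertex p x * vertex q x) \<le> 1 / (real m)\<^sup>2"
proof -
  have ne: "finite A \<and> A \<noteq> {}" if "A \<in> set As" for A using that assms(1,2) by (auto simp: board_def)
  have "bmean As (\<lambda>x. vertex p x * vertex q x)
      = avg (As ! fst p) (\<lambda>w. of_bool (w = snd p)) * avg (As ! fst q) (\<lambda>w. of_bool (w = snd q))"
    unfolding vertex_def by (rule bmean_two_coordinates[OF ne assms(3-5)])
  also have "\<dots> \<le> (1 / real m) * (1 / real m)"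
    using avg_indicator_le[of "As ! fst p" "snd p"] avg_indicator_le[of "As ! fst q" "snd q"]
      board_nth[OF assms(1,3)] board_nth[OF assms(1,4)]
    by (intro mult_mono avg_nonneg) auto
  finally show ?thesis by (simp add: power2_eq_square)
qed

lemma bmean_meeting_ge:
  assumes "board m As" "m > 0" "finite S" "\<And>p. p \<in> S \<Longrightarrow> fst p < length As \<and> snd p \<in> As ! fst p"
  shows "real (card S) - real (card (cross S)) / real m \<le> real m * bmean As (ind (meeting S))"
proof -
  have "bmean As (\<lambda>x. (\<Sum>p\<in>S. vertex p x) - (\<Sum>(p, q)\<in>cross S. vertex p x * vertex q x)) \<le> bmean As (ind (meeting S))"
    using ind_meeting_ge[OF assms(3)] by (intro bmean_mono)
  moreover have "bmean As (\<lambda>x. (\<Sum>p\<in>S. vertex p x) - (\<Sum>(p, q)\<in>cross S. vertex p x * vertex q x))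
      = (\<Sum>p\<in>S. bmean As (vertex p)) - (\<Sum>pq\<in>cross S. bmean As (\<lambda>x. vertex (fst pq) x * vertex (snd pq) x))"
    unfolding bmean_diff bmean_sum case_prod_unfold ..
  moreover have "(\<Sum>p\<in>S. bmean As (vertex p)) = (\<Sum>p\<in>S. 1 / real m)"
    using assms by (intro sum.cong refl bmean_at) auto
  moreover have "(\<Sum>pq\<in>cross S. bmean As (\<lambda>x. vertex (fst pq) x * vertex (snd pq) x)) \<le> (\<Sum>pq\<in>cross S. 1 / (real m)\<^sup>2)"
    using assms by (intro sum_mono bmean_at_at) (auto simp: cross_def)
  ultimately have "real (card S) / real m - real (card (cross S)) / (real m)\<^sup>2 \<le> bmean As (ind (meeting S))"
    by simp
  then have "real m * (real (card S) / real m - real (card (cross S)) / (real m)\<^sup>2) \<le> real m * bmean As (ind (meeting S))"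
    by (intro mult_left_mono) auto
  then show ?thesis using assms(2) by (simp add: right_diff_distrib power2_eq_square)
qed

lemma bmean_meeting_le:
  assumes "board m As" "m > 0" "finite S" "\<And>p. p \<in> S \<Longrightarrow> fst p < length As \<and> snd p \<in> As ! fst p"
  shows "real m * bmean As (ind (meeting S)) \<le> real (card S)"
proof -
  have "bmean As (ind (meeting S)) \<le> bmean As (\<lambda>x. \<Sum>p\<in>S. vertex p x)"
    using ind_meeting_le[OF assms(3)] by (intro bmean_mono)
  also have "\<dots> = (\<Sum>p\<in>S. 1 / real m)"
    unfolding bmean_sum using assms by (intro sum.cong refl bmean_at) auto
  finally have "real m * bmean As (ind (meeting S)) \<le> real m * (\<Sum>p\<in>S. 1 / real m)"
    by (intro mult_left_mono) auto
  then show ?thesis using assms(2) by simp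
qed

lemma bmean_ind_Diff: "bmean As (ind (F - H)) = bmean As (ind F) - bmean As (ind (F \<inter> H))"
proof -
  have "ind (F - H) = (\<lambda>x. ind F x - ind (F \<inter> H) x)" by (auto simp: fun_eq_iff)
  then show ?thesis by (simp only: bmean_diff)
qed

lemma bmean_ind_triangle: "bmean As (ind (F - H)) \<le> bmean As (ind (F - K)) + bmean As (ind (K - H))"
proof -
  have "bmean As (ind (F - H)) \<le> bmean As (\<lambda>x. ind (F - K) x + ind (K - H) x)"
  proof (rule bmean_mono)
    fix x
    show "ind (F - H) x \<le> ind (F - K) x + ind (K - H) x"
      by (cases "x \<in> F"; cases "x \<in> H"; cases "x \<in> K") simp_all
  qed
  then show ?thesis by (simp only: bmean_add)
qed

text \<open>Disjoint tuples meet \<open>S\<close> in different vertices, so choosing a vertex of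
  \<open>S\<close> on each tuple is injective.\<close>

lemma matching_meeting_le:
  assumes "finite S" "As \<noteq> []" "matching As L" "\<And>p. p \<in> S \<Longrightarrow> fst p < length As"
  shows "card (meeting S \<inter> set L) \<le> card S"
proof -
  define h where "h = (\<lambda>x. SOME p. p \<in> S \<and> x ! fst p = snd p)"
  have h: "h x \<in> S \<and> x ! fst (h x) = snd (h x)" if x: "x \<in> meeting S" for x
  proof -
    obtain p where "p \<in> S \<and> x ! fst p = snd p" using x unfolding meeting_def by blast
    then show ?thesis unfolding h_def by (rule someI[where P = "\<lambda>p. p \<in> S \<and> x ! fst p = snd p"])
  qed
  have "inj_on h (meeting S \<inter> set L)"
  proof (rule inj_onI, rule ccontr)
    fix x y assume xy: "x \<in> meeting S \<inter> set L" "y \<in> meeting S \<inter> set L" "h x = h y" "x \<noteq> y"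
    then have "list_all2 (\<noteq>) x y" using matching_pairwise[OF assms(3)] by auto
    moreover have "fst (h x) < length x"
      using h[of x] assms(4) xy(1) fits_length[OF matching_fits[OF assms(3), of x]] by auto
    ultimately have "x ! fst (h x) \<noteq> y ! fst (h x)" by (auto simp: list_all2_conv_all_nth)
    then show False using h[of x] h[of y] xy by auto
  qed
  then show ?thesis using h assms(1) by (intro card_inj_on_le[of h]) auto
qed

section \<open>A random perfect matching around a tuple that misses all stars\<close>

context families
begin

theorem rainbow_exists: rainbow
proof (rule ccontr)
  assume nr: "\<not> rainbow"
  obtain S where S: "finite S" "card S = r"
    "\<And>p. p \<in> S \<Longrightarrow> fst p < k \<and> snd p \<in> As ! fst p \<and> 1 - 16 * \<epsilon> \<le> degree As (ind (Fam s)) (fst p) (snd p)"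
    "real (card (cross S)) * real s \<le> real n"
    using popular_vertices[OF nr]
    by (force simp: case_prod_unfold)
  define J where "J = meeting S"
  define m where "m = n - 1"
  \<comment> \<open>Each of the r stars has at most a fraction 16 \<epsilon> outside
    \<open>Fam s\<close>, so \<sigma> bounds the expected number of tuples of
    \<open>J - Fam s\<close> in a random perfect matching.\<close>
  define \<sigma> where "\<sigma> = 16 * real r * \<epsilon>"
  have s: "real s \<ge> 1000" and n: "n > 0" "n \<ge> 2" "m > 0" "real n = real m + 1" "real n \<ge> real s"
    using s0 n_s by (auto simp: m_def)
  have pb: "0 \<le> \<epsilon>" "0 \<le> \<eta>" and \<sigma>s: "0 \<le> \<sigma>" "\<sigma> \<le> 1/50" and small: "real s * (4 * (\<sigma> + \<eta>)) \<le> 1/2" "\<eta> \<le> 1/10" "\<zeta> \<le> 1/10"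
  proof -
    have e: "\<epsilon> * real s ^ 4 \<le> 1" and h: "\<eta> * real s ^ 4 \<le> 4" and z: "\<zeta> * real s ^ 7 \<le> 1"
      and pos: "0 \<le> \<epsilon>" "0 \<le> \<eta>" using parameter_bounds by auto
    show "0 \<le> \<epsilon>" "0 \<le> \<eta>" using pos by auto
    have "\<sigma> \<le> 16 * real s * \<epsilon>" unfolding \<sigma>_def using pos by (intro mult_mono) auto
    then have "\<sigma> * real s ^ 3 \<le> 16 * real s * \<epsilon> * real s ^ 3" by (intro mult_right_mono) auto
    also have "\<dots> = 16 * (\<epsilon> * real s ^ 4)" by (simp add: power_numeral_reduce)
    finally have sg: "\<sigma> * real s ^ 3 \<le> 16" using e by linarith
    show sg0: "0 \<le> \<sigma>" unfolding \<sigma>_def using pos by simp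
    have s2: "(1000::real) * 1000 \<le> real s * real s" using s by (intro mult_mono) auto
    have *: "\<sigma> * (real s * real s) * real s \<le> 16" using sg by (simp add: power_numeral_reduce)
    have "\<sigma> * 1000000 * 1000 \<le> \<sigma> * (real s * real s) * real s"
      using s2 s sg0 by (intro mult_mono) auto
    then show "\<sigma> \<le> 1/50" using * by simp
    have "\<sigma> * real s * 1000000 \<le> \<sigma> * real s * (real s * real s)"
      using s2 sg0 by (intro mult_left_mono) auto
    then have 1: "real s * \<sigma> \<le> 1/100" using * by (simp add: mult_ac)
    have h': "\<eta> * real s * (real s * real s * real s) \<le> 4" using h by (simp add: power_numeral_reduce mult_ac)
    have s3: "(1000::real) * 1000 * 1000 \<le> real s * real s * real s" using s by (intro mult_mono) auto
    have "\<eta> * real s * 1000000000 \<le> \<eta> * real s * (real s * real s * real s)"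
      using s3 pos by (intro mult_left_mono) auto
    then have 2: "real s * \<eta> \<le> 1/100" using h' by (simp add: mult_ac)
    show "real s * (4 * (\<sigma> + \<eta>)) \<le> 1/2" using 1 2 by (simp add: algebra_simps)
    have "1 * \<eta> \<le> real s * \<eta>" using s pos by (intro mult_right_mono) auto
    then show "\<eta> \<le> 1/10" using 2 by simp
    have "1 \<le> real s ^ 6" using s by (intro one_le_power) auto
    then have "10 * 1 \<le> real s * real s ^ 6" using s by (intro mult_mono) auto
    then have "\<zeta> * 10 \<le> \<zeta> * real s ^ 7" using \<zeta>_pos by (intro mult_left_mono) (auto simp: power_numeral_reduce)
    then show "\<zeta> \<le> 1/10" using z by simp
  qed
  have SA: "fst p < length As \<and> snd p \<in> As ! fst p" if "p \<in> S" for p using S(3)[OF that] lenAs by auto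
  have col: "real (card (cross S)) / real n \<le> 1/4" "real (card (cross S)) / real m \<le> 1/4"
  proof -
    have "real (card (cross S)) * 1000 \<le> real (card (cross S)) * real s" using s by (intro mult_left_mono) auto
    then have *: "real (card (cross S)) * 1000 \<le> real n" using S(4) by linarith
    then show "real (card (cross S)) / real n \<le> 1/4" using n by (simp add: field_simps)
    have "real n \<le> 2 * real m" using n s by linarith
    then show "real (card (cross S)) / real m \<le> 1/4" using * n(3) by (simp add: field_simps)
  qed
  have rs: "real r = real s - 1" using s0 by simp

  obtain G where G: "fits G As" "G \<in> Fam s" "G \<notin> J"
  proof -
    have "bmean As (ind J) < bmean As (ind (Fam s))"
    proof -
      have "real n * bmean As (ind J) \<le> real s - 1"
        using bmean_meeting_le[OF board n(1) S(1) SA] S(2) rs by (simp add: J_def)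
      also have "\<dots> < real n * bmean As (ind (Fam s))" by (rule tight_lower[OF sT])
      finally show ?thesis using n by simp
    qed
    then have "\<not> (\<forall>x. fits x As \<longrightarrow> ind (Fam s) x \<le> ind J x)"
      using bmean_mono[of As "ind (Fam s)" "ind J"] by force
    then show ?thesis using that by (auto simp: not_le of_bool_def split: if_splits)
  qed
  define Bs where "Bs = strike As G"
  have Bs: "board m Bs" "length Bs = k" using board_strike[OF board G(1)] fits_length[OF G(1)] lenAs
    by (auto simp: Bs_def m_def)
  \<comment> \<open>\<open>G\<close> misses \<open>S\<close>, so striking it removes no vertex of
    \<open>S\<close>, and on the smaller board \<open>J\<close> still has mean almost
    \<open>r\<close>.\<close>
  have SB: "fst p < length Bs \<and> snd p \<in> Bs ! fst p" if "p \<in> S" for p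
    using SA[OF that] that G(3) Bs lenAs fits_length[OF G(1)]
    by (auto simp: Bs_def strike_nth J_def meeting_def)
  have to_Bs: "real m * bmean Bs g \<le> 2 * (real n * bmean As g)" if "\<And>x. 0 \<le> g x" for g
  proof -
    have "real n / real (n - 1) \<le> real m0 / real (m0 - 1)"
      using m0 n by (simp add: field_simps of_nat_diff)
    then have "(real n / real (n - 1)) ^ k \<le> (real m0 / real (m0 - 1)) ^ k" by (intro power_mono) auto
    then have \<rho>: "(real n / real (n - 1)) ^ k \<le> 2" using ratio by linarith
    have g0: "0 \<le> bmean As g" using that by (intro bmean_nonneg)
    have "bmean Bs g \<le> (real n / real (n - 1)) ^ k * bmean As g"
      using bmean_strike_le[OF board n(2) G(1) that] by (simp add: Bs_def lenAs)
    also have "\<dots> \<le> 2 * bmean As g" using \<rho> g0 by (intro mult_right_mono) auto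
    finally have "real m * bmean Bs g \<le> real n * (2 * bmean As g)"
      using n g0 by (intro mult_mono) (auto intro: bmean_nonneg[OF that])
    then show ?thesis by simp
  qed

  have JFs: "real n * bmean As (ind (J - Fam s)) \<le> \<sigma>"
  proof -
    have "ind (J - Fam s) x \<le> (\<Sum>p\<in>S. vertex p x - ind (Fam s) x * vertex p x)" for x
    proof (cases "x \<in> Fam s")
      case False
      then show ?thesis using ind_meeting_le[OF S(1), of x] by (simp add: J_def)
    qed simp
    then have "bmean As (ind (J - Fam s)) \<le> bmean As (\<lambda>x. \<Sum>p\<in>S. vertex p x - ind (Fam s) x * vertex p x)"
      by (intro bmean_mono)
    also have "\<dots> = (\<Sum>p\<in>S. bmean As (vertex p) - bmean As (\<lambda>x. ind (Fam s) x * vertex p x))"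
      unfolding bmean_sum bmean_diff ..
    also have "\<dots> \<le> (\<Sum>p\<in>S. 16 * \<epsilon> / real n)"
    proof (intro sum_mono)
      fix p assume p: "p \<in> S"
      note Ap = board_nth[OF board conjunct1[OF SA[OF p]]]
      have "bmean As (\<lambda>x. ind (Fam s) x * vertex p x) = degree As (ind (Fam s)) (fst p) (snd p) / real n"
        unfolding vertex_def using SA[OF p] Ap
        by (subst bmean_times_coordinate[where h = "\<lambda>w. of_bool (w = snd p)"]) (auto simp: avg_point)
      moreover have "bmean As (vertex p) = 1 / real n" using SA[OF p] by (intro bmean_at[OF board n(1)]) auto
      moreover have "1 / real n - degree As (ind (Fam s)) (fst p) (snd p) / real n \<le> 16 * \<epsilon> / real n"
        unfolding diff_divide_distrib[symmetric] using S(3)[OF p] by (intro divide_right_mono) auto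
      ultimately show "bmean As (vertex p) - bmean As (\<lambda>x. ind (Fam s) x * vertex p x) \<le> 16 * \<epsilon> / real n" by simp
    qed
    also have "\<dots> = \<sigma> / real n" using S by (simp add: \<sigma>_def)
    finally show ?thesis using n by (simp add: field_simps)
  qed
  \<comment> \<open>The mean of \<open>Fam s\<close> is at most s, and that of its part in
    \<open>J\<close> is at least s - 1 - 1/4 - \<sigma>.\<close>
  have FsJ: "real n * bmean As (ind (Fam s - J)) \<le> 2"
  proof -
    have "real n * bmean As (ind (Fam s \<inter> J)) = real n * bmean As (ind J) - real n * bmean As (ind (J - Fam s))"
      unfolding bmean_ind_Diff by (simp add: right_diff_distrib Int_commute)
    moreover have "real r - real (card (cross S)) / real n \<le> real n * bmean As (ind J)"
      using bmean_meeting_ge[OF board n(1) S(1) SA] S(2) by (simp add: J_def)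
    moreover have "real n * bmean As (ind (Fam s)) \<le> real s" using Fam_upper[of s] s_large by simp
    moreover have "real n * bmean As (ind (Fam s - J)) = real n * bmean As (ind (Fam s)) - real n * bmean As (ind (Fam s \<inter> J))"
      unfolding bmean_ind_Diff by (simp add: right_diff_distrib)
    ultimately show ?thesis using JFs col \<sigma>s rs by linarith
  qed

  \<comment> \<open>Tight families have equal size, so the bound for \<open>Fam i - Fam s\<close>
    holds for \<open>Fam s - Fam i\<close> as well. The factor 2 pays for the passage to
    \<open>Bs\<close>.\<close>
  have tight: "real m * bmean Bs (ind (J - Fam i)) \<le> 2 * (\<sigma> + \<eta>)" if i: "i \<in> T" for i
  proof -
    have i1: "i \<in> {1..s}" using i T_sub by auto
    have "bmean As (ind (Fam s - Fam i)) = bmean As (ind (Fam i - Fam s))"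
      unfolding bmean_ind_Diff using Fam_tight[OF i1] i by (simp add: T_def Int_commute)
    then have "real n * bmean As (ind (Fam s - Fam i)) \<le> \<eta>" using containment_bound[OF nr i1] by simp
    moreover have "real n * bmean As (ind (J - Fam i))
        \<le> real n * (bmean As (ind (J - Fam s)) + bmean As (ind (Fam s - Fam i)))"
      by (intro mult_left_mono bmean_ind_triangle) auto
    ultimately have "real n * bmean As (ind (J - Fam i)) \<le> \<sigma> + \<eta>" using JFs by (simp add: distrib_left)
    then show ?thesis using to_Bs[of "ind (J - Fam i)"] by simp
  qed

  \<comment> \<open>From the mean, above i + 2 b, at most \<eta> + 2 is lost outside
    \<open>J\<close>, and at most 2 b / 3 through tuples that meet both \<open>S\<close> and
    \<open>G\<close>. The two vertices of such a tuple lie in different columns, so each pair has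
    probability at most 1 / n^2. As b >= 7, at least i + b remains.\<close>
  have slack: "real i + b \<le> real m * bmean Bs (ind (Fam i))" if i: "i \<in> {1..s} - T" for i
  proof -
    define g where "g = ind (Fam i \<inter> J)"
    define dj where "dj = (\<lambda>x. of_bool (list_all2 (\<noteq>) x G) :: real)"
    have "real n * bmean As (\<lambda>x. g x * (1 - dj x)) \<le> 2 * b / 3"
    proof -
      have "g x * (1 - dj x) \<le> (\<Sum>p\<in>S. \<Sum>j<k. vertex p x * vertex (j, G ! j) x)" if fx: "fits x As" for x
      proof (cases "x \<in> J \<and> \<not> list_all2 (\<noteq>) x G")
        case True
        then obtain p where p: "p \<in> S" "vertex p x = 1" by (auto simp: J_def meeting_def vertex_def)
        from True obtain j where j: "j < k" "x ! j = G ! j"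
          using fits_length[OF fx] fits_length[OF G(1)] lenAs by (auto simp: list_all2_conv_all_nth)
        have "1 = vertex p x * vertex (j, G ! j) x" using p j by (simp add: vertex_def)
        also have "\<dots> \<le> (\<Sum>j<k. vertex p x * vertex (j, G ! j) x)"
          using j by (intro member_le_sum) (auto simp: vertex_def)
        also have "\<dots> \<le> (\<Sum>p\<in>S. \<Sum>j<k. vertex p x * vertex (j, G ! j) x)"
          using p S(1) by (intro member_le_sum[of p S "\<lambda>p. \<Sum>j<k. vertex p x * vertex (j, G ! j) x"])
            (auto simp: vertex_def intro!: sum_nonneg)
        finally show ?thesis by (auto simp: g_def dj_def of_bool_def)
      next
        case False
        then have "g x * (1 - dj x) = 0" by (auto simp: g_def dj_def)
        then show ?thesis by (auto simp: vertex_def intro!: sum_nonneg)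
      qed
      then have "bmean As (\<lambda>x. g x * (1 - dj x)) \<le> bmean As (\<lambda>x. \<Sum>p\<in>S. \<Sum>j<k. vertex p x * vertex (j, G ! j) x)"
        by (rule bmean_mono)
      also have "\<dots> = (\<Sum>p\<in>S. \<Sum>j<k. bmean As (\<lambda>x. vertex p x * vertex (j, G ! j) x))"
        unfolding bmean_sum ..
      also have "\<dots> \<le> (\<Sum>p\<in>S. \<Sum>j<k. 1 / (real n)\<^sup>2)"
      proof (intro sum_mono)
        fix p j assume p: "p \<in> S" and j: "j \<in> {..<k}"
        show "bmean As (\<lambda>x. vertex p x * vertex (j, G ! j) x) \<le> 1 / (real n)\<^sup>2"
        proof (cases "fst p = j")
          case True
          then have "snd p \<noteq> G ! j" using G(3) p by (auto simp: J_def meeting_def)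
          then have "(\<lambda>x. vertex p x * vertex (j, G ! j) x) = (\<lambda>x. 0)" using True by (auto simp: vertex_def fun_eq_iff)
          then show ?thesis by simp
        next
          case False
          then show ?thesis using SA[OF p] j lenAs by (intro bmean_at_at[OF board n(1)]) auto
        qed
      qed
      also have "\<dots> = real r * real k / (real n)\<^sup>2" using S by simp
      finally have "real n * bmean As (\<lambda>x. g x * (1 - dj x)) \<le> real n * (real r * real k / (real n)\<^sup>2)"
        by (intro mult_left_mono) auto
      also have "\<dots> = real r * real k / real n" using n by (simp add: power2_eq_square)
      also have "\<dots> \<le> real s * real k / real n" by (intro divide_right_mono mult_right_mono) auto
      also have "\<dots> \<le> 2 * b / 3" using k_bound n(1) by (simp add: field_simps)
      finally show ?thesis .
    qed
    moreover have "real n * bmean As (\<lambda>x. g x * (1 - dj x)) = real n * bmean As g - real n * bmean As (\<lambda>x. g x * dj x)"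
      by (simp add: right_diff_distrib bmean_diff)
    \<comment> \<open>The tuples summed are the same on both sides, so the left side is (m / n)^(k -
      1) times the right one.\<close>
    moreover have "real n * bmean As (\<lambda>x. g x * dj x) \<le> real m * bmean Bs g"
    proof -
      define D where "D = real n * bmean As (\<lambda>x. g x * dj x)"
      have D0: "0 \<le> D" unfolding D_def by (intro mult_nonneg_nonneg bmean_nonneg) (auto simp: g_def dj_def)
      have "real n ^ k * bmean As (\<lambda>x. g x * dj x) = real m ^ k * bmean Bs g"
        using bmean_disjoint_strike[OF board n(2) G(1), of g] by (simp add: dj_def lenAs Bs_def m_def)
      then have "real n ^ (k - 1) * D = real m ^ (k - 1) * (real m * bmean Bs g)"
        using k1 by (cases k) (auto simp: D_def mult_ac)
      moreover have "real m ^ (k - 1) * D \<le> real n ^ (k - 1) * D"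
        using D0 n by (intro mult_right_mono power_mono) auto
      ultimately have "real m ^ (k - 1) * D \<le> real m ^ (k - 1) * (real m * bmean Bs g)" by simp
      then show ?thesis using n(3) by (simp add: D_def)
    qed
    moreover have "real m * bmean Bs g \<le> real m * bmean Bs (ind (Fam i))"
      by (intro mult_left_mono bmean_mono) (auto simp: g_def)
    moreover have "real n * bmean As g = real n * bmean As (ind (Fam i)) - real n * bmean As (ind (Fam i - J))"
      unfolding bmean_ind_Diff g_def by (simp add: right_diff_distrib)
    moreover have "real n * bmean As (ind (Fam i - J)) \<le> \<eta> + 2"
    proof -
      have "real n * bmean As (ind (Fam i - J)) \<le> real n * (bmean As (ind (Fam i - Fam s)) + bmean As (ind (Fam s - J)))"
        by (intro mult_left_mono bmean_ind_triangle) auto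
      then show ?thesis using containment_bound[OF nr, of i] i FsJ by (simp add: distrib_left)
    qed
    moreover have "real i + 2 * b < real n * bmean As (ind (Fam i))" by (rule slack_lower[OF i])
    ultimately show ?thesis using small(2) b(1) by linarith
  qed

  \<comment> \<open>A single nonnegative quantity for all requirements, with mean at most 1/4 + 1/4
    + 1/10. If it is below 1, the integral terms vanish: \<open>L\<close> contains r tuples of
    \<open>J\<close>, all of which belong to every tight family, and each slack family has more than
    i members.\<close>
  define W where "W = (\<lambda>L. (real r - hits (ind J) L) + ((\<Sum>i\<in>T. hits (ind (J - Fam i)) L)
      + (\<Sum>i\<in>{1..s} - T. exp (\<theta> * (real i - X i L)))))"
  have m200: "200 * m0 \<le> m" using m0 by (simp add: m_def)
  have "mexp m Bs W < mexp m Bs (\<lambda>_. 1)"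
  proof -
    have "mexp m Bs W = (real r - real m * bmean Bs (ind J)) + ((\<Sum>i\<in>T. real m * bmean Bs (ind (J - Fam i)))
        + (\<Sum>i\<in>{1..s} - T. mexp m Bs (\<lambda>L. exp (\<theta> * (real i - X i L)))))"
      unfolding W_def mexp_add mexp_diff mexp_sum mexp_hits[OF Bs(1) order_refl] mexp_const[OF Bs(1) order_refl] ..
    moreover have "real r - real m * bmean Bs (ind J) \<le> 1/4"
      using bmean_meeting_ge[OF Bs(1) n(3) S(1) SB] S(2) col(2) by (simp add: J_def)
    moreover have "(\<Sum>i\<in>T. real m * bmean Bs (ind (J - Fam i))) \<le> 1/4"
    proof -
      have "(\<Sum>i\<in>T. real m * bmean Bs (ind (J - Fam i))) \<le> real (card T) * (2 * (\<sigma> + \<eta>))"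
        using tight by (intro sum_bounded_above) auto
      also have "\<dots> \<le> real s * (2 * (\<sigma> + \<eta>))"
        using card_mono[OF _ T_sub(1)] \<sigma>s pb by (intro mult_right_mono) auto
      also have "\<dots> = 1/2 * (real s * (4 * (\<sigma> + \<eta>)))" by simp
      finally show ?thesis using small(1) by linarith
    qed
    moreover have "(\<Sum>i\<in>{1..s} - T. mexp m Bs (\<lambda>L. exp (\<theta> * (real i - X i L)))) \<le> 1/10"
    proof -
      define E where "E = exp (3 * \<theta>\<^sup>2 * real s + \<theta> - \<theta> * b)"
      have "mexp m Bs (\<lambda>L. exp (\<theta> * (real i - X i L))) \<le> E" if i: "i \<in> {1..s} - T" for i
      proof -
        have "mexp m Bs (\<lambda>L. exp (\<theta> * (real i - X i L))) \<le> exp (\<theta> * real i - (\<theta> - 3 * \<theta>\<^sup>2) * (real i + b))"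
          using slack[OF i] by (intro tail_lower[OF Bs m200]) auto
        also have "\<dots> \<le> E"
        proof -
          have "real i + b \<le> real s" using i b by (auto simp: T_def)
          then have "\<theta>\<^sup>2 * (real i + b) \<le> \<theta>\<^sup>2 * real s" by (intro mult_left_mono) auto
          moreover have "\<theta> * real i - (\<theta> - 3 * \<theta>\<^sup>2) * (real i + b) = 3 * (\<theta>\<^sup>2 * (real i + b)) - \<theta> * b"
            by (simp add: algebra_simps)
          ultimately show ?thesis using \<theta> unfolding E_def exp_le_cancel_iff by linarith
        qed
        finally show ?thesis .
      qed
      then have "(\<Sum>i\<in>{1..s} - T. mexp m Bs (\<lambda>L. exp (\<theta> * (real i - X i L)))) \<le> real (card ({1..s} - T)) * E"
        by (intro sum_bounded_above) auto
      also have "\<dots> \<le> real s * E"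
        using card_mono[of "{1..s}" "{1..s} - T"] by (intro mult_right_mono) (auto simp: E_def)
      also have "\<dots> \<le> \<zeta>" by (simp add: \<zeta>_def E_def)
      finally show ?thesis using small(3) by simp
    qed
    moreover have "mexp m Bs (\<lambda>_. 1) = 1" by (rule mexp_const[OF Bs(1) order_refl])
    ultimately show ?thesis by linarith
  qed
  then obtain L where L: "matching Bs L" "W L < 1" using mexp_less_obtains by metis
  have Bne: "Bs \<noteq> []" using Bs(2) k1 by auto
  have dist: "distinct L" using matching_distinct[OF Bne L(1)] .
  have hJ: "hits (ind J) L = real (card (J \<inter> set L))" by (rule hits_ind[OF dist])
  have Jle: "card (J \<inter> set L) \<le> r"
    using matching_meeting_le[OF S(1) Bne L(1)] SB S(2) by (auto simp: J_def)
  have h0: "0 \<le> hits (ind F) L" for F unfolding hits_ind[OF dist] by simp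
  have parts: "real r - hits (ind J) L < 1" "i \<in> T \<Longrightarrow> hits (ind (J - Fam i)) L < 1"
    "i \<in> {1..s} - T \<Longrightarrow> exp (\<theta> * (real i - X i L)) < 1" for i
  proof -
    have A: "0 \<le> real r - hits (ind J) L" using Jle hJ by simp
    have B: "hits (ind (J - Fam i)) L \<le> (\<Sum>i\<in>T. hits (ind (J - Fam i)) L)" if "i \<in> T" for i
      by (rule member_le_sum[of i T "\<lambda>i. hits (ind (J - Fam i)) L", OF that h0 T_sub(2)])
    have C: "exp (\<theta> * (real i - X i L)) \<le> (\<Sum>i\<in>{1..s} - T. exp (\<theta> * (real i - X i L)))" if "i \<in> {1..s} - T" for i
      using that by (intro member_le_sum[of i "{1..s} - T" "\<lambda>i. exp (\<theta> * (real i - X i L))"]) auto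
    have B0: "0 \<le> (\<Sum>i\<in>T. hits (ind (J - Fam i)) L)" using h0 by (intro sum_nonneg)
    have C0: "0 \<le> (\<Sum>i\<in>{1..s} - T. exp (\<theta> * (real i - X i L)))" by (intro sum_nonneg) simp
    show "real r - hits (ind J) L < 1" using L(2) B0 C0 unfolding W_def by linarith
    show "hits (ind (J - Fam i)) L < 1" if "i \<in> T" using L(2) A B[OF that] C0 unfolding W_def by linarith
    show "exp (\<theta> * (real i - X i L)) < 1" if "i \<in> {1..s} - T"
      using L(2) A B0 C[OF that] unfolding W_def by linarith
  qed
  have Jr: "card (J \<inter> set L) = r" using parts(1) Jle hJ by simp
  have cnt_ge: "i \<le> cnt i L" if i: "i \<in> {1..r}" for i
  proof (cases "i \<in> T")
    case True
    have "card ((J - Fam i) \<inter> set L) = 0" using parts(2)[OF True] hits_ind[OF dist, of "J - Fam i"] by simp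
    then have "J \<inter> set L \<subseteq> Fam i \<inter> set L" by auto
    then have "r \<le> cnt i L" using Jr card_mono[of "Fam i \<inter> set L" "J \<inter> set L"] by simp
    then show ?thesis using i by simp
  next
    case False
    then have "exp (\<theta> * (real i - X i L)) < 1" using i by (intro parts(3)) auto
    then have "\<theta> * (real i - X i L) < 0" by simp
    then have "real i < X i L" using \<theta>(1) by (simp add: mult_less_0_iff)
    then show ?thesis using hits_ind[OF dist, of "Fam i"] by simp
  qed
  have "\<exists>c. inj_on c {1..r} \<and> (\<forall>i\<in>{1..r}. c i \<in> Fam i \<inter> set L)"
  proof (rule distinct_representatives)
    fix q assume q: "1 \<le> q" "q \<le> card {1..r}"
    have "{i \<in> {1..r}. cnt i L < q} \<subseteq> {1..<q}"     proof
      fix i assume "i \<in> {i \<in> {1..r}. cnt i L < q}"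
      then show "i \<in> {1..<q}" using cnt_ge[of i] by simp
    qed
    then have "card {i \<in> {1..r}. cnt i L < q} \<le> card {1..<q}" by (intro card_mono) auto
    then show "card {i \<in> {1..r}. cnt i L < q} < q" using q by simp
  qed auto
  then obtain c where c: "inj_on c {1..r}" "\<And>i. i \<in> {1..r} \<Longrightarrow> c i \<in> Fam i \<inter> set L" by blast
  define F where "F = c(s := G)"
  have cG: "list_all2 (\<noteq>) (c i) G" if "i \<in> {1..r}" for i
    using matching_fits[OF L(1), of "c i"] c(2)[OF that] fits_strike[OF G(1)] by (auto simp: Bs_def)
  have rainbow
    unfolding rainbow_def
  proof (intro exI[of _ F] conjI ballI impI)
    fix i assume i: "i \<in> {1..s}"
    show "F i \<in> Fam i" using c(2)[of i] G(2) i by (cases "i = s") (auto simp: F_def)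
  next
    fix i j assume ij: "i \<in> {1..s}" "j \<in> {1..s}" "i \<noteq> j"
    consider "i = s" "j \<in> {1..r}" | "j = s" "i \<in> {1..r}" | "i \<in> {1..r}" "j \<in> {1..r}" "i \<noteq> s" "j \<noteq> s"
      using ij by (cases "i = s"; cases "j = s") auto
    then show "list_all2 (\<noteq>) (F i) (F j)"
    proof cases
      case 1
      then show ?thesis using cG[of j] ij by (auto simp: F_def intro: list_all2_neq_sym)
    next
      case 2
      then show ?thesis using cG[of i] ij by (auto simp: F_def)
    next
      case 3
      then have "c i \<noteq> c j" using c(1) ij by (auto dest: inj_onD)
      then show ?thesis using 3 c(2) matching_pairwise[OF L(1), of "c i" "c j"] by (auto simp: F_def)
    qed
  qed
  then show False using nr by simp
qed

end

subsection \<open>From lists to tuples\<close>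

lemma sum_fits:
  assumes "board n As" "n > 0"
  shows "real n ^ length As * bmean As f = (\<Sum>x | fits x As. f x)"
  using assms(1)
proof (induction As arbitrary: f)
  case (Cons A As)
  have A: "finite A" "card A = n" using Cons.prems by auto
  have "{x. fits x (A # As)} = (\<lambda>(a, y). a # y) ` (A \<times> {y. fits y As})"
    by (auto simp: fits_Cons)
  then have "(\<Sum>x | fits x (A # As). f x) = (\<Sum>(a, y)\<in>A \<times> {y. fits y As}. f (a # y))"
    by (simp add: sum.reindex inj_on_def case_prod_unfold)
  also have "\<dots> = (\<Sum>a\<in>A. \<Sum>y | fits y As. f (a # y))"
    by (simp add: sum.cartesian_product)
  also have "\<dots> = (\<Sum>a\<in>A. real n ^ length As * bmean As (\<lambda>y. f (a # y)))"
    using Cons by simp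
  also have "\<dots> = real n ^ length (A # As) * bmean (A # As) f"
    using A assms(2) by (simp add: avg_def sum_distrib_left sum_divide_distrib)
  finally show ?case by simp
qed simp

lemma bmean_ind_card:
  assumes "board n As" "n > 0" "\<And>x. x \<in> F \<Longrightarrow> fits x As"
  shows "real n ^ length As * bmean As (ind F) = real (card F)"
proof -
  have "{x. fits x As} \<inter> F = F" using assms(3) by auto
  moreover have "finite {x. fits x As}" using assms(1)
  proof (induction As)
    case (Cons A As)
    have "{x. fits x (A # As)} = (\<lambda>(a, y). a # y) ` (A \<times> {y. fits y As})"
      by (auto simp: fits_Cons)
    then show ?case using Cons by simp
  qed simp
  ultimately show ?thesis using sum_fits[OF assms(1,2), of "ind F"] by (simp add: sum_of_bool_eq)
qed

definition list_of_tuple :: "nat \<Rightarrow> (nat \<Rightarrow> nat) \<Rightarrow> nat list" where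
  "list_of_tuple k x = map x [1..<Suc k]"

lemma list_of_tuple_nth: "j < k \<Longrightarrow> list_of_tuple k x ! j = x (Suc j)"
  unfolding list_of_tuple_def by (subst nth_map) (auto simp del: upt_Suc)

lemma length_list_of_tuple [simp]: "length (list_of_tuple k x) = k"
  by (simp add: list_of_tuple_def)

lemma inj_on_list_of_tuple: "inj_on (list_of_tuple k) (tuples n k)"
proof (rule inj_onI)
  fix x y assume xy: "x \<in> tuples n k" "y \<in> tuples n k" "list_of_tuple k x = list_of_tuple k y"
  show "x = y"
  proof (rule PiE_ext)
    show "x \<in> {1..k} \<rightarrow>\<^sub>E {1..n}" "y \<in> {1..k} \<rightarrow>\<^sub>E {1..n}" using xy by (simp_all add: tuples_def)
    fix i assume "i \<in> {1..k}"
    then show "x i = y i"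
      using xy(3) list_of_tuple_nth[of "i - 1" k x] list_of_tuple_nth[of "i - 1" k y] by auto
  qed
qed

lemma fits_list_of_tuple:
  assumes "x \<in> tuples n k"
  shows "fits (list_of_tuple k x) (replicate k {1..n})"
  using assms by (auto simp: fits_iff list_of_tuple_nth tuples_def PiE_def Pi_def)

lemma list_of_tuple_disjnt:
  assumes "list_all2 (\<noteq>) (list_of_tuple k x) (list_of_tuple k y)"
  shows "disjnt (tuple_set k x) (tuple_set k y)"
  unfolding tuple_set_disjnt_iff
proof
  fix j assume "j \<in> {1..k}"
  then have "j - 1 < k" "Suc (j - 1) = j" by auto
  then show "x j \<noteq> y j"
    using assms list_of_tuple_nth[of "j - 1" k x] list_of_tuple_nth[of "j - 1" k y]
    by (auto simp: list_all2_conv_all_nth)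
qed

section \<open>Parameters for large s and the application to the given families\<close>

lemma parameters_eventually:
  fixes C :: real
  assumes C: "C \<ge> 20"
  defines "b \<equiv> \<lambda>s. C / 2 * sqrt (real s * ln (real s))"
  shows "\<forall>\<^sub>F s in sequentially. s \<ge> 1000 \<and> b s / (6 * real s) \<le> 1/4000 \<and> 2 \<le> b s / (6 * real s) * b s \<and>
     7 \<le> b s \<and> 2 * b s \<le> real s - 2 \<and> 3 * b s ^ 3 \<le> (real s)\<^sup>2 \<and>
     2 * real s * exp (1 - 25/3 * ln (real s)) \<le> 1 / real s ^ 7 \<and>
     400 * (C / (3 * sqrt (real s / ln (real s)))) \<le> 1/100"
  unfolding eventually_conj_iff b_def
  using C by (intro conjI; real_asymp)

lemma exists_rainbow_matching:
  fixes C :: real and s n k :: nat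
  defines "b \<equiv> C / 2 * sqrt (real s * ln (real s))"
  assumes C: "C \<ge> 20" and s: "s \<ge> 1000"
    and par: "b / (6 * real s) \<le> 1/4000" "2 \<le> b / (6 * real s) * b" "7 \<le> b" "2 * b \<le> real s - 2"
      "3 * b ^ 3 \<le> (real s)\<^sup>2" "2 * real s * exp (1 - 25/3 * ln (real s)) \<le> 1 / real s ^ 7"
      "400 * (C / (3 * sqrt (real s / ln (real s)))) \<le> 1/100"
    and n: "n > 0" and k: "k > 0" "real k < C * real n / (3 * sqrt (real s / ln (real s)))"
    and sub: "\<And>i. i \<in> {1..s} \<Longrightarrow> \<F> i \<subseteq> tuples n k"
    and card: "\<And>i. i \<in> {1..s} \<Longrightarrow> min (real s - 1) (real i + 2 * b) * real n ^ (k - 1) < real (card (\<F> i))"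
  shows "\<exists>F. rainbow_matching k s \<F> F"
proof -
  define N where "N = n ^ (k - 1)"
  define As where "As = replicate k {1..n}"
  have N: "N > 0" "real N = real n ^ (k - 1)" using n by (simp_all add: N_def)
  have nN: "real n ^ k = real n * real N" using k(1) by (cases k) (auto simp: N(2))
  have lns: "ln (real s) > 0" using s by simp
  have board: "board n As" "length As = k" by (simp_all add: As_def board_def)
  have b0: "b > 0" using par(3) by simp
  have tight: "min (real s - 1) (real s + 2 * b) = real s - 1" using b0 by simp
  \<comment> \<open>The least integer above (s - 1) n^(k - 1). Trimming families to at most
    \<open>c\<close> members keeps the lower bounds, gives all tight families the same size and, as
    c <= s N, bounds every mean by s.\<close>
  define c where "c = (s - 1) * N + 1"
  have "\<exists>F\<subseteq>\<F> i. card F = min (card (\<F> i)) c \<and> finite F" if "i \<in> {1..s}" for i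
    using obtain_subset_with_card_n[of "min (card (\<F> i)) c" "\<F> i"] by (metis min.cobounded1)
  then obtain H where H: "\<And>i. i \<in> {1..s} \<Longrightarrow> H i \<subseteq> \<F> i"
      "\<And>i. i \<in> {1..s} \<Longrightarrow> card (H i) = min (card (\<F> i)) c" by metis
  define Fam where "Fam = (\<lambda>i. list_of_tuple k ` H i)"
  have fam_fits: "fits x As" if "i \<in> {1..s}" "x \<in> Fam i" for i x
    using that H(1) sub fits_list_of_tuple unfolding Fam_def As_def by blast
  have card_Fam: "card (Fam i) = min (card (\<F> i)) c" if "i \<in> {1..s}" for i
  proof -
    have "inj_on (list_of_tuple k) (H i)"
      using inj_on_subset[OF inj_on_list_of_tuple, of "H i" n k] H(1)[OF that] sub[OF that] by blast
    then show ?thesis using H(2)[OF that] by (simp add: Fam_def card_image)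
  qed
  have mean: "real N * (real n * bmean As (ind (Fam i))) = real (card (Fam i))" if "i \<in> {1..s}" for i
    using bmean_ind_card[OF board(1) n fam_fits[OF that]] by (simp add: board(2) nN mult_ac)
  have c_gt: "(real s - 1) * real N < real c" using s by (simp add: c_def)
  have lower: "min (real s - 1) (real i + 2 * b) < real n * bmean As (ind (Fam i))" if i: "i \<in> {1..s}" for i
  proof -
    have "min (real s - 1) (real i + 2 * b) * real N \<le> (real s - 1) * real N"
      by (intro mult_right_mono) auto
    then have "min (real s - 1) (real i + 2 * b) * real N < real c" using c_gt by linarith
    then have "min (real s - 1) (real i + 2 * b) * real N < real (card (Fam i))"
      using card[OF i] by (simp add: card_Fam[OF i] N(2) min_def)
    then have "real N * min (real s - 1) (real i + 2 * b) < real N * (real n * bmean As (ind (Fam i)))"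
      by (simp add: mean[OF i] mult.commute)
    then show ?thesis using N(1) by simp
  qed
  have upper: "real n * bmean As (ind (Fam i)) \<le> real s" if i: "i \<in> {1..s}" for i
  proof -
    have "c \<le> s * N" using N(1) s by (cases s) (auto simp: c_def)
    then have "card (Fam i) \<le> s * N" by (simp add: card_Fam[OF i])
    then have "real (card (Fam i)) \<le> real (s * N)" by (simp only: of_nat_le_iff)
    then have "real N * (real n * bmean As (ind (Fam i))) \<le> real N * real s"
      by (simp add: mean[OF i] mult.commute)
    then show ?thesis using N(1) by simp
  qed
  have tight_card: "card (Fam i) = c" if i: "i \<in> {1..s}" "real s - 1 \<le> real i + 2 * b" for i
  proof -
    have "(real s - 1) * real N < real (card (\<F> i))" using card[OF i(1)] i(2) by (simp add: N(2) min_def)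
    then have "real ((s - 1) * N) < real (card (\<F> i))" using s by simp
    then have "c \<le> card (\<F> i)" by (simp only: c_def of_nat_less_iff)
    then show ?thesis by (simp add: card_Fam[OF i(1)])
  qed
  have eq: "bmean As (ind (Fam i)) = bmean As (ind (Fam s))" if i: "i \<in> {1..s}" "real s - 1 \<le> real i + 2 * b" for i
  proof -
    have s1: "s \<in> {1..s}" using s by simp
    have "real N * (real n * bmean As (ind (Fam i))) = real N * (real n * bmean As (ind (Fam s)))"
      unfolding mean[OF i(1)] mean[OF s1] using tight_card[OF i] tight_card[OF s1] b0 by simp
    then show ?thesis using N(1) n by simp
  qed
  have ns: "s \<le> n"
  proof -
    have "real s - 1 < real n * bmean As (ind (Fam s))" using lower[of s] s tight by simp
    also have "\<dots> \<le> real n * 1" using n by (intro mult_left_mono bmean_le_const[OF board(1)]) auto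
    finally show ?thesis using s by linarith
  qed
  \<comment> \<open>The largest block length that the moment bounds permit. It is a fixed fraction
    of n, while k / n is small for large s, so the power below is at most exp(1/100).\<close>
  define m0 where "m0 = (n - 1) div 200"
  have m0: "m0 \<ge> 4" "200 * m0 \<le> n - 1" "real n \<le> 400 * (real m0 - 1)"
  proof -
    show 1: "m0 \<ge> 4" using ns s unfolding m0_def by simp
    show "200 * m0 \<le> n - 1" by (simp add: m0_def)
    have "n - 1 < 200 * m0 + 200" using div_mult_mod_eq[of "n - 1" 200] by (simp add: m0_def)
    then have "n + 400 \<le> 400 * m0" using 1 by linarith
    then have "real (n + 400) \<le> real (400 * m0)" by (simp only: of_nat_le_iff)
    then show "real n \<le> 400 * (real m0 - 1)" by simp
  qed
  have ratio: "(real m0 / real (m0 - 1)) ^ k \<le> 51/50"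
  proof -
    have m1: "real (m0 - 1) = real m0 - 1" "real m0 - 1 > 0" using m0(1) by auto
    have "real k * 400 \<le> (C * real n / (3 * sqrt (real s / ln (real s)))) * 400"
      using k(2) by (intro mult_right_mono) auto
    also have "\<dots> = 400 * (C / (3 * sqrt (real s / ln (real s)))) * real n" by simp
    also have "\<dots> \<le> 1/100 * real n" using par(7) by (intro mult_right_mono) auto
    finally have "real k \<le> 1/100 * (real m0 - 1)" using m0(3) by simp
    then have kx: "real k / (real m0 - 1) \<le> 1/100" using m1 by (simp add: field_simps)
    have "real m0 / real (m0 - 1) = 1 + 1 / (real m0 - 1)" using m1 by (simp add: field_simps)
    also have "\<dots> \<le> exp (1 / (real m0 - 1))" by (rule exp_ge_add_one_self)
    finally have "(real m0 / real (m0 - 1)) ^ k \<le> exp (1 / (real m0 - 1)) ^ k"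
      by (intro power_mono) auto
    also have "\<dots> = exp (real k / (real m0 - 1))" by (simp add: exp_of_nat_mult[symmetric])
    also have "\<dots> \<le> exp (1/100)" using kx by simp
    also have "\<dots> \<le> 51/50" using exp_bound[of "1/100"] by (simp add: power2_eq_square)
    finally show ?thesis .
  qed
  have k_bound: "real k * real s \<le> real n * (2 * b / 3)"
  proof -
    define q where "q = sqrt (real s / ln (real s))"
    have q0: "q > 0" using lns s by (simp add: q_def)
    have "q * sqrt (real s * ln (real s)) = real s"
      using lns by (simp add: q_def real_sqrt_mult[symmetric])
    then have "C * real n / (3 * q) * real s = real n * (2 * b / 3)"
      using q0 by (simp add: b_def field_simps)
    moreover have "real k * real s \<le> C * real n / (3 * q) * real s"
      using k(2) by (intro mult_right_mono) (auto simp: q_def)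
    ultimately show ?thesis by simp
  qed
  \<comment> \<open>The minimiser of 3 \<theta>^2 s - \<theta> b. The minimum is - C^2 ln s / 48,
    and C >= 20 makes it at most - 25/3 ln s, since 400 / 48 = 25/3.\<close>
  define \<theta> where "\<theta> = b / (6 * real s)"
  have tail: "2 * real s * exp (3 * \<theta>\<^sup>2 * real s + \<theta> - \<theta> * b) \<le> 1 / real s ^ 7"
  proof -
    have "400 \<le> C\<^sup>2" using power_mono[of 20 C 2] C by simp
    then have "400 * ln (real s) \<le> C\<^sup>2 * ln (real s)" using lns by (intro mult_right_mono) auto
    moreover have "3 * \<theta>\<^sup>2 * real s - \<theta> * b = - (b\<^sup>2 / (12 * real s))"
      using s by (simp add: \<theta>_def power2_eq_square field_simps)
    moreover have "b\<^sup>2 / (12 * real s) = C\<^sup>2 * ln (real s) / 48"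
      using s lns by (simp add: b_def power_mult_distrib power_divide real_sqrt_pow2 field_simps)
    ultimately have "3 * \<theta>\<^sup>2 * real s + \<theta> - \<theta> * b \<le> 1 - 25/3 * ln (real s)"
      using par(1) by (simp add: \<theta>_def)
    then have "2 * real s * exp (3 * \<theta>\<^sup>2 * real s + \<theta> - \<theta> * b) \<le> 2 * real s * exp (1 - 25/3 * ln (real s))"
      by (intro mult_left_mono) auto
    then show ?thesis using par(6) by linarith
  qed
  have fam: "families s n k m0 b \<theta> As Fam"
  proof -
    have "k \<ge> 1" "m0 \<ge> 2" "0 < \<theta>" "\<theta> \<le> 1/4000" "2 \<le> \<theta> * b"
      using k(1) m0(1) b0 s par(1,2) by (simp_all add: \<theta>_def)
    note facts = this board s m0(2) ratio par(3-5) tail k_bound lower upper eq fam_fits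
    show ?thesis by (rule families.intro) (fact facts)+
  qed
  obtain F where F: "\<And>i. i \<in> {1..s} \<Longrightarrow> F i \<in> Fam i"
    "\<And>i j. i \<in> {1..s} \<Longrightarrow> j \<in> {1..s} \<Longrightarrow> i \<noteq> j \<Longrightarrow> list_all2 (\<noteq>) (F i) (F j)"
    using families.rainbow_exists[OF fam] unfolding families.rainbow_def[OF fam] by blast
  have "\<exists>g. g \<in> \<F> i \<and> list_of_tuple k g = F i" if "i \<in> {1..s}" for i
    using F(1)[OF that] H(1)[OF that] unfolding Fam_def by auto
  then obtain g where g: "\<And>i. i \<in> {1..s} \<Longrightarrow> g i \<in> \<F> i" "\<And>i. i \<in> {1..s} \<Longrightarrow> list_of_tuple k (g i) = F i"
    by metis
  have "rainbow_matching k s \<F> g"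
    unfolding rainbow_matching_def disjoint_family_on_def
  proof (intro conjI ballI impI)
    fix i j assume ij: "i \<in> {1..s}" "j \<in> {1..s}" "i \<noteq> j"
    have "disjnt (tuple_set k (g i)) (tuple_set k (g j))"
      using F(2)[OF ij] g(2) ij by (intro list_of_tuple_disjnt) simp
    then show "tuple_set k (g i) \<inter> tuple_set k (g j) = {}" by (simp add: disjnt_def)
  qed (use g in auto)
  then show ?thesis by blast
qed

theorem theorem2:
  fixes C :: real
  assumes "C \<ge> 20"
  shows "\<exists>s0::nat. \<forall>s n k :: nat.
           s > s0 \<longrightarrow> n > 0 \<longrightarrow> k > 0 \<longrightarrow>
           real k < C * real n / (3 * sqrt (real s / ln (real s))) \<longrightarrow>
           satisfying n k s
             (\<lambda>i. min (real s - 1) (real i + C * sqrt (real s * ln (real s))) * real n ^ (k - 1))"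
proof -
  obtain s0 where s0: "\<And>s. s \<ge> s0 \<Longrightarrow> (let b = C / 2 * sqrt (real s * ln (real s)) in
     s \<ge> 1000 \<and> b / (6 * real s) \<le> 1/4000 \<and> 2 \<le> b / (6 * real s) * b \<and>
     7 \<le> b \<and> 2 * b \<le> real s - 2 \<and> 3 * b ^ 3 \<le> (real s)\<^sup>2 \<and>
     2 * real s * exp (1 - 25/3 * ln (real s)) \<le> 1 / real s ^ 7 \<and>
     400 * (C / (3 * sqrt (real s / ln (real s)))) \<le> 1/100)"
    using parameters_eventually[OF assms] unfolding eventually_sequentially Let_def by blast
  show ?thesis
  proof (intro exI[of _ s0] allI impI)
    fix s n k :: nat
    assume "s > s0" "n > 0" "k > 0" "real k < C * real n / (3 * sqrt (real s / ln (real s)))"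
    moreover from \<open>s > s0\<close> have "s \<ge> s0" by simp
    note s0[OF this, unfolded Let_def]
    ultimately show "satisfying n k s
        (\<lambda>i. min (real s - 1) (real i + C * sqrt (real s * ln (real s))) * real n ^ (k - 1))"
      unfolding satisfying_def using assms
      by (intro allI impI exists_rainbow_matching[of C s n k]) (simp_all add: algebra_simps)
  qed
qed

end
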